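(* Let $(\mathfrak H_1,J_1)$ and $(\mathfrak H_2,J_2)$ be Pontryagin spaces (so $\nu_-(J_1),\nu_-(J_2)<\infty$), $\mathfrak H=\mathfrak H_1\oplus\mathfrak H_2$, $J=\begin{pmatrix} J_1 & 0 \\ 0 & J_2 \end{pmatrix}$. Let $$T_1=\begin{pmatrix} T_{11} \\ T_{21} \end{pmatrix}:(\mathfrak H_1,J_1)\to\begin{pmatrix} (\mathfrak H_1,J_1) \\ (\mathfrak H_2,J_2) \end{pmatrix}$$ be a bounded symmetric operator, i.e. $T_{11}=T_{11}^{[*]}\in[(\mathfrak H_1,J_1)]$, with $\nu_-[I-T_{11}^2]=\kappa<\infty$, and let $J_{11}=J_{T_{11}}=\operatorname{sign}(J_1(I-T_{11}^2))$. Consider the pair of completion problems for $$A_\pm^0=\begin{pmatrix} I\pm T_{11} & \pm T_{21}^{[*]} \\ \pm T_{21} & \ast \end{pmatrix}$$ under the minimal index conditions $\nu_-[I+T]=\nu_-[I+T_{11}]$ and $\nu_-[I-T]=\nu_-[I-T_{11}]$, respectively. Then these completion problems have a solution $I\pm T$ for some $T=T^{[*]}$ with $\nu_-[I-T^2]=\kappa-\nu_-(J_2)$ if and only if $$\nu_-[I-T_{11}^2]=\nu_-[I-T_1^{[*]}T_1]+\nu_-(J_2).$$ If this condition is satisfied, then the following facts hold: (i) The completion problems for $A_+^0$ and $A_-^0$ have minimal solutions $A_+$ and $A_-$, respectively (with respect to the ordering $\le_{J_2}$). (ii) The operators $T_m:=A_+-I$ and $T_M:=I-A_-$ belong to $\operatorname{Ext}_{T_1,\kappa}(-1,1)_{J_2}$.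 (iii) The operators $T_m$ and $T_M$ have the block form $$T_m=\begin{pmatrix} T_{11} & J_1D_{T_{11}}V^* \\ J_2VD_{T_{11}} & -I+J_2V(I-L_{T_{11}}^*J_1)J_{11}V^* \end{pmatrix},$$ $$T_M=\begin{pmatrix} T_{11} & J_1D_{T_{11}}V^* \\ J_2VD_{T_{11}} & I-J_2V(I+L_{T_{11}}^*J_1)J_{11}V^* \end{pmatrix},$$ where $D_{T_{11}}:=|I-T_{11}^2|^{1/2}$ and $V:=\operatorname{clos}(J_2T_{21}D_{T_{11}}^{[-1]})$. (iv) The operators $T_m$ and $T_M$ are extremal extensions of $T_1$: $$T\in\operatorname{Ext}_{T_1,\kappa}(-1,1)_{J_2}\quad\text{iff}\quad T=T^{[*]}\in[(\mathfrak H,J)],\ \ T_m\le_{J_2}T\le_{J_2}T_M.$$ (v) The operators $T_m$ and $T_M$ are connected via $$(-T)_m=-T_M,\qquad(-T)_M=-T_m,$$ where $(-T)_m$ and $(-T)_M$ denote the operators $T_m$ and $T_M$ constructed for $-T_1$ in place of $T_1$.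
   Context: A Kreĭn space $(\mathcal H,J_{\mathcal H})$ is a Hilbert space with a fundamental symmetry $J_{\mathcal H}=J_{\mathcal H}^*=J_{\mathcal H}^{-1}$ and inner product $[\varphi,\psi]=(J_{\mathcal H}\varphi,\psi)$; it is a Pontryagin space here if $\nu_-(J_{\mathcal H})<\infty$. $[(\mathcal H,J_{\mathcal H})]$ denotes the bounded everywhere defined operators on $\mathcal H$. For bounded $X:\mathcal H\to\mathcal K$, $X^*$ is the Hilbert space adjoint and $X^{[*]}=J_{\mathcal H}X^*J_{\mathcal K}$ is the Kreĭn space adjoint (so $T_1^{[*]}=J_1T_1^*J$). For a bounded Hilbert-space selfadjoint $H$, $\nu_-(H)$ is the dimension of the spectral subspace corresponding to $(-\infty,0)$. For Kreĭn-selfadjoint $X$ in $(\mathcal H,J_{\mathcal H})$, $\nu_-[X]:=\nu_-(J_{\mathcal H}X)$; e.g. $\nu_-[I-T_{11}^2]=\nu_-(J_1(I-T_{11}^2))$, $\nu_-[I-T_1^{[*]}T_1]=\nu_-(J_1(I-T_1^{[*]}T_1))$, $\nu_-[I\pm T]=\nu_-(J(I\pm T))$. $|C|=(C^*C)^{1/2}$; $\operatorname{sign}(H)$ is defined by functional calculus with $\operatorname{sign}(t)=1$ for $t\ge0$ and $-1$ for $t<0$. For nonnegative bounded $D$, the Moore–Penrose inverse $D^{[-1]}$ has domain $\operatorname{ran}D\oplus\ker D$, vanishes on $\ker D$, and maps $y\in\operatorname{ran}D$ to the unique $x\in\overline{\operatorname{ran}}\,D$ with $Dx=y$. $\operatorname{clos}$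 is operator closure. Completion problems: one seeks $T=T^{[*]}\in[(\mathfrak H,J)]$ extending $T_1$ (first block column $T_1$, hence upper right block $T_{21}^{[*]}$) such that $A_+=I+T$ and $A_-=I-T$ complete $A_+^0$ and $A_-^0$ with the stated minimal index conditions. $\operatorname{Ext}_{T_1,\kappa}(-1,1)_{J_2}$ is the set of all such $T$, satisfying both conditions $\nu_-[I\pm T]=\nu_-[I\pm T_{11}]$. A solution of the single problem for $A_+^0$ (resp. $A_-^0$) is a Kreĭn-selfadjoint completion $A$ of it with $\nu_-[A]=\nu_-[I+T_{11}]$ (resp. $\nu_-[I-T_{11}]$), and "minimal" means smallest among these solutions. Ordering: for Kreĭn-selfadjoint $X,Y$, $X\ge Y$ means $[(X-Y)f,f]\ge0$ for all $f$. It is written $\le_{J_2}$ because for completions of the same incomplete operator it amounts to the ordering of the lower right blocks in $(\mathfrak H_2,J_2)$: $J_2(X_{22}-Y_{22})\ge0$. Defect and link operators of $T_{11}$: with $D_{T_{11}}=|J_1-T_{11}^*J_1T_{11}|^{1/2}=|I-T_{11}^2|^{1/2}$, $D_{T_{11}^*}=|J_1-T_{11}J_1T_{11}^*|^{1/2}$, $\mathfrak D_{T_{11}}=\overline{\operatorname{ran}}\,D_{T_{11}}$, $\mathfrak D_{T_{11}^*}=\overline{\operatorname{ran}}\,D_{T_{11}^*}$, the link operator $L_{T_{11}}:\mathfrak D_{T_{11}}\to\mathfrak D_{T_{11}^*}$ is the unique bounded operator with $D_{T_{11}^*}L_{T_{11}}=T_{11}J_1D_{T_{11}}\restriction\mathfrak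 D_{T_{11}}$. Its adjoint $L_{T_{11}}^*$ maps $\mathfrak D_{T_{11}^*}=J_1\mathfrak D_{T_{11}}$ to $\mathfrak D_{T_{11}}$, and $\operatorname{ran}V^*\subset\mathfrak D_{T_{11}}$, so the expressions in (iii) make sense. *)

theory Defs
  imports "HOL-Analysis.Analysis" "HOL-Library.Function_Algebras" "HOL-Library.Extended_Nat"
begin

section \<open>Complex Hilbert spaces\<close>

text \<open>
  A complex Hilbert space is presented as a complete real inner product space carrying a
  compatible complex scalar multiplication and a sesquilinear inner product (linear in the first
  argument) whose real part is the underlying real inner product. Norm, topology and completeness
  are therefore those of the library; in particular \<open>(norm x)\<^sup>2 = cinner x x\<close>.
\<close>

class complex_hilbert = real_inner + complete_space +
  fixes scaleC :: "complex \<Rightarrow> 'a \<Rightarrow> 'a"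
    and cinner :: "'a \<Rightarrow> 'a \<Rightarrow> complex"
  assumes scaleC_add_right: "scaleC c (x + y) = scaleC c x + scaleC c y"
    and scaleC_add_left: "scaleC (c + d) x = scaleC c x + scaleC d x"
    and scaleC_scaleC: "scaleC c (scaleC d x) = scaleC (c * d) x"
    and scaleC_of_real: "scaleC (complex_of_real r) x = scaleR r x"
    and cinner_commute: "cinner x y = cnj (cinner y x)"
    and cinner_add_left: "cinner (x + y) z = cinner x z + cinner y z"
    and cinner_scaleC_left: "cinner (scaleC c x) y = c * cinner x y"
    and inner_eq_Re_cinner: "inner x y = Re (cinner x y)"

lemma vector_space_scaleC: "vector_space (scaleC :: complex \<Rightarrow> 'a::complex_hilbert \<Rightarrow> 'a)"
proof
  show "scaleC 1 x = x" for x :: 'a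
    using scaleC_of_real[of 1 x] by simp
qed (simp_all add: scaleC_add_right scaleC_add_left scaleC_scaleC)

instantiation complex :: complex_hilbert
begin
definition "scaleC (c::complex) (x::complex) = c * x"
definition "cinner (x::complex) (y::complex) = x * cnj y"
instance
  by standard (auto simp: scaleC_complex_def cinner_complex_def algebra_simps
      inner_complex_def scaleR_conv_of_real)
end

text \<open>The orthogonal sum of two Hilbert spaces is the product type.\<close>

instantiation prod :: (complex_hilbert, complex_hilbert) complex_hilbert
begin
definition "scaleC c (x :: 'a \<times> 'b) = (scaleC c (fst x), scaleC c (snd x))"
definition "cinner (x :: 'a \<times> 'b) y = cinner (fst x) (fst y) + cinner (snd x) (snd y)"
instance
proof
  show "cinner x y = cnj (cinner y x)" for x y :: "'a \<times> 'b"
    unfolding cinner_prod_def complex_cnj_add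
    by (metis cinner_commute)
qed (auto simp: scaleC_prod_def cinner_prod_def scaleC_add_right scaleC_add_left scaleC_scaleC
      scaleC_of_real cinner_add_left cinner_scaleC_left inner_prod_def inner_eq_Re_cinner
      algebra_simps scaleR_prod_def)
end

text \<open>Complex dimension; all infinite dimensions are identified.\<close>

definition cdim :: "'a::complex_hilbert set \<Rightarrow> enat" where
  "cdim S = (if \<exists>B. finite B \<and> S \<subseteq> module.span scaleC B
             then enat (vector_space.dim scaleC S) else \<infinity>)"


section \<open>Bounded operators\<close>

definition bounded_clinear :: "('a::complex_hilbert \<Rightarrow> 'b::complex_hilbert) \<Rightarrow> bool" where
  "bounded_clinear A \<longleftrightarrow> bounded_linear A \<and> (\<forall>c x. A (scaleC c x) = scaleC c (A x))"

definition cadj :: "('a::complex_hilbert \<Rightarrow> 'b::complex_hilbert) \<Rightarrow> 'b \<Rightarrow> 'a" where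
  "cadj A = (THE B. \<forall>x y. cinner (A x) y = cinner x (B y))"

definition selfadjoint :: "('a::complex_hilbert \<Rightarrow> 'a) \<Rightarrow> bool" where
  "selfadjoint A \<longleftrightarrow> bounded_clinear A \<and> cadj A = A"

definition nonneg_op :: "('a::complex_hilbert \<Rightarrow> 'a) \<Rightarrow> bool" where
  "nonneg_op A \<longleftrightarrow> selfadjoint A \<and> (\<forall>x. 0 \<le> Re (cinner (A x) x))"

definition orth_projection :: "('a::complex_hilbert \<Rightarrow> 'a) \<Rightarrow> bool" where
  "orth_projection P \<longleftrightarrow> selfadjoint P \<and> P \<circ> P = P"

definition op_sqrt :: "('a::complex_hilbert \<Rightarrow> 'a) \<Rightarrow> 'a \<Rightarrow> 'a" where
  "op_sqrt A = (THE B. nonneg_op B \<and> B \<circ> B = A)"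

definition op_abs :: "('a::complex_hilbert \<Rightarrow> 'a) \<Rightarrow> 'a \<Rightarrow> 'a" where
  "op_abs C = op_sqrt (cadj C \<circ> C)"


section \<open>Spectral family and functional calculus of a bounded selfadjoint operator\<close>

text \<open>
  \<open>E\<close> is the resolution of the identity of \<open>H\<close>: a nondecreasing, strongly right-continuous family
  of orthogonal projections with \<open>H = \<integral> t dE(t)\<close>, the integral being taken weakly, i.e. against
  the Lebesgue-Stieltjes measures of the functions \<open>t \<mapsto> (E(t)x,x)\<close>. Such a family exists and is
  unique by the spectral theorem.
\<close>

definition stieltjes :: "(real \<Rightarrow> 'a::complex_hilbert \<Rightarrow> 'a) \<Rightarrow> 'a \<Rightarrow> real measure" where
  "stieltjes E x = interval_measure (\<lambda>t. Re (cinner (E t x) x))"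

definition is_spectral_family ::
    "('a::complex_hilbert \<Rightarrow> 'a) \<Rightarrow> (real \<Rightarrow> 'a \<Rightarrow> 'a) \<Rightarrow> bool" where
  "is_spectral_family H E \<longleftrightarrow>
     (\<forall>t. orth_projection (E t)) \<and>
     (\<forall>s t. s \<le> t \<longrightarrow> range (E s) \<subseteq> range (E t)) \<and>
     (\<forall>t x. ((\<lambda>s. E s x) \<longlongrightarrow> E t x) (at_right t)) \<and>
     (\<exists>r. (\<forall>t < - r. E t = 0) \<and> (\<forall>t\<ge>r. E t = id)) \<and>
     (\<forall>x. cinner (H x) x = complex_of_real (\<integral>t. t \<partial>stieltjes E x))"

definition spectral_family :: "('a::complex_hilbert \<Rightarrow> 'a) \<Rightarrow> real \<Rightarrow> 'a \<Rightarrow> 'a" where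
  "spectral_family H = (SOME E. is_spectral_family H E)"

text \<open>
  \<open>f(H) = \<integral> f(t) dE(t)\<close> for real-valued Borel functions \<open>f\<close> bounded on bounded sets; over the
  complex scalars a bounded operator is determined by its quadratic form.
\<close>

definition fun_calc :: "(real \<Rightarrow> real) \<Rightarrow> ('a::complex_hilbert \<Rightarrow> 'a) \<Rightarrow> 'a \<Rightarrow> 'a" where
  "fun_calc f H = (THE A. bounded_clinear A \<and>
     (\<forall>x. cinner (A x) x = complex_of_real (\<integral>t. f t \<partial>stieltjes (spectral_family H) x)))"

definition spectral_subspace :: "('a::complex_hilbert \<Rightarrow> 'a) \<Rightarrow> real set \<Rightarrow> 'a set" where
  "spectral_subspace H B = range (fun_calc (indicat_real B) H)"

definition nu_minus :: "('a::complex_hilbert \<Rightarrow> 'a) \<Rightarrow> enat" where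
  "nu_minus H = cdim (spectral_subspace H {..<0})"

text \<open>Not the library's \<open>sgn\<close>, which vanishes at 0.\<close>

definition op_sign :: "('a::complex_hilbert \<Rightarrow> 'a) \<Rightarrow> 'a \<Rightarrow> 'a" where
  "op_sign H = fun_calc (\<lambda>t. if 0 \<le> t then 1 else -1) H"


section \<open>Krein and Pontryagin spaces\<close>

definition fundamental_symmetry :: "('a::complex_hilbert \<Rightarrow> 'a) \<Rightarrow> bool" where
  "fundamental_symmetry J \<longleftrightarrow> selfadjoint J \<and> J \<circ> J = id"

definition pontryagin_space :: "('a::complex_hilbert \<Rightarrow> 'a) \<Rightarrow> bool" where
  "pontryagin_space J \<longleftrightarrow> fundamental_symmetry J \<and> nu_minus J < \<infinity>"

definition krein_inner :: "('a::complex_hilbert \<Rightarrow> 'a) \<Rightarrow> 'a \<Rightarrow> 'a \<Rightarrow> complex" where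
  "krein_inner J x y = cinner (J x) y"

text \<open>Adjoint of \<open>X : (H, JH) \<rightarrow> (K, JK)\<close>.\<close>

definition kadj :: "('a::complex_hilbert \<Rightarrow> 'a) \<Rightarrow> ('b::complex_hilbert \<Rightarrow> 'b) \<Rightarrow>
    ('a \<Rightarrow> 'b) \<Rightarrow> 'b \<Rightarrow> 'a" where
  "kadj JH JK X = JH \<circ> cadj X \<circ> JK"

definition krein_selfadjoint :: "('a::complex_hilbert \<Rightarrow> 'a) \<Rightarrow> ('a \<Rightarrow> 'a) \<Rightarrow> bool" where
  "krein_selfadjoint J X \<longleftrightarrow> bounded_clinear X \<and> kadj J J X = X"

definition krein_nu :: "('a::complex_hilbert \<Rightarrow> 'a) \<Rightarrow> ('a \<Rightarrow> 'a) \<Rightarrow> enat" where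
  "krein_nu J X = nu_minus (J \<circ> X)"

text \<open>
  The order \<open>X \<le> Y\<close> of Krein-selfadjoint operators. The form below is real for such operators, so
  that taking the real part loses nothing.
\<close>

definition krein_le :: "('a::complex_hilbert \<Rightarrow> 'a) \<Rightarrow> ('a \<Rightarrow> 'a) \<Rightarrow> ('a \<Rightarrow> 'a) \<Rightarrow> bool" where
  "krein_le J X Y \<longleftrightarrow> (\<forall>f. 0 \<le> Re (krein_inner J ((Y - X) f) f))"


section \<open>Block operators and completion problems\<close>

definition col_op :: "('c \<Rightarrow> 'a) \<Rightarrow> ('c \<Rightarrow> 'b) \<Rightarrow> 'c \<Rightarrow> 'a \<times> 'b" where
  "col_op A B x = (A x, B x)"

definition block_op :: "('a \<Rightarrow> 'a::plus) \<Rightarrow> ('b \<Rightarrow> 'a) \<Rightarrow> ('a \<Rightarrow> 'b) \<Rightarrow> ('b \<Rightarrow> 'b::plus) \<Rightarrow>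
    'a \<times> 'b \<Rightarrow> 'a \<times> 'b" where
  "block_op A B C D = (\<lambda>(x, y). (A x + B y, C x + D y))"

definition diag_symmetry :: "('a::complex_hilbert \<Rightarrow> 'a) \<Rightarrow> ('b::complex_hilbert \<Rightarrow> 'b) \<Rightarrow>
    'a \<times> 'b \<Rightarrow> 'a \<times> 'b" where
  "diag_symmetry J1 J2 = block_op J1 0 0 J2"

text \<open>
  Krein-selfadjoint completions of the incomplete operator with first column \<open>(A11, A21)\<close> and
  upper right block \<open>A21\<^sup>[\<^sup>*\<^sup>]\<close>, of minimal negative index.
\<close>

definition completion_solutions ::
    "('a::complex_hilbert \<Rightarrow> 'a) \<Rightarrow> ('b::complex_hilbert \<Rightarrow> 'b) \<Rightarrow> ('a \<Rightarrow> 'a) \<Rightarrow> ('a \<Rightarrow> 'b) \<Rightarrow>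
     ('a \<times> 'b \<Rightarrow> 'a \<times> 'b) set" where
  "completion_solutions J1 J2 A11 A21 =
     {A. krein_selfadjoint (diag_symmetry J1 J2) A \<and>
         (\<exists>A22. A = block_op A11 (kadj J1 J2 A21) A21 A22) \<and>
         krein_nu (diag_symmetry J1 J2) A = krein_nu J1 A11}"

definition is_minimal_completion ::
    "('a::complex_hilbert \<Rightarrow> 'a) \<Rightarrow> ('b::complex_hilbert \<Rightarrow> 'b) \<Rightarrow> ('a \<Rightarrow> 'a) \<Rightarrow> ('a \<Rightarrow> 'b) \<Rightarrow>
     ('a \<times> 'b \<Rightarrow> 'a \<times> 'b) \<Rightarrow> bool" where
  "is_minimal_completion J1 J2 A11 A21 A \<longleftrightarrow>
     A \<in> completion_solutions J1 J2 A11 A21 \<and>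
     (\<forall>B \<in> completion_solutions J1 J2 A11 A21. krein_le (diag_symmetry J1 J2) A B)"

definition minimal_completion ::
    "('a::complex_hilbert \<Rightarrow> 'a) \<Rightarrow> ('b::complex_hilbert \<Rightarrow> 'b) \<Rightarrow> ('a \<Rightarrow> 'a) \<Rightarrow> ('a \<Rightarrow> 'b) \<Rightarrow>
     'a \<times> 'b \<Rightarrow> 'a \<times> 'b" where
  "minimal_completion J1 J2 A11 A21 = (THE A. is_minimal_completion J1 J2 A11 A21 A)"

definition Ext ::
    "('a::complex_hilbert \<Rightarrow> 'a) \<Rightarrow> ('b::complex_hilbert \<Rightarrow> 'b) \<Rightarrow> ('a \<Rightarrow> 'a) \<Rightarrow> ('a \<Rightarrow> 'b) \<Rightarrow>
     ('a \<times> 'b \<Rightarrow> 'a \<times> 'b) set" where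
  "Ext J1 J2 T11 T21 =
     {T. krein_selfadjoint (diag_symmetry J1 J2) T \<and>
         (\<forall>x. T (x, 0) = col_op T11 T21 x) \<and>
         id + T \<in> completion_solutions J1 J2 (id + T11) T21 \<and>
         id - T \<in> completion_solutions J1 J2 (id - T11) (- T21)}"

definition T_min ::
    "('a::complex_hilbert \<Rightarrow> 'a) \<Rightarrow> ('b::complex_hilbert \<Rightarrow> 'b) \<Rightarrow> ('a \<Rightarrow> 'a) \<Rightarrow> ('a \<Rightarrow> 'b) \<Rightarrow>
     'a \<times> 'b \<Rightarrow> 'a \<times> 'b" where
  "T_min J1 J2 T11 T21 = minimal_completion J1 J2 (id + T11) T21 - id"

definition T_max ::
    "('a::complex_hilbert \<Rightarrow> 'a) \<Rightarrow> ('b::complex_hilbert \<Rightarrow> 'b) \<Rightarrow> ('a \<Rightarrow> 'a) \<Rightarrow> ('a \<Rightarrow> 'b) \<Rightarrow>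
     'a \<times> 'b \<Rightarrow> 'a \<times> 'b" where
  "T_max J1 J2 T11 T21 = id - minimal_completion J1 J2 (id - T11) (- T21)"


section \<open>Unbounded operators as graphs\<close>

definition op_graph :: "('a \<Rightarrow> 'b) \<Rightarrow> ('a \<times> 'b) set" where
  "op_graph A = {(x, A x) | x. True}"

text \<open>
  Moore-Penrose inverse of a nonnegative operator: on \<open>ran D \<oplus> ker D\<close> it sends \<open>D x + z\<close>, with \<open>x\<close>
  in the closed range and \<open>D z = 0\<close>, to \<open>x\<close>. (As \<open>ker D\<close> is the orthogonal complement of the closed
  range, every element of \<open>ran D\<close> is \<open>D x\<close> for exactly one such \<open>x\<close>.)
\<close>

definition mp_inverse_graph :: "('a::complex_hilbert \<Rightarrow> 'a) \<Rightarrow> ('a \<times> 'a) set" where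
  "mp_inverse_graph D = {(D x + z, x) | x z. x \<in> closure (range D) \<and> D z = 0}"

text \<open>The operator closure of \<open>A D\<^sup>[\<^sup>-\<^sup>1\<^sup>]\<close>, as a graph.\<close>

definition clos_comp_mp_inverse ::
    "('a::complex_hilbert \<Rightarrow> 'b::complex_hilbert) \<Rightarrow> ('a \<Rightarrow> 'a) \<Rightarrow> ('a \<times> 'b) set" where
  "clos_comp_mp_inverse A D = closure (mp_inverse_graph D O op_graph A)"


section \<open>Defect and link operators\<close>

definition defect_op :: "('a::complex_hilbert \<Rightarrow> 'a) \<Rightarrow> ('a \<Rightarrow> 'a) \<Rightarrow> 'a \<Rightarrow> 'a" where
  "defect_op J T = op_sqrt (op_abs (J - (cadj T \<circ> J \<circ> T)))"

definition defect_op_adj :: "('a::complex_hilbert \<Rightarrow> 'a) \<Rightarrow> ('a \<Rightarrow> 'a) \<Rightarrow> 'a \<Rightarrow> 'a" where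
  "defect_op_adj J T = op_sqrt (op_abs (J - (T \<circ> J \<circ> cadj T)))"

text \<open>
  The link operator acts between the closed ranges of \<open>defect_op J T\<close> and \<open>defect_op_adj J T\<close>; here
  it is extended by zero to the orthogonal complement \<open>ker (defect_op J T)\<close>. On the closed range of
  \<open>defect_op_adj J T\<close>, the adjoint of this extension is the adjoint of the link operator proper.
\<close>

definition link_op :: "('a::complex_hilbert \<Rightarrow> 'a) \<Rightarrow> ('a \<Rightarrow> 'a) \<Rightarrow> 'a \<Rightarrow> 'a" where
  "link_op J T = (THE L. bounded_clinear L \<and>
     (\<forall>x \<in> closure (range (defect_op J T)).
        L x \<in> closure (range (defect_op_adj J T)) \<and>
        defect_op_adj J T (L x) = T (J (defect_op J T x))) \<and>
     (\<forall>x. defect_op J T x = 0 \<longrightarrow> L x = 0))"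

end

theory Submission
  imports Defs
begin

text \<open>
  Everything is reduced to quadratic forms: \<open>nu_minus H\<close> is the largest dimension on which
  \<open>(H x, x)\<close> is negative. With \<open>H = J\<^sub>1 (I - T\<^sub>1\<^sub>1\<^sup>2)\<close>, \<open>D = |H|\<^sup>1\<^sup>/\<^sup>2\<close> and \<open>S = sign H\<close> one has
  \<open>H = A X\<close> for \<open>A = J\<^sub>1 (I \<plusminus> T\<^sub>1\<^sub>1)\<close>, \<open>X = I \<minusplus> T\<^sub>1\<^sub>1\<close>, and \<open>D X = Y D\<close> for a bounded \<open>Y\<close>. Hence, for
  \<open>v = S D w\<close>, the form of the block operator \<open>(A, D; D, Y S)\<close> at \<open>(u, v)\<close> is that of \<open>A\<close> at
  \<open>u + X w\<close>, and such \<open>v\<close> are dense in the closed range of \<open>D\<close>. If \<open>nu_minus A\<close> is finite, the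
  spectral gap of \<open>A\<close> below 0 lets the negative index pass to the closure, and this identifies the
  completions of minimal index as those with lower right corner at least \<open>V Y S V\<^sup>*\<close>. The same
  statement with \<open>A = H\<close>, \<open>X = I\<close> yields \<open>V S V\<^sup>* \<le> J\<^sub>2\<close>, which makes the two minimal completions
  compatible. The factor \<open>V\<close> exists because the index condition bounds \<open>T\<^sub>2\<^sub>1\<close> by \<open>D\<close>.
\<close>

section \<open>Complex Hilbert spaces\<close>

text \<open>The obstacle is that \<open>A\<close> need not be invertible and \<open>D\<close> need
  not have closed range, so no Schur complement is available: along a sequence \<open>w\<close> with
  \<open>S (D w)\<close> convergent, \<open>X w\<close> may diverge. A bound on the negative index
  is not by itself a condition that passes to the limit. The gap replaces it by the inequality -|Q
  (A u + C' f)|^2 <= \<delta> (block form at (u, f)), where \<open>Q\<close> is the negative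
  spectral projection of \<open>A\<close>, C the lower left block and primes denote adjoints. For
  the vectors used, both sides depend on \<open>w\<close> only through \<open>S (D w)\<close>, so
  the inequality survives the limit. The operator \<open>Y\<close> is the identity minus or plus
  \<open>W\<close>, where \<open>W D = D T11\<close>. Taking adjoints and using T11' = J1 T11 J1
  shows that the link operator is J1 W', so \<open>W\<close> is the factor L' J1 of the block
  formulas. The index identity for I - T^2, applied to T and to T11, gives nu(I - T^2) + nu(J2) =
  \<kappa> for every T in \<open>Ext\<close>. The equivalence therefore amounts to asking when
  \<open>Ext\<close> is nonempty.\<close>

interpretation cvec: vector_space "scaleC :: complex \<Rightarrow> 'a \<Rightarrow> 'a::complex_hilbert"
  by (rule vector_space_scaleC)

interpretation cvec_pair: vector_space_pair
  "scaleC :: complex \<Rightarrow> 'a \<Rightarrow> 'a::complex_hilbert" "scaleC :: complex \<Rightarrow> 'b \<Rightarrow> 'b::complex_hilbert"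
  by unfold_locales

lemma cinner_scaleC_right: "cinner x (scaleC c y) = cnj c * cinner (x::'a::complex_hilbert) y"
  by (metis cinner_commute cinner_scaleC_left complex_cnj_mult)

lemma Im_cinner: "Im (cinner x y) = inner (x::'a::complex_hilbert) (scaleC \<i> y)"
  by (simp add: inner_eq_Re_cinner cinner_scaleC_right)

lemma cinner_eq_inner:
  "cinner x y = Complex (inner x y) (inner (x::'a::complex_hilbert) (scaleC \<i> y))"
  by (simp add: complex_eq_iff Im_cinner inner_eq_Re_cinner)

lemma inner_scaleC_ii: "inner (scaleC \<i> x) y = - inner (x::'a::complex_hilbert) (scaleC \<i> y)"
  by (simp add: inner_eq_Re_cinner cinner_scaleC_right cinner_scaleC_left)

lemma inner_scaleC_scaleC:
  "inner (scaleC c x) (scaleC c y) = (cmod c)\<^sup>2 * inner (x::'a::complex_hilbert) y"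
proof -
  have "cinner (scaleC c x) (scaleC c y) = complex_of_real ((cmod c)\<^sup>2) * cinner x y"
    unfolding complex_norm_square by (simp add: cinner_scaleC_left cinner_scaleC_right)
  then show ?thesis by (simp add: inner_eq_Re_cinner del: of_real_power)
qed

lemma norm_scaleC: "norm (scaleC c (x::'a::complex_hilbert)) = cmod c * norm x"
proof -
  have "(norm (scaleC c x))\<^sup>2 = (cmod c * norm x)\<^sup>2"
    by (simp add: power2_norm_eq_inner power_mult_distrib inner_scaleC_scaleC)
  then show ?thesis
    by (simp add: power2_eq_iff_nonneg)
qed

lemma bounded_linear_scaleC: "bounded_linear (scaleC c :: 'a::complex_hilbert \<Rightarrow> 'a)"
proof (rule bounded_linear_intro)
  show "scaleC c (r *\<^sub>R x) = r *\<^sub>R scaleC c (x::'a)" for r x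
    by (simp add: scaleC_of_real[symmetric] scaleC_scaleC mult.commute)
  show "norm (scaleC c x) \<le> norm x * cmod c" for x :: 'a
    by (simp add: norm_scaleC)
qed (rule scaleC_add_right)

section \<open>Bounded complex-linear operators\<close>

lemma bounded_clinear_linear: "bounded_clinear A \<Longrightarrow> bounded_linear A"
  by (simp add: bounded_clinear_def)

lemma bounded_clinear_scaleC: "bounded_clinear A \<Longrightarrow> A (scaleC c x) = scaleC c (A x)"
  by (simp add: bounded_clinear_def)

lemma bounded_clinear_add: "bounded_clinear A \<Longrightarrow> A (x + y) = A x + A y"
  by (meson bounded_clinear_linear linear_simps(1))

lemma bounded_clinear_diff: "bounded_clinear A \<Longrightarrow> A (x - y) = A x - A y"
  by (meson bounded_clinear_linear linear_simps(2))

lemma bounded_clinear_neg: "bounded_clinear A \<Longrightarrow> A (- x) = - A x"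
  by (meson bounded_clinear_linear linear_simps(4))

lemma bounded_clinear_0: "bounded_clinear A \<Longrightarrow> A 0 = 0"
  by (meson bounded_clinear_linear linear_simps(3))

lemma bounded_clinear_scaleR: "bounded_clinear A \<Longrightarrow> A (r *\<^sub>R x) = r *\<^sub>R A x"
  by (meson bounded_clinear_linear linear_simps(5))

lemmas clinear_simps = bounded_clinear_scaleC bounded_clinear_add bounded_clinear_diff
  bounded_clinear_neg bounded_clinear_0 bounded_clinear_scaleR

lemma bounded_clinear_tendsto:
  "bounded_clinear A \<Longrightarrow> (f \<longlongrightarrow> l) F \<Longrightarrow> ((\<lambda>n. A (f n)) \<longlongrightarrow> A l) F"
  using bounded_linear.tendsto bounded_clinear_linear by blast

lemma bounded_clinear_bound:
  assumes "bounded_clinear A" obtains K where "K > 0" "\<And>x. norm (A x) \<le> K * norm x"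
  using bounded_linear.pos_bounded[OF bounded_clinear_linear[OF assms]]
  by (metis mult.commute)

lemma bounded_clinearI:
  assumes "\<And>x y. A (x + y) = A x + A y" "\<And>c x. A (scaleC c x) = scaleC c (A x)"
    "\<And>x. norm (A x) \<le> K * norm x"
  shows "bounded_clinear A"
  unfolding bounded_clinear_def
proof
  show "bounded_linear A"
  proof (rule bounded_linear_intro)
    show "A (r *\<^sub>R x) = r *\<^sub>R A x" for r x
      by (metis assms(2) scaleC_of_real)
    show "norm (A x) \<le> norm x * K" for x
      by (metis assms(3) mult.commute)
  qed (rule assms)
qed (use assms in auto)

lemma bounded_clinear_id [intro!]: "bounded_clinear id"
  by (rule bounded_clinearI[of _ 1]) auto

lemma bounded_clinear_zero [intro!]: "bounded_clinear 0"
  by (rule bounded_clinearI[of _ 1]) auto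

lemma bounded_clinear_comp [intro!]:
  "bounded_clinear A \<Longrightarrow> bounded_clinear B \<Longrightarrow> bounded_clinear (A \<circ> B)"
  unfolding bounded_clinear_def by (auto simp: comp_def intro: bounded_linear_compose)

lemma bounded_clinear_plus [intro!]:
  "bounded_clinear A \<Longrightarrow> bounded_clinear B \<Longrightarrow> bounded_clinear (A + B)"
  unfolding bounded_clinear_def
  by (auto simp: plus_fun_def scaleC_add_right intro: bounded_linear_add)

lemma bounded_clinear_minus [intro!]:
  "bounded_clinear A \<Longrightarrow> bounded_clinear B \<Longrightarrow> bounded_clinear (A - B)"
  unfolding bounded_clinear_def
  by (auto simp: fun_diff_def cvec.scale_right_diff_distrib intro: bounded_linear_sub)

lemma bounded_clinear_uminus [intro!]: "bounded_clinear A \<Longrightarrow> bounded_clinear (- A)"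
  unfolding bounded_clinear_def
  by (auto simp: fun_Compl_def intro: bounded_linear_minus)

lemma bounded_clinear_scaleR_fun:
  "bounded_clinear A \<Longrightarrow> bounded_clinear (\<lambda>x. r *\<^sub>R A x)"
  unfolding bounded_clinear_def
  by (auto simp: scaleC_of_real[symmetric] scaleC_scaleC mult.commute
      intro: bounded_linear_const_scaleR bounded_linear_compose[OF bounded_linear_scaleC])

lemma bounded_clinear_limit:
  fixes L :: "'a::complex_hilbert \<Rightarrow> 'b::complex_hilbert"
  assumes "\<And>n. bounded_clinear (X n)" "\<And>n x. norm (X n x) \<le> K * norm x"
    "\<And>x. (\<lambda>n::nat. X n x) \<longlonglongrightarrow> L x"
  shows "bounded_clinear L" "norm (L x) \<le> K * norm x"
proof -
  show b: "norm (L x) \<le> K * norm x" for x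
    using LIMSEQ_le_const2[OF tendsto_norm[OF assms(3)]] assms(2) by blast
  show "bounded_clinear L"
  proof (rule bounded_clinearI[OF _ _ b])
    show "L (x + y) = L x + L y" for x y
      using LIMSEQ_unique[OF assms(3)[of "x + y"]] tendsto_add[OF assms(3)[of x] assms(3)[of y]]
      by (simp add: clinear_simps[OF assms(1)])
    show "L (scaleC c x) = scaleC c (L x)" for c x
      using LIMSEQ_unique[OF assms(3)[of "scaleC c x"]]
        bounded_linear.tendsto[OF bounded_linear_scaleC assms(3)[of x], of c]
      by (simp add: clinear_simps[OF assms(1)])
  qed
qed

section \<open>Orthogonal projections and adjoints\<close>

lemma csubspace_subspace: "cvec.subspace S \<Longrightarrow> subspace (S::'a::complex_hilbert set)"
  unfolding subspace_def by (metis cvec.subspace_def scaleC_of_real)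

text \<open>A minimizing sequence is Cauchy by the parallelogram law, since the midpoint of two of
  its terms again lies in \<open>S\<close>. At the limit no shift along \<open>s\<close> can shorten
  the distance, which forces orthogonality.\<close>

lemma closest_point_exists:
  fixes S :: "'a::complex_hilbert set"
  assumes S: "subspace S" "closed S"
  shows "\<exists>y\<in>S. \<forall>s\<in>S. inner (x - y) s = 0"
proof -
  define d where "d = infdist x S"
  have ne: "S \<noteq> {}" using S(1) subspace_0 by blast
  have le: "d \<le> dist x s" if "s \<in> S" for s
    using that by (simp add: d_def infdist_le)
  have "\<exists>s\<in>S. dist x s < d + 1 / Suc n" for n
  proof -
    have "(INF a\<in>S. dist x a) < d + 1 / Suc n"
      using ne by (simp add: d_def infdist_def)
    then show ?thesis
      by (subst (asm) cInf_less_iff) (use ne in \<open>auto intro: bdd_belowI2[of _ 0]\<close>)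
  qed
  then obtain y where y: "\<And>n. y n \<in> S" "\<And>n. dist x (y n) < d + 1 / Suc n" by metis
  have d0: "0 \<le> d" by (simp add: d_def infdist_nonneg)
  have par: "(dist (y m) (y n))\<^sup>2 \<le> 2 * (dist x (y m))\<^sup>2 + 2 * (dist x (y n))\<^sup>2 - 4 * d\<^sup>2" for m n
  proof -
    have mem: "(1/2) *\<^sub>R (y m + y n) \<in> S"
      using S(1) y(1) by (simp add: subspace_add subspace_scale)
    have "d\<^sup>2 \<le> (dist x ((1/2) *\<^sub>R (y m + y n)))\<^sup>2"
      using le[OF mem] d0 by (simp add: power_mono)
    also have "4 * (dist x ((1/2) *\<^sub>R (y m + y n)))\<^sup>2
        = 2 * (dist x (y m))\<^sup>2 + 2 * (dist x (y n))\<^sup>2 - (dist (y m) (y n))\<^sup>2"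
      by (simp add: dist_norm power2_norm_eq_inner algebra_simps inner_commute)
    finally show ?thesis by linarith
  qed
  have lim: "(\<lambda>n. dist x (y n)) \<longlonglongrightarrow> d"
  proof (rule tendsto_sandwich[of "\<lambda>_. d" _ _ "\<lambda>n. d + 1 / Suc n"])
    show "(\<lambda>n. d + 1 / real (Suc n)) \<longlonglongrightarrow> d"
      using tendsto_add[OF tendsto_const[of d] LIMSEQ_inverse_real_of_nat]
      by (simp add: inverse_eq_divide)
  qed (use le y(1) less_imp_le[OF y(2)] in \<open>auto intro!: always_eventually\<close>)
  have "Cauchy y"
  proof (rule metric_CauchyI)
    fix e :: real assume e: "0 < e"
    have "(\<lambda>n. (dist x (y n))\<^sup>2) \<longlonglongrightarrow> d\<^sup>2" using lim by (intro tendsto_intros)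
    then obtain N where N: "\<And>n. n \<ge> N \<Longrightarrow> (dist x (y n))\<^sup>2 < d\<^sup>2 + e\<^sup>2 / 4"
      using order_tendstoD(2)[of _ "d\<^sup>2" sequentially "d\<^sup>2 + e\<^sup>2/4"] e
      by (auto simp: eventually_sequentially)
    have "dist (y m) (y n) < e" if "m \<ge> N" "n \<ge> N" for m n
    proof -
      have "(dist (y m) (y n))\<^sup>2 < e\<^sup>2"
        using par[of m n] N[OF that(1)] N[OF that(2)] by linarith
      then show ?thesis using e by (simp add: power2_less_imp_less)
    qed
    then show "\<exists>M. \<forall>m\<ge>M. \<forall>n\<ge>M. dist (y m) (y n) < e" by blast
  qed
  then obtain l where l: "y \<longlonglongrightarrow> l" using Cauchy_convergent convergent_def by blast
  have lS: "l \<in> S" using closed_sequentially[OF S(2) _ l] y by blast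
  have dl: "dist x l = d"
    using LIMSEQ_unique[OF lim tendsto_dist[OF tendsto_const l]] by simp
  have "inner (x - l) s = 0" if s: "s \<in> S" for s
  proof (cases "s = 0")
    case False
    \<comment> \<open>The shift along \<open>s\<close> that brings \<open>l\<close> closest to
      \<open>x\<close>.\<close>
    define t where "t = inner (x - l) s / inner s s"
    have "l + t *\<^sub>R s \<in> S" using S(1) lS s by (simp add: subspace_add subspace_scale)
    then have "d\<^sup>2 \<le> (norm ((x - l) - t *\<^sub>R s))\<^sup>2"
      using le[of "l + t *\<^sub>R s"] d0 by (simp add: dist_norm power_mono diff_diff_eq)
    also have "\<dots> = d\<^sup>2 - 2 * t * inner (x - l) s + t\<^sup>2 * inner s s"
    proof -
      have "(norm (u - t *\<^sub>R s))\<^sup>2 = (norm u)\<^sup>2 - 2 * t * inner u s + t\<^sup>2 * inner s s" for u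
        unfolding power2_norm_eq_inner
        by (simp add: inner_diff_left inner_diff_right inner_commute[of s u] power2_eq_square
            algebra_simps)
      then show ?thesis using dl by (simp add: dist_norm)
    qed
    also have "\<dots> = d\<^sup>2 - (inner (x - l) s)\<^sup>2 / inner s s"
      using False by (simp add: t_def power2_eq_square)
    finally have "(inner (x - l) s)\<^sup>2 / inner s s \<le> 0" by simp
    moreover have "inner s s > 0" using False by simp
    ultimately show ?thesis
      by (simp add: divide_le_0_iff)
  qed simp
  then show ?thesis using lS by blast
qed

lemma riesz:
  fixes f :: "'a::complex_hilbert \<Rightarrow> real"
  assumes f: "bounded_linear f"
  shows "\<exists>y. \<forall>x. f x = inner x y"
proof (cases "\<forall>x. f x = 0")
  case True
  then show ?thesis by (intro exI[of _ 0]) simp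
next
  case False
  then obtain a where a: "f a \<noteq> 0" by blast
  define S where "S = {x. f x = 0}"
  have "subspace S"
    unfolding S_def using f by (auto simp: subspace_def linear_simps[OF f])
  moreover have "closed S"
    unfolding S_def using f
    by (intro closed_Collect_eq) (auto intro: linear_continuous_on continuous_intros)
  ultimately obtain y where y: "y \<in> S" "\<And>s. s \<in> S \<Longrightarrow> inner (a - y) s = 0"
    using closest_point_exists by blast
  define b where "b = a - y"
  have fb: "f b \<noteq> 0" using a y(1) by (simp add: b_def S_def linear_simps[OF f])
  then have b0: "inner b b \<noteq> 0" using linear_simps(3)[OF f] by auto
  have "f x = inner x ((f b / inner b b) *\<^sub>R b)" for x
  proof -
    have "x - (f x / f b) *\<^sub>R b \<in> S" using fb by (simp add: S_def linear_simps[OF f])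
    then have "inner b (x - (f x / f b) *\<^sub>R b) = 0" using y(2) b_def by blast
    then show ?thesis using fb b0
      by (simp add: inner_diff_right inner_commute[of x] field_simps)
  qed
  then show ?thesis by blast
qed

text \<open>The representation theorem is applied to real functionals and yields the adjoint for the
  real inner product. Multiplication by i is skew for that inner product and commutes with
  \<open>A\<close>, hence also with this adjoint, which makes it the complex one.\<close>

lemma cadj_exists:
  fixes A :: "'a::complex_hilbert \<Rightarrow> 'b::complex_hilbert"
  assumes A: "bounded_clinear A"
  shows "\<exists>B. bounded_clinear B \<and> (\<forall>x y. cinner (A x) y = cinner x (B y))"
proof -
  obtain K where K: "K > 0" "\<And>x. norm (A x) \<le> K * norm x" using bounded_clinear_bound[OF A] by metis
  have "\<exists>z. \<forall>x. inner (A x) y = inner x z" for y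
    by (rule riesz)
      (rule bounded_linear_compose[OF bounded_linear_inner_left bounded_clinear_linear[OF A]])
  then obtain B where B: "\<And>x y. inner (A x) y = inner x (B y)" by metis
  have ii: "B (scaleC \<i> y) = scaleC \<i> (B y)" for y
  proof (rule vector_eq_ldot[THEN iffD1], rule)
    fix z
    show "inner z (B (scaleC \<i> y)) = inner z (scaleC \<i> (B y))"
      by (metis A B bounded_clinear_scaleC inner_scaleC_ii minus_minus)
  qed
  have c: "cinner (A x) y = cinner x (B y)" for x y
    by (simp add: cinner_eq_inner B ii)
  have add: "B (x + y) = B x + B y" for x y
    by (rule vector_eq_ldot[THEN iffD1]) (simp add: inner_add_right flip: B)
  have sc: "B (scaleC r y) = scaleC r (B y)" for r y
  proof (rule vector_eq_ldot[THEN iffD1], rule)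
    fix z show "inner z (B (scaleC r y)) = inner z (scaleC r (B y))"
      by (simp add: inner_eq_Re_cinner cinner_scaleC_right flip: c)
  qed
  have "bounded_clinear B"
  proof (rule bounded_clinearI[OF add sc, where K=K])
    fix y
    have "(norm (B y))\<^sup>2 = inner (A (B y)) y" by (simp add: B power2_norm_eq_inner)
    also have "\<dots> \<le> K * norm (B y) * norm y"
      by (meson K(2) mult_right_mono norm_cauchy_schwarz norm_ge_zero order_trans)
    finally have "norm (B y) * norm (B y) \<le> norm (B y) * (K * norm y)"
      by (simp add: power2_eq_square algebra_simps)
    then show "norm (B y) \<le> K * norm y"
      using K(1) by (cases "norm (B y) = 0") (auto simp: mult_le_cancel_left)
  qed
  with c show ?thesis by blast
qed

lemma cadj_unique:
  assumes "bounded_clinear A" "\<And>x y. cinner (A x) y = cinner x (B y)"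
  shows "cadj A = B"
  unfolding cadj_def
proof (rule the_equality)
  show "\<forall>x y. cinner (A x) y = cinner x (B y)" using assms by blast
  fix C assume "\<forall>x y. cinner (A x) y = cinner x (C y)"
  then have "cinner x (C y) = cinner x (B y)" for x y using assms(2) by metis
  then have "inner x (C y) = inner x (B y)" for x y by (simp add: inner_eq_Re_cinner)
  then have "C y = B y" for y by (metis vector_eq_ldot)
  then show "C = B" by blast
qed

lemma
  assumes A: "bounded_clinear A"
  shows bounded_clinear_cadj [intro!]: "bounded_clinear (cadj A)"
    and inner_cadj: "inner (A x) y = inner x (cadj A y)"
proof -
  obtain B where B: "bounded_clinear B" "\<And>x y. cinner (A x) y = cinner x (B y)"
    using cadj_exists[OF A] by blast
  then have "cadj A = B" using cadj_unique[OF A] by blast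
  with B show "bounded_clinear (cadj A)"
    "inner (A x) y = inner x (cadj A y)" by (auto simp: inner_eq_Re_cinner)
qed

lemma inner_cadj': "bounded_clinear A \<Longrightarrow> inner (cadj A x) y = inner x (A y)"
  by (metis inner_cadj inner_commute)

lemma cadj_eqI:
  assumes A: "bounded_clinear A" and "\<And>x y. inner (A x) y = inner x (B y)"
  shows "cadj A = B"
proof
  fix y show "cadj A y = B y"
    by (rule vector_eq_ldot[THEN iffD1]) (simp add: assms flip: inner_cadj)
qed

lemma selfadjointI:
  assumes "bounded_clinear A" "\<And>x y. inner (A x) y = inner x (A y)"
  shows "selfadjoint A"
  using assms cadj_eqI unfolding selfadjoint_def by blast

lemma selfadjoint_bounded [dest]: "selfadjoint A \<Longrightarrow> bounded_clinear A"
  by (simp add: selfadjoint_def)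

lemma selfadjoint_inner: "selfadjoint A \<Longrightarrow> inner (A x) y = inner x (A y)"
  by (metis inner_cadj selfadjoint_def)

lemma cadj_cadj: "bounded_clinear A \<Longrightarrow> cadj (cadj A) = A"
  by (rule cadj_eqI) (auto simp: inner_cadj')

lemma cadj_comp:
  "bounded_clinear A \<Longrightarrow> bounded_clinear B \<Longrightarrow> cadj (A \<circ> B) = cadj B \<circ> cadj A"
  by (rule cadj_eqI) (auto simp: inner_cadj)

lemma cadj_uminus: "bounded_clinear A \<Longrightarrow> cadj (- A) = - cadj A"
  by (rule cadj_eqI) (auto simp: inner_cadj)

lemma selfadjoint_id [intro!]: "selfadjoint id"
  by (rule selfadjointI) auto

lemma selfadjoint_plus [intro!]: "selfadjoint A \<Longrightarrow> selfadjoint B \<Longrightarrow> selfadjoint (A + B)"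
  by (rule selfadjointI) (auto simp: inner_add_left inner_add_right selfadjoint_inner)

lemma selfadjoint_diff [intro!]: "selfadjoint A \<Longrightarrow> selfadjoint B \<Longrightarrow> selfadjoint (A - B)"
  by (rule selfadjointI) (auto simp: inner_diff_left inner_diff_right selfadjoint_inner)

lemma selfadjoint_scaleR: "selfadjoint A \<Longrightarrow> selfadjoint (\<lambda>x. r *\<^sub>R A x)"
  by (rule selfadjointI) (auto simp: selfadjoint_inner intro: bounded_clinear_scaleR_fun)

lemma cinner_selfadjoint:
  "selfadjoint A \<Longrightarrow> cinner (A x) x = complex_of_real (inner (A x) x)"
proof -
  assume A: "selfadjoint A"
  have "inner (A x) (scaleC \<i> x) = - inner (A x) (scaleC \<i> x)"
    by (metis A bounded_clinear_scaleC inner_commute inner_scaleC_ii selfadjoint_bounded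
        selfadjoint_inner)
  then show ?thesis by (simp add: cinner_eq_inner complex_eq_iff)
qed

lemma orth_projectionI:
  "selfadjoint P \<Longrightarrow> (\<And>x. P (P x) = P x) \<Longrightarrow> orth_projection P"
  by (auto simp: orth_projection_def)

lemma orth_projectionD:
  assumes "orth_projection P"
  shows "selfadjoint P" "bounded_clinear P" "P (P x) = P x"
  using assms by (auto simp: orth_projection_def fun_eq_iff)

lemma orth_projection_norm:
  assumes P: "orth_projection P"
  shows "inner (P x) x = (norm (P x))\<^sup>2" "norm (P x) \<le> norm x"
    "(norm x)\<^sup>2 = (norm (P x))\<^sup>2 + (norm (x - P x))\<^sup>2"
proof -
  show 1: "inner (P x) x = (norm (P x))\<^sup>2"
    by (metis orth_projectionD[OF P] power2_norm_eq_inner selfadjoint_inner)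
  show 2: "(norm x)\<^sup>2 = (norm (P x))\<^sup>2 + (norm (x - P x))\<^sup>2"
    using 1 by (simp add: power2_norm_eq_inner inner_diff_left inner_diff_right inner_commute)
  show "norm (P x) \<le> norm x"
    by (rule power2_le_imp_le) (use 2 in auto)
qed

lemma orth_projection_compl: "orth_projection P \<Longrightarrow> orth_projection (id - P)"
  by (rule orth_projectionI) (auto dest: orth_projectionD simp: clinear_simps orth_projectionD)

lemma range_orth_projection: "orth_projection P \<Longrightarrow> x \<in> range P \<longleftrightarrow> P x = x"
  by (metis orth_projectionD(3) rangeE rangeI)

lemma csubspace_range: "bounded_clinear A \<Longrightarrow> cvec.subspace (range A)"
  unfolding cvec.subspace_def
  by (metis (no_types, lifting) bounded_clinear_0 bounded_clinear_add bounded_clinear_scaleC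
      rangeE rangeI)

lemma csubspace_ker: "bounded_clinear A \<Longrightarrow> cvec.subspace {x. A x = 0}"
  unfolding cvec.subspace_def by (auto simp: clinear_simps)

lemma closed_ker: "bounded_clinear A \<Longrightarrow> closed {x. A x = 0}"
  by (intro closed_Collect_eq continuous_intros)
    (simp add: bounded_clinear_linear linear_continuous_on)

lemma csubspace_closure:
  assumes S: "cvec.subspace (S::'a::complex_hilbert set)"
  shows "cvec.subspace (closure S)"
  unfolding cvec.subspace_def
proof (intro conjI ballI allI)
  show "0 \<in> closure S" using S cvec.subspace_0 closure_subset by blast
  fix x y assume "x \<in> closure S" "y \<in> closure S"
  then obtain f g where f: "\<And>n. f n \<in> S" "f \<longlonglongrightarrow> x" and g: "\<And>n. g n \<in> S" "g \<longlonglongrightarrow> y"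
    unfolding closure_sequential by metis
  then show "x + y \<in> closure S" unfolding closure_sequential
    using S by (intro exI[of _ "\<lambda>n. f n + g n"]) (auto intro: tendsto_add simp: cvec.subspace_add)
next
  fix c x assume "x \<in> closure S"
  then obtain f where f: "\<And>n. f n \<in> S" "f \<longlonglongrightarrow> x"
    unfolding closure_sequential by metis
  then show "scaleC c x \<in> closure S" unfolding closure_sequential
    using S by (intro exI[of _ "\<lambda>n. scaleC c (f n)"])
      (auto intro: bounded_linear.tendsto[OF bounded_linear_scaleC] simp: cvec.subspace_scale)
qed

definition proj :: "'a::complex_hilbert set \<Rightarrow> 'a \<Rightarrow> 'a" where
  "proj S x = (SOME y. y \<in> S \<and> (\<forall>s\<in>S. inner (x - y) s = 0))"

context
  fixes S :: "'a::complex_hilbert set"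
  assumes S: "cvec.subspace S" "closed S"
begin

lemma proj_mem: "proj S x \<in> S" and proj_orth: "s \<in> S \<Longrightarrow> inner (x - proj S x) s = 0"
proof -
  have "\<exists>y. y \<in> S \<and> (\<forall>s\<in>S. inner (x - y) s = 0)"
    using closest_point_exists[OF csubspace_subspace[OF S(1)] S(2)] by blast
  from someI_ex[OF this] show "proj S x \<in> S" "s \<in> S \<Longrightarrow> inner (x - proj S x) s = 0"
    by (auto simp: proj_def)
qed

lemma proj_unique:
  assumes y: "y \<in> S" "\<And>s. s \<in> S \<Longrightarrow> inner (x - y) s = 0"
  shows "proj S x = y"
proof -
  have m: "proj S x - y \<in> S"
    using proj_mem y(1) S(1) by (simp add: cvec.subspace_diff)
  have "inner (proj S x - y) (proj S x - y) = inner (x - y) (proj S x - y) - inner (x - proj S x) (proj S x - y)"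
    by (simp add: inner_diff_left)
  also have "\<dots> = 0" using y(2)[OF m] proj_orth[OF m] by simp
  finally show ?thesis by simp
qed

lemma orth_projection_proj: "orth_projection (proj S)"
proof (rule orth_projectionI[OF selfadjointI])
  show idem: "proj S (proj S x) = proj S x" for x
    by (rule proj_unique) (auto simp: proj_mem)
  show sym: "inner (proj S x) y = inner x (proj S y)" for x y
    using proj_orth[OF proj_mem[of y], of x] proj_orth[OF proj_mem[of x], of y]
    by (metis eq_iff_diff_eq_0 inner_commute inner_diff_left)
  show "bounded_clinear (proj S)"
  proof (rule bounded_clinearI)
    show "proj S (x + y) = proj S x + proj S y" for x y
      using proj_orth[of _ x] proj_orth[of _ y]
      by (intro proj_unique)
        (auto simp: proj_mem cvec.subspace_add[OF S(1)] inner_diff_left inner_add_left)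
    show "proj S (scaleC c x) = scaleC c (proj S x)" for c x
    proof (intro proj_unique)
      show "scaleC c (proj S x) \<in> S" by (simp add: proj_mem cvec.subspace_scale[OF S(1)])
      fix s assume s: "s \<in> S"
      \<comment> \<open>A complex subspace contains i s along with s, so real orthogonality to it is
        complex orthogonality.\<close>
      have "inner (x - proj S x) s = 0" "inner (x - proj S x) (scaleC \<i> s) = 0"
        by (auto intro: proj_orth s cvec.subspace_scale[OF S(1)])
      then have "cinner (x - proj S x) s = 0" by (simp add: cinner_eq_inner complex_eq_iff)
      then show "inner (scaleC c x - scaleC c (proj S x)) s = 0"
        by (simp add: inner_eq_Re_cinner cinner_scaleC_left flip: cvec.scale_right_diff_distrib)
    qed
    show "norm (proj S x) \<le> 1 * norm x" for x
    proof -
      have "(norm (proj S x))\<^sup>2 = inner x (proj S x)"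
        by (metis idem sym inner_commute power2_norm_eq_inner)
      also have "\<dots> \<le> norm x * norm (proj S x)" by (rule norm_cauchy_schwarz)
      finally show ?thesis
        by (cases "norm (proj S x) = 0") (auto simp: power2_eq_square mult_le_cancel_right)
    qed
  qed
qed

lemma proj_fix: "x \<in> S \<Longrightarrow> proj S x = x"
  by (rule proj_unique) auto

lemma proj_eq_0: "(\<And>s. s \<in> S \<Longrightarrow> inner x s = 0) \<Longrightarrow> proj S x = 0"
  by (rule proj_unique) (auto simp: cvec.subspace_0[OF S(1)])

end

text \<open>Invariance of the range of \<open>P\<close> under \<open>R\<close> says P R P = R P. The
  left side is selfadjoint, so R P equals its own adjoint P R.\<close>

lemma orth_projection_commute_selfadjoint:
  assumes P: "orth_projection P" and R: "selfadjoint R" and inv: "\<And>x. P x = x \<Longrightarrow> P (R x) = R x"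
  shows "P (R x) = R (P x)"
proof -
  note p = orth_projectionD[OF P]
  have PRP: "P (R (P z)) = R (P z)" for z using inv p(3) by blast
  have "inner (P (R x)) y = inner (R (P x)) y" for y
  proof -
    have "inner (P (R x)) y = inner x (R (P y))"
      by (simp add: selfadjoint_inner[OF R] selfadjoint_inner[OF p(1)])
    also have "\<dots> = inner x (P (R (P y)))" by (simp add: PRP)
    also have "\<dots> = inner (P (R (P x))) y"
      by (simp add: selfadjoint_inner[OF R] selfadjoint_inner[OF p(1)])
    finally show ?thesis by (simp add: PRP)
  qed
  then show ?thesis by (metis inner_commute vector_eq_rdot)
qed

text \<open>The component of \<open>x\<close> orthogonal to the closed range is annihilated by
  \<open>D\<close>, so it is orthogonal to \<open>x\<close> by hypothesis and hence to
  itself.\<close>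

lemma closure_range_ker:
  assumes D: "selfadjoint D" and x: "\<And>y. D y = 0 \<Longrightarrow> inner x y = 0"
  shows "x \<in> closure (range D)"
proof -
  let ?S = "closure (range D)"
  have S: "cvec.subspace ?S" "closed ?S"
    using D by (auto intro: csubspace_closure csubspace_range)
  define z where "z = x - proj ?S x"
  have "inner (D z) y = 0" for y
    using proj_orth[OF S, of "D y" x] closure_subset[of "range D"]
    by (auto simp: z_def selfadjoint_inner[OF D])
  then have "D z = 0" by (metis inner_eq_zero_iff)
  then have "inner x z = 0" using x by blast
  moreover have "inner z (proj ?S x) = 0"
    using proj_orth[OF S, of "proj ?S x" x] proj_mem[OF S] by (simp add: z_def)
  ultimately have "inner z z = 0" by (simp add: z_def inner_diff_right inner_diff_left inner_commute)
  then show ?thesis using proj_mem[OF S, of x] by (simp add: z_def)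
qed

lemma closure_range_orth_ker:
  assumes D: "selfadjoint D" and x: "x \<in> closure (range D)" and y: "D y = 0"
  shows "inner x y = 0"
proof -
  obtain w where w: "\<And>n. w n \<in> range D" "w \<longlonglongrightarrow> x" using x unfolding closure_sequential by metis
  have "inner (w n) y = 0" for n
    using w(1)[of n] y by (auto simp: selfadjoint_inner[OF D])
  then show ?thesis
    using LIMSEQ_unique[OF tendsto_inner[OF w(2) tendsto_const[of y]]] by simp
qed

section \<open>Nonnegative operators and square roots\<close>

lemma nonneg_op_inner: "nonneg_op A \<longleftrightarrow> selfadjoint A \<and> (\<forall>x. 0 \<le> inner (A x) x)"
  by (simp add: nonneg_op_def inner_eq_Re_cinner)

lemma nonneg_op_cauchy_schwarz:
  assumes A: "nonneg_op A"
  shows "(inner (A x) y)\<^sup>2 \<le> inner (A x) x * inner (A y) y"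
proof -
  define a b c where "a = inner (A x) x" and "b = inner (A x) y" and "c = inner (A y) y"
  have sa: "selfadjoint A" and nn: "\<And>z. 0 \<le> inner (A z) z"
    using A by (auto simp: nonneg_op_inner)
  have q: "0 \<le> a + 2 * t * b + t\<^sup>2 * c" for t
  proof -
    have "inner (A (x + t *\<^sub>R y)) (x + t *\<^sub>R y) = a + 2 * t * b + t\<^sup>2 * c"
      using selfadjoint_inner[OF sa, of y x]
      by (simp add: clinear_simps[OF selfadjoint_bounded[OF sa]] inner_add_left inner_add_right
          inner_commute[of y "A x"] a_def b_def c_def power2_eq_square algebra_simps)
    then show ?thesis using nn[of "x + t *\<^sub>R y"] by simp
  qed
  have "c \<ge> 0" using nn by (simp add: c_def)
  show ?thesis unfolding a_def[symmetric] b_def[symmetric] c_def[symmetric]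
  proof (cases "c = 0")
    case True
    have "b = 0"
    proof (rule ccontr)
      assume "b \<noteq> 0"
      \<comment> \<open>With \<open>c = 0\<close> the polynomial is affine; at this point its value
        is -1.\<close>
      then show False using q[of "- (a + 1) / (2 * b)"] True by (simp add: field_simps)
    qed
    then show "b\<^sup>2 \<le> a * c" using True by simp
  next
    case False
    then have c: "c > 0" using \<open>c \<ge> 0\<close> by simp
    have "a + 2 * (- b / c) * b + (- b / c)\<^sup>2 * c = a - b\<^sup>2 / c"
      using c by (simp add: power2_eq_square)
    then have "b\<^sup>2 / c \<le> a" using q[of "- b / c"] by simp
    then show "b\<^sup>2 \<le> a * c" using c by (simp add: divide_le_eq)
  qed
qed

lemma nonneg_op_eq_0:
  assumes A: "nonneg_op A" and 0: "inner (A x) x = 0" shows "A x = 0"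
  using nonneg_op_cauchy_schwarz[OF A, of x "A x"] 0 by simp

text \<open>Complex polarization: replacing \<open>v\<close> by i v turns the vanishing of (A u, v)
  + (A v, u) into that of the difference. Over the reals, rotation by a right angle is a
  counterexample. The lemma lets forms determine operators, both in \<open>fun_calc\<close> and in
  the uniqueness of minimal completions.\<close>

lemma form_eq_0:
  assumes A: "bounded_clinear A" and 0: "\<And>x. cinner (A x) x = 0" shows "A x = 0"
proof -
  have s: "cinner (A u) v + cinner (A v) u = 0" for u v
    using 0[of "u + v"] 0[of u] 0[of v]
    by (simp add: clinear_simps[OF A] cinner_eq_inner inner_add_left inner_add_right
        scaleC_add_right complex_eq_iff algebra_simps)
  have "cinner (A u) v = 0" for u v
  proof -
    have "cinner (A u) v - cinner (A v) u = 0"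
      using s[of u "scaleC \<i> v"]
      by (simp add: clinear_simps[OF A] cinner_scaleC_left cinner_scaleC_right complex_eq_iff)
    with s[of u v] show ?thesis by (simp add: complex_eq_iff)
  qed
  then have "inner (A x) (A x) = 0" by (simp add: inner_eq_Re_cinner)
  then show ?thesis by simp
qed

text \<open>The Cauchy-Schwarz inequality for the form of \<open>A\<close>, taken at
  \<open>x\<close> and \<open>A x\<close>, bounds |A x|^4 by (A x, x) (A A x, A x).\<close>

lemma nonneg_contraction:
  assumes A: "nonneg_op A" and le: "\<And>x. inner (A x) x \<le> (norm x)\<^sup>2"
  shows "norm (A x) \<le> norm x"
proof -
  have "((norm (A x))\<^sup>2)\<^sup>2 \<le> inner (A x) x * inner (A (A x)) (A x)"
    using nonneg_op_cauchy_schwarz[OF A, of x "A x"] by (simp add: power2_norm_eq_inner)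
  also have "\<dots> \<le> (norm x)\<^sup>2 * (norm (A x))\<^sup>2"
    using A le by (intro mult_mono) (auto simp: nonneg_op_inner)
  finally have "(norm (A x))\<^sup>2 * (norm (A x))\<^sup>2 \<le> (norm x)\<^sup>2 * (norm (A x))\<^sup>2"
    by (simp add: power2_eq_square)
  then have "(norm (A x))\<^sup>2 \<le> (norm x)\<^sup>2"
    by (cases "A x = 0") (simp, metis mult_right_le_imp_le zero_less_norm_iff zero_less_power)
  then show ?thesis by (rule power2_le_imp_le) simp
qed

text \<open>
  The root of \<open>1 - C\<close> is \<open>1 - X\<close> with \<open>X = (C + X\<^sup>2)/2\<close>; the fixed-point iteration is dominated by
  the scalar iteration for \<open>C = 1\<close>.
\<close>

primrec sqrt_iter :: "('a::complex_hilbert \<Rightarrow> 'a) \<Rightarrow> nat \<Rightarrow> 'a \<Rightarrow> 'a" where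
  "sqrt_iter C 0 = 0"
| "sqrt_iter C (Suc n) = (\<lambda>x. (1/2) *\<^sub>R (C x + sqrt_iter C n (sqrt_iter C n x)))"

primrec sqrt_bound :: "nat \<Rightarrow> real" where
  "sqrt_bound 0 = 0"
| "sqrt_bound (Suc n) = (1 + (sqrt_bound n)\<^sup>2) / 2"

lemma sqrt_bound_01: "0 \<le> sqrt_bound n \<and> sqrt_bound n \<le> 1"
  by (induction n) (auto simp: power_le_one)

lemma sqrt_bound_Suc: "sqrt_bound n \<le> sqrt_bound (Suc n)"
proof -
  have "0 \<le> (1 - sqrt_bound n)\<^sup>2" by simp
  then show ?thesis by (simp add: power2_eq_square field_simps)
qed

context
  fixes C :: "'a::complex_hilbert \<Rightarrow> 'a"
  assumes C: "selfadjoint C" and C1: "\<And>x. norm (C x) \<le> norm x"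
begin

lemma sqrt_iter_selfadjoint: "selfadjoint (sqrt_iter C n)"
proof (induction n)
  case 0
  show ?case by (rule selfadjointI) (auto simp: zero_fun_def[symmetric])
next
  case (Suc n)
  let ?X = "sqrt_iter C n"
  have "selfadjoint (?X \<circ> ?X)"
    using Suc by (intro selfadjointI) (auto simp: selfadjoint_inner[OF Suc])
  then have "selfadjoint (\<lambda>x. (1/2) *\<^sub>R (C + (?X \<circ> ?X)) x)"
    by (intro selfadjoint_scaleR selfadjoint_plus C)
  then show ?case by (simp add: plus_fun_def comp_def)
qed

lemma sqrt_iter_commute:
  assumes "bounded_clinear R" "\<And>x. R (C x) = C (R x)"
  shows "R (sqrt_iter C n x) = sqrt_iter C n (R x)"
  by (induction n arbitrary: x) (auto simp: clinear_simps[OF assms(1)] assms(2))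

lemma sqrt_iter_norm: "norm (sqrt_iter C n x) \<le> sqrt_bound n * norm x"
proof (induction n arbitrary: x)
  case (Suc n)
  let ?X = "sqrt_iter C n" and ?a = "sqrt_bound n"
  have "norm (?X (?X x)) \<le> ?a * (?a * norm x)"
    by (meson Suc mult_left_mono order_trans sqrt_bound_01)
  then have "norm (C x + ?X (?X x)) \<le> norm x + ?a * (?a * norm x)"
    by (meson C1 add_mono norm_triangle_ineq order_trans)
  moreover have "norm (sqrt_iter C (Suc n) x) = norm (C x + ?X (?X x)) / 2" by simp
  moreover have "sqrt_bound (Suc n) * norm x = (norm x + ?a * (?a * norm x)) / 2"
    by (simp add: power2_eq_square algebra_simps)
  ultimately show ?case by (metis divide_right_mono zero_le_numeral)
qed auto

text \<open>For consecutive iterates X and Y the difference Y Y - X X is split as Y (Y - X) + (Y -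
  X) X. The scalar bounds of the two terms add up to b^2 - a^2, twice the next increment of
  \<open>sqrt_bound\<close>.\<close>

lemma sqrt_iter_step:
  "norm (sqrt_iter C (Suc n) x - sqrt_iter C n x)
     \<le> (sqrt_bound (Suc n) - sqrt_bound n) * norm x"
proof (induction n arbitrary: x)
  case 0
  show ?case using C1[of x] by simp
next
  case (Suc n)
  let ?X = "sqrt_iter C n" and ?Y = "sqrt_iter C (Suc n)"
  let ?a = "sqrt_bound n" and ?b = "sqrt_bound (Suc n)"
  have Y: "bounded_clinear ?Y" using sqrt_iter_selfadjoint by blast
  have ab: "?a \<le> ?b" "0 \<le> ?a" "0 \<le> ?b" using sqrt_bound_Suc sqrt_bound_01 by blast+
  have "sqrt_iter C (Suc (Suc n)) x - ?Y x
      = (1/2) *\<^sub>R ((C x + ?Y (?Y x)) - (C x + ?X (?X x)))"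
    by (simp only: sqrt_iter.simps scaleR_diff_right)
  also have "\<dots> = (1/2) *\<^sub>R (?Y (?Y x - ?X x) + (?Y (?X x) - ?X (?X x)))"
    by (simp add: clinear_simps[OF Y] del: sqrt_iter.simps)
  also have "norm \<dots> \<le> (1/2) * (?b * ((?b - ?a) * norm x) + (?b - ?a) * (?a * norm x))"
  proof -
    have 1: "norm (?Y (?Y x - ?X x)) \<le> ?b * ((?b - ?a) * norm x)"
      by (rule order_trans[OF sqrt_iter_norm mult_left_mono[OF Suc]]) (rule ab)
    have 2: "norm (?Y (?X x) - ?X (?X x)) \<le> (?b - ?a) * (?a * norm x)"
      by (rule order_trans[OF Suc mult_left_mono[OF sqrt_iter_norm]]) (use ab in simp)
    have "norm (?Y (?Y x - ?X x) + (?Y (?X x) - ?X (?X x)))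
        \<le> ?b * ((?b - ?a) * norm x) + (?b - ?a) * (?a * norm x)"
      by (rule order_trans[OF norm_triangle_ineq add_mono[OF 1 2]])
    then show ?thesis by (simp del: sqrt_iter.simps sqrt_bound.simps)
  qed
  also have "\<dots> = ((1/2) * (?b\<^sup>2 - ?a\<^sup>2)) * norm x"
    by (simp add: power2_eq_square algebra_simps del: sqrt_bound.simps)
  also have "(1/2) * (?b\<^sup>2 - ?a\<^sup>2) = sqrt_bound (Suc (Suc n)) - ?b"
    by (simp add: sqrt_bound.simps(2)[of "Suc n"] del: sqrt_bound.simps)
      (simp add: field_simps)
  finally show ?case .
qed

lemma sqrt_iter_diff:
  "norm (sqrt_iter C (n + k) x - sqrt_iter C n x) \<le> (sqrt_bound (n + k) - sqrt_bound n) * norm x"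
proof (induction k)
  case (Suc k)
  have "norm ((sqrt_iter C (Suc (n + k)) x - sqrt_iter C (n + k) x)
      + (sqrt_iter C (n + k) x - sqrt_iter C n x))
    \<le> (sqrt_bound (Suc (n + k)) - sqrt_bound (n + k)) * norm x
      + (sqrt_bound (n + k) - sqrt_bound n) * norm x"
    by (rule order_trans[OF norm_triangle_ineq add_mono[OF sqrt_iter_step Suc]])
  then show ?case by (simp add: algebra_simps del: sqrt_iter.simps sqrt_bound.simps)
qed auto

lemma sqrt_iter_convergent: "convergent (\<lambda>n. sqrt_iter C n x)"
proof -
  have "Bseq sqrt_bound" using sqrt_bound_01 by (intro BseqI'[of _ 1]) auto
  moreover have "incseq sqrt_bound" by (rule incseq_SucI) (rule sqrt_bound_Suc)
  ultimately have "convergent sqrt_bound" by (simp add: Bseq_monoseq_convergent incseq_imp_monoseq)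
  then have "convergent (\<lambda>n. sqrt_bound n * norm x)"
    by (intro convergent_mult convergent_const)
  then have "Cauchy (\<lambda>n. sqrt_bound n * norm x)" by (rule convergent_Cauchy)
  then have "Cauchy (\<lambda>n. sqrt_iter C n x)"
    unfolding Cauchy_def
  proof (intro allI impI)
    fix e :: real assume "\<forall>e>0. \<exists>M. \<forall>m\<ge>M. \<forall>n\<ge>M. dist (sqrt_bound m * norm x) (sqrt_bound n * norm x) < e" "0 < e"
    then obtain M where M: "\<And>m n. m \<ge> M \<Longrightarrow> n \<ge> M \<Longrightarrow> dist (sqrt_bound m * norm x) (sqrt_bound n * norm x) < e"
      by meson
    have *: "dist (sqrt_iter C m x) (sqrt_iter C n x) < e" if "m \<ge> n" "n \<ge> M" for m n
    proof -
      have "dist (sqrt_iter C m x) (sqrt_iter C n x) \<le> (sqrt_bound m - sqrt_bound n) * norm x"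
        using sqrt_iter_diff[of n "m - n" x] that by (simp add: dist_norm)
      also have "\<dots> \<le> dist (sqrt_bound m * norm x) (sqrt_bound n * norm x)"
        by (simp add: dist_norm left_diff_distrib)
      finally show ?thesis using M[of m n] that by simp
    qed
    show "\<exists>M. \<forall>m\<ge>M. \<forall>n\<ge>M. dist (sqrt_iter C m x) (sqrt_iter C n x) < e"
      by (rule exI[of _ M]) (metis * dist_commute nle_le)
  qed
  then show ?thesis by (rule Cauchy_convergent)
qed

text \<open>Each iterate is a polynomial in \<open>C\<close>, so whatever commutes with
  \<open>C\<close> commutes with the limit. This last conjunct yields the uniqueness of roots and
  the commutation relations of roots and absolute values.\<close>

lemma sqrt_exists_contraction:
  "\<exists>B. nonneg_op B \<and> (\<forall>x. B (B x) = x - C x) \<and>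
     (\<forall>R. bounded_clinear R \<longrightarrow> (\<forall>x. R (C x) = C (R x)) \<longrightarrow> (\<forall>x. R (B x) = B (R x)))"
proof -
  let ?X = "sqrt_iter C"
  have bcX: "bounded_clinear (?X n)" for n using sqrt_iter_selfadjoint by blast
  obtain L where L: "\<And>x. (\<lambda>n. ?X n x) \<longlonglongrightarrow> L x"
    using sqrt_iter_convergent unfolding convergent_def by metis
  have n1: "norm (?X n x) \<le> 1 * norm x" for n x
    by (rule order_trans[OF sqrt_iter_norm mult_right_mono]) (use sqrt_bound_01 in auto)
  have bcL: "bounded_clinear L" and nL: "\<And>x. norm (L x) \<le> norm x"
    using bounded_clinear_limit[where X="?X" and L=L, OF bcX n1 L] by auto
  have saL: "selfadjoint L"
  proof (rule selfadjointI[OF bcL])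
    fix x y
    have "(\<lambda>n. inner (?X n x) y) \<longlonglongrightarrow> inner (L x) y" "(\<lambda>n. inner x (?X n y)) \<longlonglongrightarrow> inner x (L y)"
      by (intro tendsto_intros L)+
    then show "inner (L x) y = inner x (L y)"
      using LIMSEQ_unique by (simp add: selfadjoint_inner[OF sqrt_iter_selfadjoint])
  qed
  have LL: "(\<lambda>n. ?X n (?X n x)) \<longlonglongrightarrow> L (L x)" for x
  proof -
    have "(\<lambda>n. ?X n (?X n x - L x)) \<longlonglongrightarrow> 0"
    proof (rule Lim_null_comparison)
      show "\<forall>\<^sub>F n in sequentially. norm (?X n (?X n x - L x)) \<le> norm (?X n x - L x)"
        using n1 by (auto intro!: always_eventually)
      show "(\<lambda>n. norm (?X n x - L x)) \<longlonglongrightarrow> 0"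
        using L[of x] by (simp add: LIM_zero tendsto_norm_zero)
    qed
    from tendsto_add[OF this L[of "L x"]] show ?thesis by (simp add: clinear_simps[OF bcX])
  qed
  have eq: "L x = (1/2) *\<^sub>R (C x + L (L x))" for x
  proof (rule LIMSEQ_unique[OF LIMSEQ_Suc[OF L[of x]]])
    show "(\<lambda>n. ?X (Suc n) x) \<longlonglongrightarrow> (1/2) *\<^sub>R (C x + L (L x))"
      unfolding sqrt_iter.simps by (intro tendsto_intros LL)
  qed
  show ?thesis
  proof (intro exI[of _ "id - L"] conjI allI impI)
    show "nonneg_op (id - L)"
      unfolding nonneg_op_inner
    proof (intro conjI allI)
      show "selfadjoint (id - L)" using saL by blast
      fix x
      have "inner (L x) x \<le> norm x * norm x"
        by (meson mult_right_mono nL norm_cauchy_schwarz norm_ge_zero order_trans)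
      then show "0 \<le> inner ((id - L) x) x"
        by (simp add: inner_diff_left norm_eq_sqrt_inner)
    qed
    show "(id - L) ((id - L) x) = x - C x" for x
    proof -
      have "L x + L x = C x + L (L x)"
        using eq[of x] by (metis (no_types, opaque_lifting) scaleR_2 scaleR_half_double scaleR_add_right)
      then show ?thesis by (simp add: clinear_simps[OF bcL] algebra_simps)
    qed
    fix R x assume R: "bounded_clinear R" "\<forall>x. R (C x) = C (R x)"
    have "R (L x) = L (R x)"
      using LIMSEQ_unique[OF bounded_clinear_tendsto[OF R(1) L[of x]]] L[of "R x"]
        sqrt_iter_commute R by simp
    then show "R ((id - L) x) = (id - L) (R x)" by (simp add: clinear_simps[OF R(1)])
  qed
qed

end

lemma sqrt_exists:
  assumes A: "nonneg_op A"
  shows "\<exists>B. nonneg_op B \<and> (\<forall>x. B (B x) = A x) \<and>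
     (\<forall>R. bounded_clinear R \<longrightarrow> (\<forall>x. R (A x) = A (R x)) \<longrightarrow> (\<forall>x. R (B x) = B (R x)))"
proof -
  have sa: "selfadjoint A" and nn: "\<And>x. 0 \<le> inner (A x) x" using A by (auto simp: nonneg_op_inner)
  obtain K where K: "K > 0" "\<And>x. norm (A x) \<le> K * norm x"
    using bounded_clinear_bound[OF selfadjoint_bounded[OF sa]] by metis
  \<comment> \<open>Dividing by the norm bound puts \<open>C\<close> between 0 and the identity; the
    root of 1 - C = A / K is then rescaled by \<open>sqrt K\<close>.\<close>
  define C where "C = id - (\<lambda>x. (1 / K) *\<^sub>R A x)"
  have Cx: "C x = x - (1 / K) *\<^sub>R A x" for x by (simp add: C_def)
  have saC: "selfadjoint C" unfolding C_def by (intro selfadjoint_diff selfadjoint_id selfadjoint_scaleR sa)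
  have "inner (A x) x \<le> K * (norm x)\<^sup>2" for x
    using mult_right_mono[OF K(2), of "norm x" x] norm_cauchy_schwarz[of "A x" x]
    by (simp add: power2_eq_square mult.assoc)
  then have "nonneg_op C" using saC K(1)
    by (simp add: nonneg_op_inner Cx inner_diff_left power2_norm_eq_inner divide_le_eq mult.commute)
  moreover have "inner (C x) x \<le> (norm x)\<^sup>2" for x
    using nn K(1) by (simp add: Cx inner_diff_left power2_norm_eq_inner)
  ultimately have nC: "norm (C x) \<le> norm x" for x by (rule nonneg_contraction)
  obtain B where B: "nonneg_op B" "\<And>x. B (B x) = x - C x"
    "\<And>R x. bounded_clinear R \<Longrightarrow> (\<And>x. R (C x) = C (R x)) \<Longrightarrow> R (B x) = B (R x)"
    using sqrt_exists_contraction[OF saC nC] by metis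
  have saB: "selfadjoint B" using B(1) by (simp add: nonneg_op_inner)
  show ?thesis
  proof (intro exI[of _ "\<lambda>x. sqrt K *\<^sub>R B x"] conjI allI impI)
    show "nonneg_op (\<lambda>x. sqrt K *\<^sub>R B x)"
      using B(1) K(1) selfadjoint_scaleR[OF saB, of "sqrt K"] by (simp add: nonneg_op_inner)
    show "sqrt K *\<^sub>R B (sqrt K *\<^sub>R B x) = A x" for x
      using K(1) by (simp add: clinear_simps[OF selfadjoint_bounded[OF saB]] B(2) Cx)
    fix R x assume R: "bounded_clinear R" "\<forall>x. R (A x) = A (R x)"
    have "R (B x) = B (R x)"
      using R(2) by (intro B(3)[OF R(1)]) (simp add: Cx clinear_simps[OF R(1)])
    then show "R (sqrt K *\<^sub>R B x) = sqrt K *\<^sub>R B (R x)" by (simp add: clinear_simps[OF R(1)])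
  qed
qed

text \<open>For y = B x - C x one has (B + C) y = B B x - C C x = 0, and two nonnegative forms with
  sum zero both vanish. Hence \<open>B y\<close> and \<open>C y\<close> are 0, and |y|^2 = (x, (B -
  C) y) = 0.\<close>

lemma sqrt_unique_commuting:
  assumes B: "nonneg_op B" and C: "nonneg_op C" and eq: "\<And>x. B (B x) = C (C x)"
    and comm: "\<And>x. B (C x) = C (B x)"
  shows "B = C"
proof
  fix x
  note b = B[unfolded nonneg_op_inner, THEN conjunct1] and c = C[unfolded nonneg_op_inner, THEN conjunct1]
  note s = clinear_simps[OF selfadjoint_bounded[OF b]] clinear_simps[OF selfadjoint_bounded[OF c]]
  define y where "y = B x - C x"
  have 0: "B y + C y = 0" by (simp add: y_def s eq comm)
  have "inner (B y) y + inner (C y) y = 0"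
    by (metis 0 inner_add_left inner_zero_left)
  then have "inner (B y) y = 0" "inner (C y) y = 0"
    using B C unfolding nonneg_op_inner by (smt (verit))+
  then have "B y = 0" "C y = 0" using nonneg_op_eq_0 B C by blast+
  then have "inner y y = 0"
    by (metis (no_types, lifting) b c diff_self inner_diff_left inner_zero_right selfadjoint_inner y_def)
  then show "B x = C x" by (simp add: y_def)
qed

lemma op_sqrt_spec:
  assumes A: "nonneg_op A"
  shows "nonneg_op (op_sqrt A)" "op_sqrt A (op_sqrt A x) = A x"
    "bounded_clinear R \<Longrightarrow> (\<And>x. R (A x) = A (R x)) \<Longrightarrow> R (op_sqrt A x) = op_sqrt A (R x)"
    "nonneg_op C \<Longrightarrow> (\<And>x. C (C x) = A x) \<Longrightarrow> op_sqrt A = C"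
proof -
  obtain B where B: "nonneg_op B" "\<And>x. B (B x) = A x"
    "\<And>R x. bounded_clinear R \<Longrightarrow> (\<And>x. R (A x) = A (R x)) \<Longrightarrow> R (B x) = B (R x)"
    using sqrt_exists[OF A] by metis
  \<comment> \<open>Any root \<open>C\<close> of \<open>A\<close> commutes with A = C C, hence with
    the constructed root \<open>B\<close>.\<close>
  have u: "C = B" if C: "nonneg_op C" "\<And>x. C (C x) = A x" for C
  proof (rule sqrt_unique_commuting[OF C(1) B(1)])
    show "C (C x) = B (B x)" for x by (simp add: C B)
    show "C (B x) = B (C x)" for x
      using C by (intro B(3)) (auto simp: nonneg_op_inner simp flip: C(2))
  qed
  have eq: "op_sqrt A = B"
    unfolding op_sqrt_def
  proof (rule the_equality)
    show "nonneg_op B \<and> B \<circ> B = A" using B(1,2) by (simp add: fun_eq_iff)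
    show "C = B" if "nonneg_op C \<and> C \<circ> C = A" for C
      using that by (intro u) auto
  qed
  show "nonneg_op (op_sqrt A)" "op_sqrt A (op_sqrt A x) = A x"
    using B(1,2) eq by simp_all
  show "R (op_sqrt A x) = op_sqrt A (R x)" if "bounded_clinear R" "\<And>x. R (A x) = A (R x)"
    unfolding eq using that by (rule B(3))
  show "op_sqrt A = C" if "nonneg_op C" "\<And>x. C (C x) = A x"
    unfolding eq using that by (rule u[symmetric])
qed

lemma nonneg_cadj_comp: "bounded_clinear C \<Longrightarrow> nonneg_op (cadj C \<circ> C)"
  unfolding nonneg_op_inner
  by (auto intro!: selfadjointI simp: inner_cadj' inner_cadj[symmetric])

lemma op_abs_spec:
  assumes C: "selfadjoint C"
  shows "nonneg_op (op_abs C)" "op_abs C (op_abs C x) = C (C x)"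
    "bounded_clinear R \<Longrightarrow> (\<And>x. R (C x) = C (R x)) \<Longrightarrow> R (op_abs C x) = op_abs C (R x)"
    "nonneg_op B \<Longrightarrow> (\<And>x. B (B x) = C (C x)) \<Longrightarrow> op_abs C = B"
proof -
  have n: "nonneg_op (cadj C \<circ> C)" using C by (intro nonneg_cadj_comp) blast
  have e: "cadj C = C" using C by (simp add: selfadjoint_def)
  show "nonneg_op (op_abs C)" "op_abs C (op_abs C x) = C (C x)"
    using op_sqrt_spec(1,2)[OF n] by (simp_all add: op_abs_def e)
  show "R (op_abs C x) = op_abs C (R x)" if "bounded_clinear R" "\<And>x. R (C x) = C (R x)"
    unfolding op_abs_def by (rule op_sqrt_spec(3)[OF n that(1)]) (simp add: e that(2))
  show "op_abs C = B" if "nonneg_op B" "\<And>x. B (B x) = C (C x)"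
    unfolding op_abs_def by (rule op_sqrt_spec(4)[OF n that(1)]) (simp add: e that(2))
qed

section \<open>Complex dimension\<close>

lemma bounded_clinear_is_linear: "bounded_clinear f \<Longrightarrow> Vector_Spaces.linear scaleC scaleC f"
  by (simp add: Vector_Spaces.linear_iff vector_space_scaleC clinear_simps)

text \<open>Inequalities between negative indices rest on this comparison: \<open>f\<close> will
  typically be a spectral projection composed with a substitution, which is injective only on a
  subspace where a form is negative.\<close>

lemma cdim_inj_le:
  fixes f :: "'a::complex_hilbert \<Rightarrow> 'b::complex_hilbert"
  assumes f: "Vector_Spaces.linear scaleC scaleC f" and S: "cvec.subspace S"
    and inj: "\<And>x. x \<in> S \<Longrightarrow> f x = 0 \<Longrightarrow> x = 0" and sub: "\<And>x. x \<in> S \<Longrightarrow> f x \<in> W"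
  shows "cdim S \<le> cdim W"
proof (cases "\<exists>B. finite B \<and> W \<subseteq> cvec.span B")
  case False
  then have "cdim W = \<infinity>" unfolding cdim_def by meson
  then show ?thesis by simp
next
  case True
  then obtain T where T: "finite T" "W \<subseteq> cvec.span T" by blast
  obtain B where B: "B \<subseteq> W" "cvec.independent B" "W \<subseteq> cvec.span B" "card B = cvec.dim W"
    using cvec.basis_exists by metis
  have fB: "finite B" using cvec.independent_span_bound[OF T(1) B(2)] B(1) T(2) by auto
  obtain C where C: "C \<subseteq> S" "cvec.independent C" "S \<subseteq> cvec.span C" "card C = cvec.dim S"
    using cvec.basis_exists by metis
  have "inj_on f (cvec.span C)"
  proof (rule inj_onI)
    fix x y assume xy: "x \<in> cvec.span C" "y \<in> cvec.span C" "f x = f y"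
    then have "x - y \<in> S"
      using cvec.span_minimal[OF C(1) S] cvec.subspace_diff[OF S] by blast
    moreover have "f (x - y) = 0" using xy(3) cvec_pair.linear_diff[OF f] by simp
    ultimately show "x = y" using inj by force
  qed
  then have ind: "cvec.independent (f ` C)"
    by (rule cvec_pair.linear_independent_injective_image[OF f C(2)])
  have "f ` C \<subseteq> cvec.span B" using C(1) B(3) sub by blast
  from cvec.independent_span_bound[OF fB ind this]
  have c: "finite (f ` C)" "card (f ` C) \<le> card B" by auto
  have "inj_on f C"
    using \<open>inj_on f (cvec.span C)\<close> cvec.span_superset inj_on_subset by blast
  then have "finite C" "card (f ` C) = card C" using c(1) by (auto simp: finite_image_iff card_image)
  then show ?thesis using c(2) B(4) C(3,4) True by (auto simp: cdim_def)
qed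

lemma cdim_mono: "cvec.subspace S \<Longrightarrow> S \<subseteq> W \<Longrightarrow> cdim S \<le> cdim W"
  by (rule cdim_inj_le[OF bounded_clinear_is_linear[OF bounded_clinear_id]]) auto

text \<open>Makes an increasing chain of finite-dimensional spectral subspaces stationary, which is
  where the gap below 0 comes from.\<close>

lemma cdim_eq_subset:
  assumes U: "cvec.subspace U" and UW: "U \<subseteq> W" and fin: "cdim W \<noteq> \<infinity>" and eq: "cdim U = cdim W"
  shows "U = W"
proof (rule ccontr)
  assume "U \<noteq> W"
  then obtain w where w: "w \<in> W" "w \<notin> U" using UW by blast
  obtain T where T: "finite T" "W \<subseteq> cvec.span T" using fin by (auto simp: cdim_def split: if_splits)
  obtain B where B: "B \<subseteq> U" "cvec.independent B" "U \<subseteq> cvec.span B" "card B = cvec.dim U"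
    using cvec.basis_exists by metis
  obtain C where C: "C \<subseteq> W" "cvec.independent C" "W \<subseteq> cvec.span C" "card C = cvec.dim W"
    using cvec.basis_exists by metis
  have fC: "finite C" using cvec.independent_span_bound[OF T(1) C(2)] C(1) T(2) by auto
  have fB: "finite B" using cvec.independent_span_bound[OF T(1) B(2)] B(1) UW T(2) by auto
  have "w \<notin> cvec.span B" using w(2) cvec.span_minimal[OF B(1) U] by blast
  then have "cvec.independent (insert w B)" "w \<notin> B"
    using B(2) cvec.independent_insertI cvec.span_superset by blast+
  moreover have "insert w B \<subseteq> cvec.span C" using B(1) UW w(1) C(3) by blast
  ultimately have "card B + 1 \<le> card C"
    using cvec.independent_span_bound[OF fC] fB by fastforce
  moreover have "\<exists>T. finite T \<and> U \<subseteq> cvec.span T" using T UW by blast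
  ultimately show False using eq B(4) C(4) T by (auto simp: cdim_def split: if_splits)
qed

lemma cdim_Times:
  fixes U :: "'a::complex_hilbert set" and W :: "'b::complex_hilbert set"
  assumes U: "cvec.subspace U" and W: "cvec.subspace W"
  shows "cdim (U \<times> W) = cdim U + cdim W"
proof -
  have l1: "Vector_Spaces.linear scaleC scaleC (\<lambda>x::'a. (x, 0::'b))"
    and l2: "Vector_Spaces.linear scaleC scaleC (\<lambda>x::'b. (0::'a, x))"
    and lf: "Vector_Spaces.linear scaleC scaleC (fst :: 'a \<times> 'b \<Rightarrow> 'a)"
    and ls: "Vector_Spaces.linear scaleC scaleC (snd :: 'a \<times> 'b \<Rightarrow> 'b)"
    by (auto simp: Vector_Spaces.linear_iff vector_space_scaleC scaleC_prod_def)
  have 0: "0 \<in> U" "0 \<in> W" using U W cvec.subspace_0 by auto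
  have le1: "cdim U \<le> cdim (U \<times> W)"
    by (rule cdim_inj_le[OF l1 U]) (use 0 in \<open>auto simp: zero_prod_def\<close>)
  have le2: "cdim W \<le> cdim (U \<times> W)"
    by (rule cdim_inj_le[OF l2 W]) (use 0 in \<open>auto simp: zero_prod_def\<close>)
  show ?thesis
  proof (cases "cdim U = \<infinity> \<or> cdim W = \<infinity>")
    case True
    then show ?thesis using le1 le2 by auto
  next
    case False
    obtain B where B: "B \<subseteq> U" "cvec.independent B" "U \<subseteq> cvec.span B" "card B = cvec.dim U"
      using cvec.basis_exists by metis
    obtain C where C: "C \<subseteq> W" "cvec.independent C" "W \<subseteq> cvec.span C" "card C = cvec.dim W"
      using cvec.basis_exists by metis
    have fB: "finite B"
      using False B(1) cvec.independent_span_bound[OF _ B(2)] by (auto simp: cdim_def split: if_splits)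
    have fC: "finite C"
      using False C(1) cvec.independent_span_bound[OF _ C(2)] by (auto simp: cdim_def split: if_splits)
    define A where "A = (\<lambda>x. (x, 0::'b)) ` B \<union> (\<lambda>x. (0::'a, x)) ` C"
    have n0: "0 \<notin> B" "0 \<notin> C" using B(2) C(2) cvec.dependent_zero by blast+
    have ind: "cvec.independent A"
      unfolding cvec.dependent_def
    proof (intro notI, elim bexE)
      fix a assume a: "a \<in> A" "a \<in> cvec.span (A - {a})"
      then have f: "fst a \<in> cvec.span (fst ` (A - {a}))" and s: "snd a \<in> cvec.span (snd ` (A - {a}))"
        using cvec_pair.linear_span_image[OF lf, of "A - {a}"]
          cvec_pair.linear_span_image[OF ls, of "A - {a}"] by blast+
      from a(1) consider b where "b \<in> B" "a = (b, 0)" | c where "c \<in> C" "a = (0, c)"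
        unfolding A_def by blast
      then show False
      proof cases
        case 1
        then have "fst ` (A - {a}) \<subseteq> insert 0 (B - {b})" by (auto simp: A_def)
        then have "b \<in> cvec.span (B - {b})"
          using f 1 cvec.span_mono[of "fst ` (A - {a})" "insert 0 (B - {b})"] by auto
        then show False using 1 B(2) cvec.dependent_def by blast
      next
        case 2
        then have "snd ` (A - {a}) \<subseteq> insert 0 (C - {c})" by (auto simp: A_def)
        then have "c \<in> cvec.span (C - {c})"
          using s 2 cvec.span_mono[of "snd ` (A - {a})" "insert 0 (C - {c})"] by auto
        then show False using 2 C(2) cvec.dependent_def by blast
      qed
    qed
    have sp: "U \<times> W \<subseteq> cvec.span A"
    proof
      fix z assume "z \<in> U \<times> W"
      then obtain u w where z: "z = (u, w)" "u \<in> cvec.span B" "w \<in> cvec.span C" using B(3) C(3) by blast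
      have "(u, 0::'b) \<in> cvec.span ((\<lambda>x. (x, 0)) ` B)" "(0::'a, w) \<in> cvec.span ((\<lambda>x. (0, x)) ` C)"
        using z cvec_pair.linear_span_image[OF l1, of B] cvec_pair.linear_span_image[OF l2, of C] by blast+
      then have "(u, 0) \<in> cvec.span A" "(0, w) \<in> cvec.span A"
        unfolding A_def using cvec.span_mono by blast+
      then have "(u, 0) + (0, w) \<in> cvec.span A" by (rule cvec.span_add)
      then show "z \<in> cvec.span A" using z by simp
    qed
    have "A \<subseteq> U \<times> W" using B(1) C(1) 0 by (auto simp: A_def)
    then have d: "cvec.dim (U \<times> W) = card A" using cvec.dim_unique[OF _ sp ind] by simp
    have "card A = card B + card C"
      unfolding A_def using n0 fB fC
      by (subst card_Un_disjoint) (auto simp: card_image inj_on_def)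
    moreover have "finite A" using fB fC by (simp add: A_def)
    ultimately show ?thesis using False B(4) C(4) sp d by (auto simp: cdim_def split: if_splits)
  qed
qed

section \<open>Existence of the spectral family\<close>

text \<open>\<open>P\<close> projects onto the kernel of |X| + X, where X = -|X|. The orthogonal
  complement is the closed range of |X| + X, and there X = |X| because |X| (|X| + X) = X (|X| + X).
  The kernel of \<open>X\<close> goes into the range of \<open>P\<close>, which makes the form
  strictly positive on the complement; nestedness and right-continuity of the spectral family use
  this strictness.\<close>

lemma nonpos_projection_exists:
  fixes X :: "'a::complex_hilbert \<Rightarrow> 'a"
  assumes X: "selfadjoint X"
  shows "\<exists>P. orth_projection P \<and> (\<forall>x. P x = x \<longrightarrow> inner (X x) x \<le> 0) \<and>
     (\<forall>y. P y = 0 \<longrightarrow> y \<noteq> 0 \<longrightarrow> 0 < inner (X y) y) \<and>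
     (\<forall>R. selfadjoint R \<longrightarrow> (\<forall>x. R (X x) = X (R x)) \<longrightarrow> (\<forall>x. P (R x) = R (P x)))"
proof -
  define A where "A = op_abs X"
  define Y where "Y = A + X"
  have nA: "nonneg_op A" and sA: "selfadjoint A" and AA: "A (A x) = X (X x)" for x
    using op_abs_spec(1,2)[OF X] by (auto simp: A_def nonneg_op_inner)
  have AX: "A (X x) = X (A x)" for x
    using op_abs_spec(3)[OF X selfadjoint_bounded[OF X]] by (simp add: A_def)
  have Y: "selfadjoint Y" using sA X by (auto simp: Y_def)
  define N where "N = {x. Y x = 0}"
  have N: "cvec.subspace N" "closed N"
    using Y by (auto simp: N_def intro: csubspace_ker closed_ker)
  note s = clinear_simps[OF selfadjoint_bounded[OF X]] clinear_simps[OF selfadjoint_bounded[OF sA]]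
  show ?thesis
  proof (intro exI[of _ "proj N"] conjI allI impI)
    show P: "orth_projection (proj N)" by (rule orth_projection_proj[OF N])
    show "inner (X x) x \<le> 0" if "proj N x = x" for x
    proof -
      have "x \<in> N" using proj_mem[OF N, of x] that by simp
      then have "X x = - A x" by (simp add: N_def Y_def add_eq_0_iff)
      then show ?thesis using nA by (simp add: nonneg_op_inner)
    qed
    show "0 < inner (X y) y" if y: "proj N y = 0" "y \<noteq> 0" for y
    proof -
      have orth: "inner y z = 0" if "Y z = 0" for z
        using proj_orth[OF N, of z y] that y(1) by (simp add: N_def)
      have "y \<in> closure (range Y)" by (rule closure_range_ker[OF Y orth])
      then obtain w where w: "\<And>n. w n \<in> range Y" "w \<longlonglongrightarrow> y" unfolding closure_sequential by metis
      have "A (w n) = X (w n)" for n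
        using w(1)[of n] by (auto simp: Y_def s AA AX add.commute)
      then have AX: "A y = X y"
        using LIMSEQ_unique[OF bounded_clinear_tendsto[OF selfadjoint_bounded[OF sA] w(2)]]
          bounded_clinear_tendsto[OF selfadjoint_bounded[OF X] w(2)] by simp
      have "inner (A y) y \<noteq> 0"
      proof
        assume "inner (A y) y = 0"
        then have "A y = 0" by (rule nonneg_op_eq_0[OF nA])
        then have "Y y = 0" using AX by (simp add: Y_def)
        then show False using orth[of y] y(2) by simp
      qed
      moreover have "0 \<le> inner (A y) y" using nA by (simp add: nonneg_op_inner)
      ultimately show ?thesis using AX by simp
    qed
    show "proj N (R x) = R (proj N x)" if R: "selfadjoint R" "\<forall>x. R (X x) = X (R x)" for R x
    proof (rule orth_projection_commute_selfadjoint[OF P R(1)])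
      fix x assume "proj N x = x"
      then have "x \<in> N" using proj_mem[OF N, of x] by simp
      then have "Y x = 0" by (simp add: N_def)
      moreover have "R (A x) = A (R x)"
        unfolding A_def using R by (intro op_abs_spec(3)[OF X]) auto
      ultimately have "Y (R x) = 0"
        using R by (simp add: Y_def) (metis add.commute bounded_clinear_0 bounded_clinear_add selfadjoint_bounded)
      then show "proj N (R x) = R x" by (intro proj_fix[OF N]) (simp add: N_def)
    qed
  qed
qed

lemma nested_projections:
  assumes P: "orth_projection P" and Q: "orth_projection Q" and sub: "range P \<subseteq> range Q"
  shows "Q (P x) = P x" "P (Q x) = P x"
    "(norm (Q x - P x))\<^sup>2 = (norm (Q x))\<^sup>2 - (norm (P x))\<^sup>2"
proof -
  note p = orth_projectionD[OF P] and q = orth_projectionD[OF Q]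
  show 1: "Q (P x) = P x" for x using sub range_orth_projection[OF Q] by blast
  show 2: "P (Q x) = P x" for x
  proof (rule vector_eq_rdot[THEN iffD1], rule)
    show "inner (P (Q x)) z = inner (P x) z" for z
      by (simp add: selfadjoint_inner[OF p(1)] selfadjoint_inner[OF q(1)] 1)
  qed
  have "inner (Q x) (P x) = (norm (P x))\<^sup>2"
    by (metis 1 p(1,3) q(1) selfadjoint_inner power2_norm_eq_inner)
  then show "(norm (Q x - P x))\<^sup>2 = (norm (Q x))\<^sup>2 - (norm (P x))\<^sup>2"
    by (simp add: power2_norm_eq_inner inner_diff_left inner_diff_right inner_commute)
qed

text \<open>By the Pythagorean identity |E_m x - E_n x|^2 is the difference of the squared norms,
  which form a bounded monotone sequence. Decreasing ranges occur in the right-continuity of the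
  spectral family, increasing ones in the approach to 0 from the left.\<close>

lemma nested_projections_limit:
  fixes E :: "nat \<Rightarrow> 'a::complex_hilbert \<Rightarrow> 'a"
  assumes E: "\<And>n. orth_projection (E n)"
    and mono: "(\<forall>m n. m \<le> n \<longrightarrow> range (E m) \<subseteq> range (E n)) \<or> (\<forall>m n. m \<le> n \<longrightarrow> range (E n) \<subseteq> range (E m))"
  shows "\<exists>P. orth_projection P \<and> (\<forall>x. (\<lambda>n. E n x) \<longlonglongrightarrow> P x)"
proof -
  note e = orth_projectionD[OF E]
  have nested: "range (E m) \<subseteq> range (E n) \<or> range (E n) \<subseteq> range (E m)" for m n
    using mono nle_le by metis
  have diff: "(norm (E m x - E n x))\<^sup>2 = \<bar>(norm (E m x))\<^sup>2 - (norm (E n x))\<^sup>2\<bar>" for m n x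
  proof (cases "range (E m) \<subseteq> range (E n)")
    case True
    from nested_projections(3)[OF E E this, of x] show ?thesis
      by (metis abs_minus_commute abs_of_nonneg norm_minus_commute zero_le_power2)
  next
    case False
    then have "range (E n) \<subseteq> range (E m)" using nested by blast
    from nested_projections(3)[OF E E this, of x] show ?thesis
      by (metis abs_of_nonneg zero_le_power2)
  qed
  have "convergent (\<lambda>n. E n x)" for x
  proof -
    let ?a = "\<lambda>n. (norm (E n x))\<^sup>2"
    have le: "?a m \<le> ?a n" if "range (E m) \<subseteq> range (E n)" for m n
      using nested_projections(3)[OF E E that, of x] by (metis diff_ge_0_iff_ge zero_le_power2)
    have "monoseq ?a"
      using mono le unfolding monoseq_def by meson
    moreover have "Bseq ?a"
      using orth_projection_norm(2)[OF E] by (intro BseqI'[of _ "(norm x)\<^sup>2"]) (simp add: power_mono)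
    ultimately have "Cauchy ?a"
      by (simp add: Bseq_monoseq_convergent convergent_Cauchy)
    then have "Cauchy (\<lambda>n. E n x)"
      unfolding Cauchy_def
    proof (intro allI impI)
      fix r :: real assume a: "\<forall>e>0. \<exists>M. \<forall>m\<ge>M. \<forall>n\<ge>M. dist (?a m) (?a n) < e" and "r > 0"
      then have "r\<^sup>2 > 0" by simp
      then obtain M where M: "\<And>m n. m \<ge> M \<Longrightarrow> n \<ge> M \<Longrightarrow> dist (?a m) (?a n) < r\<^sup>2" using a by meson
      have "dist (E m x) (E n x) < r" if "m \<ge> M" "n \<ge> M" for m n
      proof -
        have "(dist (E m x) (E n x))\<^sup>2 < r\<^sup>2"
          using M[OF that] diff[of m x n] by (simp add: dist_norm)
        then show ?thesis using \<open>r > 0\<close> by (simp add: power2_less_imp_less)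
      qed
      then show "\<exists>M. \<forall>m\<ge>M. \<forall>n\<ge>M. dist (E m x) (E n x) < r" by blast
    qed
    then show ?thesis by (rule Cauchy_convergent)
  qed
  then obtain P where P: "\<And>x. (\<lambda>n. E n x) \<longlonglongrightarrow> P x" unfolding convergent_def by metis
  have n1: "norm (E n x) \<le> 1 * norm x" for n x using orth_projection_norm(2)[OF E] by simp
  have bP: "bounded_clinear P" using bounded_clinear_limit(1)[OF e(2) n1 P] .
  have "selfadjoint P"
  proof (rule selfadjointI[OF bP])
    fix x y
    have "(\<lambda>n. inner (E n x) y) \<longlonglongrightarrow> inner (P x) y" "(\<lambda>n. inner x (E n y)) \<longlonglongrightarrow> inner x (P y)"
      by (intro tendsto_intros P)+
    then show "inner (P x) y = inner x (P y)"
      using LIMSEQ_unique by (simp add: selfadjoint_inner[OF e(1)])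
  qed
  moreover have "P (P x) = P x" for x
  proof -
    have "(\<lambda>n. E n (E n x - P x)) \<longlonglongrightarrow> 0"
    proof (rule Lim_null_comparison)
      show "\<forall>\<^sub>F n in sequentially. norm (E n (E n x - P x)) \<le> norm (E n x - P x)"
        using n1 by (auto intro!: always_eventually)
      show "(\<lambda>n. norm (E n x - P x)) \<longlonglongrightarrow> 0"
        using P[of x] by (simp add: LIM_zero tendsto_norm_zero)
    qed
    from tendsto_add[OF this P[of "P x"]] have "(\<lambda>n. E n x) \<longlonglongrightarrow> P (P x)"
      by (simp add: clinear_simps[OF e(2)] e(3))
    then show ?thesis using LIMSEQ_unique P by blast
  qed
  ultimately show ?thesis using P orth_projectionI by blast
qed

text \<open>
  The two estimates say that \<open>d\<close> is an indefinite Stieltjes integral of \<open>t dF(t)\<close>; two of them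
  differ by \<open>O(h)\<close> on a partition of mesh \<open>h\<close>, hence not at all.
\<close>

definition stieltjes_primitive :: "(real \<Rightarrow> real) \<Rightarrow> (real \<Rightarrow> real) \<Rightarrow> bool" where
  "stieltjes_primitive F d \<longleftrightarrow>
     (\<forall>s t. s \<le> t \<longrightarrow> s * (F t - F s) \<le> d t - d s \<and> d t - d s \<le> t * (F t - F s))"

lemma stieltjes_primitive_unique:
  assumes d: "stieltjes_primitive F d" and e: "stieltjes_primitive F e" and ab: "a \<le> b"
  shows "d b - d a = e b - e a"
proof -
  define g where "g t = d t - e t" for t
  have step: "\<bar>g t - g s\<bar> \<le> (t - s) * (F t - F s)" if "s \<le> t" for s t
  proof -
    have "s * (F t - F s) \<le> d t - d s \<and> d t - d s \<le> t * (F t - F s)"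
      "s * (F t - F s) \<le> e t - e s \<and> e t - e s \<le> t * (F t - F s)"
      using d e that by (auto simp: stieltjes_primitive_def)
    then show ?thesis by (simp add: g_def left_diff_distrib abs_le_iff)
  qed
  have bound: "\<bar>g b - g a\<bar> * real n \<le> (b - a) * (F b - F a)" if n: "n > 0" for n :: nat
  proof -
    define t where "t i = a + real i * ((b - a) / n)" for i
    have t: "t i \<le> t (Suc i)" "t (Suc i) - t i = (b - a) / n" for i
      using ab n by (auto simp: t_def field_simps)
    have ends: "t 0 = a" "t n = b" using n by (auto simp: t_def)
    have "g b - g a = (\<Sum>i<n. g (t (Suc i)) - g (t i))"
      using sum_lessThan_telescope[of "g \<circ> t" n] by (simp add: ends)
    also have "\<bar>\<dots>\<bar> \<le> (\<Sum>i<n. \<bar>g (t (Suc i)) - g (t i)\<bar>)" by (rule sum_abs)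
    also have "\<dots> \<le> (\<Sum>i<n. (b - a) / n * (F (t (Suc i)) - F (t i)))"
      by (rule sum_mono) (use step t in \<open>metis\<close>)
    also have "\<dots> = (b - a) / n * (F b - F a)"
      unfolding sum_distrib_left[symmetric]
      using sum_lessThan_telescope[of "F \<circ> t" n] by (simp add: ends)
    finally show ?thesis using n by (simp add: field_simps)
  qed
  have "g b = g a"
  proof (rule ccontr)
    assume "g b \<noteq> g a"
    then have p: "\<bar>g b - g a\<bar> > 0" by simp
    obtain n :: nat where n: "(b - a) * (F b - F a) < n * \<bar>g b - g a\<bar>"
      using ex_less_of_nat_mult[OF p] by metis
    then have "n > 0" using bound[of 1] by (cases n) auto
    from bound[OF this] n show False by (simp add: mult.commute)
  qed
  then show ?thesis by (simp add: g_def)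
qed

section \<open>Stieltjes measures of distribution functions that are constant outside an
  interval\<close>

context
  fixes F :: "real \<Rightarrow> real" and r c :: real
  assumes F_mono: "\<And>s t. s \<le> t \<Longrightarrow> F s \<le> F t"
    and F_right: "\<And>t. (F \<longlongrightarrow> F t) (at_right t)"
    and F_low: "\<And>t. t < - r \<Longrightarrow> F t = 0" and F_high: "\<And>t. r \<le> t \<Longrightarrow> F t = c"
begin

private abbreviation (input) "\<mu> \<equiv> interval_measure F"

lemma emeasure_stieltjes_Ioc: "a \<le> b \<Longrightarrow> emeasure \<mu> {a<..b} = ennreal (F b - F a)"
  by (rule emeasure_interval_measure_Ioc) (auto simp: F_mono F_right continuous_within)

lemma stieltjes_total_nonneg: "0 \<le> c"
proof -
  \<comment> \<open>\<open>r\<close> may be negative; this point is in any case strictly below -r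
    and at most r.\<close>
  have "F (min (- r - 1) r) \<le> F r" by (rule F_mono) simp
  then show ?thesis using F_low[of "min (- r - 1) r"] F_high[of r] by simp
qed

lemma emeasure_stieltjes_UNIV: "emeasure \<mu> UNIV = ennreal c"
proof -
  let ?A = "\<lambda>n::nat. {- real n<..real n}"
  have "(\<lambda>n. emeasure \<mu> (?A n)) \<longlonglongrightarrow> emeasure \<mu> (\<Union>n. ?A n)"
    by (rule Lim_emeasure_incseq) (auto simp: incseq_def)
  also have "(\<Union>n. ?A n) = UNIV"
  proof -
    have "\<exists>n. x \<in> ?A n" for x
      using reals_Archimedean2[of "\<bar>x\<bar>"] by (auto simp: abs_less_iff intro: less_imp_le)
        (metis abs_less_iff less_imp_le minus_less_iff)
    then show ?thesis by blast
  qed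
  finally have *: "(\<lambda>n. emeasure \<mu> (?A n)) \<longlonglongrightarrow> emeasure \<mu> UNIV" .
  obtain N :: nat where N: "\<bar>r\<bar> < N" using reals_Archimedean2 by blast
  have "emeasure \<mu> (?A n) = ennreal c" if "n \<ge> N" for n
  proof -
    have "F (real n) = c" "F (- real n) = 0" using that N by (auto intro!: F_high F_low)
    then show ?thesis using emeasure_stieltjes_Ioc[of "- real n" "real n"] by simp
  qed
  then have "(\<lambda>n. emeasure \<mu> (?A n)) \<longlonglongrightarrow> ennreal c"
    by (intro tendsto_eventually) (auto simp: eventually_sequentially)
  then show ?thesis using * LIMSEQ_unique by blast
qed

lemma finite_stieltjes: "finite_measure \<mu>"
  by (rule finite_measureI) (simp add: emeasure_stieltjes_UNIV)

interpretation finite_measure \<mu> by (rule finite_stieltjes)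

lemma measure_stieltjes_UNIV: "measure \<mu> UNIV = c"
  by (simp add: measure_def emeasure_stieltjes_UNIV stieltjes_total_nonneg)

lemma measure_stieltjes_Ioc: "a \<le> b \<Longrightarrow> measure \<mu> {a<..b} = F b - F a"
  by (simp add: measure_def emeasure_stieltjes_Ioc F_mono)

lemma measure_stieltjes_atMost: "measure \<mu> {..s} = F s"
proof -
  let ?A = "\<lambda>n::nat. {- real n<..s}"
  have "(\<lambda>n. measure \<mu> (?A n)) \<longlonglongrightarrow> measure \<mu> (\<Union>n. ?A n)"
    by (rule finite_Lim_measure_incseq) (auto simp: incseq_def)
  also have "(\<Union>n. ?A n) = {..s}"
  proof -
    have "\<exists>n. - real n < x" for x
      using reals_Archimedean2[of "- x"] by (metis minus_less_iff)
    then show ?thesis by auto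
  qed
  finally have *: "(\<lambda>n. measure \<mu> (?A n)) \<longlonglongrightarrow> measure \<mu> {..s}" .
  obtain N :: nat where N: "\<bar>r\<bar> + \<bar>s\<bar> < N" using reals_Archimedean2 by blast
  have "measure \<mu> (?A n) = F s" if "n \<ge> N" for n
  proof -
    have "F (- real n) = 0" "- real n \<le> s" using that N by (auto intro!: F_low)
    then show ?thesis using measure_stieltjes_Ioc[of "- real n" s] by simp
  qed
  then have "(\<lambda>n. measure \<mu> (?A n)) \<longlonglongrightarrow> F s"
    by (intro tendsto_eventually) (auto simp: eventually_sequentially)
  then show ?thesis using * LIMSEQ_unique by blast
qed

lemma stieltjes_AE:
  assumes a: "a < - r" and b: "r \<le> b"
  shows "AE t in \<mu>. a < t \<and> t \<le> b"
proof -
  have "measure \<mu> {..a} = 0" using a by (simp add: measure_stieltjes_atMost F_low)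
  then have 1: "AE t in \<mu>. t \<notin> {..a}" by (intro AE_not_in) (auto simp: null_sets_def emeasure_eq_measure)
  have "measure \<mu> (UNIV - {..b}) = 0"
    using b finite_measure_compl[of "{..b}"]
    by (simp add: measure_stieltjes_atMost F_high measure_stieltjes_UNIV)
  then have 2: "AE t in \<mu>. t \<notin> UNIV - {..b}"
    by (intro AE_not_in) (auto simp: null_sets_def emeasure_eq_measure)
  from 1 2 show ?thesis by eventually_elim auto
qed

lemma stieltjes_integrable_ident: "integrable \<mu> (\<lambda>t. t)"
proof (rule integrable_const_bound)
  show "AE t in \<mu>. norm t \<le> \<bar>r\<bar> + 1"
    using stieltjes_AE[of "- \<bar>r\<bar> - 1" "\<bar>r\<bar> + 1"] by (rule AE_mp) auto
qed simp

lemma stieltjes_integrable_ident_on: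
  "S \<in> sets borel \<Longrightarrow> integrable \<mu> (\<lambda>t. t * indicator S t)"
  using integrable_mult_indicator[OF _ stieltjes_integrable_ident, of S] by (simp add: mult.commute)

lemma stieltjes_primitive_integral:
  "stieltjes_primitive F (\<lambda>s. \<integral>t. t * indicator {..s} t \<partial>\<mu>)"
  unfolding stieltjes_primitive_def
proof (intro allI impI)
  fix s t :: real assume st: "s \<le> t"
  have "(\<integral>x. x * indicator {..t} x \<partial>\<mu>) - (\<integral>x. x * indicator {..s} x \<partial>\<mu>)
      = (\<integral>x. x * indicator {..t} x - x * indicator {..s} x \<partial>\<mu>)"
    by (intro Bochner_Integration.integral_diff[symmetric] stieltjes_integrable_ident_on) auto
  also have "\<dots> = (\<integral>x. x * indicator {s<..t} x \<partial>\<mu>)"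
    using st by (intro Bochner_Integration.integral_cong) (auto simp: indicator_def)
  finally have eq: "(\<integral>x. x * indicator {..t} x \<partial>\<mu>) - (\<integral>x. x * indicator {..s} x \<partial>\<mu>)
      = (\<integral>x. x * indicator {s<..t} x \<partial>\<mu>)" .
  have m: "(\<integral>x. k * indicator {s<..t} x \<partial>\<mu>) = k * (F t - F s)" for k
    using measure_stieltjes_Ioc[OF st] by simp
  have i: "integrable \<mu> (\<lambda>x. k * indicator {s<..t} x :: real)" for k
    by (intro integrable_mult_right integrable_real_indicator) (auto simp: emeasure_eq_measure)
  have "(\<integral>x. s * indicator {s<..t} x \<partial>\<mu>) \<le> (\<integral>x. x * indicator {s<..t} x \<partial>\<mu>)"
    by (intro integral_mono stieltjes_integrable_ident_on i) (auto simp: indicator_def)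
  moreover have "(\<integral>x. x * indicator {s<..t} x \<partial>\<mu>) \<le> (\<integral>x. t * indicator {s<..t} x \<partial>\<mu>)"
    by (intro integral_mono stieltjes_integrable_ident_on i) (auto simp: indicator_def)
  ultimately show "s * (F t - F s)
        \<le> (\<integral>x. x * indicator {..t} x \<partial>\<mu>) - (\<integral>x. x * indicator {..s} x \<partial>\<mu>) \<and>
      (\<integral>x. x * indicator {..t} x \<partial>\<mu>) - (\<integral>x. x * indicator {..s} x \<partial>\<mu>) \<le> t * (F t - F s)"
    unfolding eq m by blast
qed

text \<open>Reduces the integral to increments of any primitive, so that no further measure theory
  is needed for forms. It is applied in both directions: to verify the constructed spectral family,
  and to extract form bounds from a given one.\<close>

lemma stieltjes_integral_primitive:
  assumes d: "stieltjes_primitive F d" and a: "a < - r" and b: "r \<le> b" and ab: "a \<le> b"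
  shows "(\<integral>t. t \<partial>\<mu>) = d b - d a"
proof -
  have "d b - d a = (\<integral>t. t * indicator {..b} t \<partial>\<mu>) - (\<integral>t. t * indicator {..a} t \<partial>\<mu>)"
    by (rule stieltjes_primitive_unique[OF d stieltjes_primitive_integral ab])
  moreover have "(\<integral>t. t * indicator {..b} t \<partial>\<mu>) = (\<integral>t. t \<partial>\<mu>)"
    by (intro integral_cong_AE) (use stieltjes_AE[OF a b] in \<open>auto elim!: AE_mp simp: indicator_def\<close>)
  moreover have "(\<integral>t. t * indicator {..a} t \<partial>\<mu>) = (\<integral>t. 0 \<partial>\<mu>)"
    by (intro integral_cong_AE) (use stieltjes_AE[OF a b] in \<open>auto elim!: AE_mp simp: indicator_def\<close>)
  ultimately show ?thesis by simp
qed

lemma stieltjes_primitive_exists: "\<exists>d. stieltjes_primitive F d"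
  using stieltjes_primitive_integral by blast

text \<open>The left limit of \<open>F\<close> at 0 is the mass of the open half-line, whether or
  not \<open>F\<close> jumps at 0.\<close>

lemma stieltjes_negative_limit: "(\<lambda>n. F (- 1 / real (Suc n))) \<longlonglongrightarrow> measure \<mu> {..<0}"
proof -
  have "(\<lambda>n. measure \<mu> {..- 1 / real (Suc n)}) \<longlonglongrightarrow> measure \<mu> (\<Union>n. {..- 1 / real (Suc n)})"
    by (rule finite_Lim_measure_incseq) (auto simp: incseq_def frac_le)
  moreover have "(\<Union>n. {..- 1 / real (Suc n)}) = {..<0}"
  proof -
    have "\<exists>n. x \<le> - 1 / real (Suc n)" if "x < 0" for x
    proof -
      have "0 < - x" using that by simp
      then obtain n where "inverse (real (Suc n)) < - x" using reals_Archimedean by blast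
      then show ?thesis by (intro exI[of _ n]) (simp add: inverse_eq_divide)
    qed
    moreover have "- 1 / real (Suc n) < 0" for n by simp
    ultimately show ?thesis by (auto intro: le_less_trans)
  qed
  ultimately show ?thesis by (simp add: measure_stieltjes_atMost)
qed

lemma integral_stieltjes_sign:
  "(\<integral>t. (if 0 \<le> t then 1 else - 1 :: real) \<partial>\<mu>) = c - 2 * measure \<mu> {..<0}"
proof -
  have "(\<integral>t. (if 0 \<le> t then 1 else - 1 :: real) \<partial>\<mu>) = (\<integral>t. 1 - 2 * indicat_real {..<0} t \<partial>\<mu>)"
    by (intro Bochner_Integration.integral_cong) (auto simp: indicator_def)
  also have "\<dots> = (\<integral>t. 1 \<partial>\<mu>) - (\<integral>t. 2 * indicat_real {..<0} t \<partial>\<mu>)"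
    by (intro Bochner_Integration.integral_diff integrable_mult_right integrable_real_indicator)
      (auto simp: emeasure_eq_measure)
  also have "\<dots> = c - 2 * measure \<mu> {..<0}" by (simp add: measure_stieltjes_UNIV)
  finally show ?thesis .
qed

end

text \<open>\<open>E t\<close> projects onto the part of the space where H - t is nonpositive. These
  projections commute with \<open>H\<close> and with each other, so a vector split by two of them
  satisfies both form bounds, and contradictory bounds leave only 0. The function t to (H E_t x, x)
  is a primitive, which evaluates the weak integral.\<close>

lemma spectral_family_exists:
  fixes H :: "'a::complex_hilbert \<Rightarrow> 'a"
  assumes H: "selfadjoint H"
  shows "\<exists>E. is_spectral_family H E"
proof -
  note h = clinear_simps[OF selfadjoint_bounded[OF H]]
  define X where "X t = (\<lambda>x. H x - t *\<^sub>R x)" for t :: real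
  have X: "selfadjoint (X t)" for t
    using selfadjoint_diff[OF H selfadjoint_scaleR[OF selfadjoint_id, of t]]
    by (simp add: X_def fun_diff_def)
  have "\<forall>t. \<exists>P. orth_projection P \<and> (\<forall>x. P x = x \<longrightarrow> inner (X t x) x \<le> 0) \<and>
     (\<forall>y. P y = 0 \<longrightarrow> y \<noteq> 0 \<longrightarrow> 0 < inner (X t y) y) \<and>
     (\<forall>R. selfadjoint R \<longrightarrow> (\<forall>x. R (X t x) = X t (R x)) \<longrightarrow> (\<forall>x. P (R x) = R (P x)))"
    by (intro allI nonpos_projection_exists X)
  then obtain E where E0: "\<forall>t. orth_projection (E t) \<and>
     (\<forall>x. E t x = x \<longrightarrow> inner (X t x) x \<le> 0) \<and>
     (\<forall>y. E t y = 0 \<longrightarrow> y \<noteq> 0 \<longrightarrow> 0 < inner (X t y) y) \<and>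
     (\<forall>R. selfadjoint R \<longrightarrow> (\<forall>x. R (X t x) = X t (R x)) \<longrightarrow> (\<forall>x. E t (R x) = R (E t x)))"
    by (elim exE[OF choice])
  have E: "orth_projection (E t)" "E t x = x \<Longrightarrow> inner (X t x) x \<le> 0"
    "E t x = 0 \<Longrightarrow> x \<noteq> 0 \<Longrightarrow> 0 < inner (X t x) x"
    "selfadjoint R \<Longrightarrow> (\<And>x. R (X t x) = X t (R x)) \<Longrightarrow> E t (R x) = R (E t x)" for t x R
    using spec[OF E0, of t] by auto
  note e = orth_projectionD[OF E(1)] and es = clinear_simps[OF orth_projectionD(2)[OF E(1)]]
  have low: "inner (H x) x \<le> t * (norm x)\<^sup>2" if "E t x = x" for t x
    using E(2)[OF that] by (simp add: X_def inner_diff_left power2_norm_eq_inner)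
  have high: "t * (norm x)\<^sup>2 < inner (H x) x" if "E t x = 0" "x \<noteq> 0" for t x
    using E(3)[OF that] by (simp add: X_def inner_diff_left power2_norm_eq_inner)
  have high': "t * (norm x)\<^sup>2 \<le> inner (H x) x" if "E t x = 0" for t x
    using high[OF that] by (cases "x = 0") (auto simp: h)
  have comm: "E t (R x) = R (E t x)" if "selfadjoint R" "\<And>x. R (H x) = H (R x)" for t R x
    using that by (intro E(4)) (auto simp: X_def clinear_simps[OF selfadjoint_bounded[OF that(1)]])
  have EH: "E t (H x) = H (E t x)" for t x by (rule comm[OF H]) simp
  have EE: "E t (E s x) = E s (E t x)" for s t x
    by (rule comm[OF e(1)]) (rule EH)
  have nest: "range (E s) \<subseteq> range (E t)" if st: "s \<le> t" for s t
  proof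
    fix x assume "x \<in> range (E s)"
    then have x: "E s x = x" by (simp add: range_orth_projection[OF E(1)])
    define y where "y = x - E t x"
    have "E t y = 0" "E s y = y" by (simp_all add: y_def es e(3) EE[of s t] x)
    then have "y = 0" using low[of s y] high[of t y] mult_right_mono[OF st, of "(norm y)\<^sup>2"] by force
    then show "x \<in> range (E t)" by (simp add: range_orth_projection[OF E(1)] y_def)
  qed
  note np = nested_projections[OF E(1) E(1) nest]
  have F_mono: "(norm (E s x))\<^sup>2 \<le> (norm (E t x))\<^sup>2" if "s \<le> t" for s t x
    using np(3)[OF that, of x] by (metis diff_ge_0_iff_ge zero_le_power2)
  have right: "((\<lambda>s. E s x) \<longlongrightarrow> E t x) (at_right t)" for t x
  proof -
    let ?t = "\<lambda>n. t + 1 / real (Suc n)"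
    have "\<forall>m n. m \<le> n \<longrightarrow> range (E (?t n)) \<subseteq> range (E (?t m))"
      by (intro allI impI nest) (simp add: frac_le)
    then obtain P where P: "orth_projection P" "\<And>x. (\<lambda>n. E (?t n) x) \<longlonglongrightarrow> P x"
      using nested_projections_limit[of "\<lambda>n. E (?t n)"] E(1) by blast
    have tn: "?t \<longlonglongrightarrow> t"
      using tendsto_add[OF tendsto_const[of t] LIMSEQ_inverse_real_of_nat] by (simp add: inverse_eq_divide)
    \<comment> \<open>A possible jump to the right of \<open>t\<close>: it lies in the range of
      every \<open>E (?t n)\<close> and in the kernel of \<open>E t\<close>, so its form is at most
      t |z|^2 and, unless z vanishes, larger than that.\<close>
    define z where "z = P x - E t (P x)"
    have "E (?t n) (P x) = P x" for n
    proof (rule LIMSEQ_unique)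
      show "(\<lambda>k. E (?t n) (E (?t k) x)) \<longlonglongrightarrow> E (?t n) (P x)"
        by (rule bounded_clinear_tendsto[OF e(2) P(2)])
      show "(\<lambda>k. E (?t n) (E (?t k) x)) \<longlonglongrightarrow> P x"
      proof (rule Lim_transform_eventually[OF P(2)])
        show "\<forall>\<^sub>F k in sequentially. E (?t k) x = E (?t n) (E (?t k) x)"
          unfolding eventually_sequentially
          by (intro exI[of _ n] allI impI np(1)[symmetric]) (simp add: frac_le)
      qed
    qed
    then have "E (?t n) z = z" for n by (simp add: z_def es EE[of _ t])
    then have "inner (H z) z \<le> ?t n * (norm z)\<^sup>2" for n by (rule low)
    moreover have "(\<lambda>n. ?t n * (norm z)\<^sup>2) \<longlonglongrightarrow> t * (norm z)\<^sup>2" by (intro tendsto_intros tn)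
    ultimately have "inner (H z) z \<le> t * (norm z)\<^sup>2" by (meson LIMSEQ_le_const)
    moreover have "E t z = 0" by (simp add: z_def es e(3))
    ultimately have "z = 0" using high[of t z] by force
    moreover have "E t (P x) = E t x"
    proof (rule LIMSEQ_unique[OF bounded_clinear_tendsto[OF e(2) P(2)]])
      have "E t (E (?t k) x) = E t x" for k by (rule np(2)) simp
      then show "(\<lambda>k. E t (E (?t k) x)) \<longlonglongrightarrow> E t x" by simp
    qed
    ultimately have lim: "(\<lambda>n. E (?t n) x) \<longlonglongrightarrow> E t x" using P(2)[of x] by (simp add: z_def)
    show ?thesis
    proof (rule tendstoI)
      fix r :: real assume "r > 0"
      then obtain n where n: "dist (E (?t n) x) (E t x) < r"
        using tendstoD[OF lim, of r] by (auto simp: eventually_sequentially)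
      have "dist (E s x) (E t x) < r" if s: "t < s" "s < ?t n" for s
      proof -
        have "(norm (E s x - E t x))\<^sup>2 \<le> (norm (E (?t n) x - E t x))\<^sup>2"
          using np(3)[of t s x] np(3)[of t "?t n" x] F_mono[of s "?t n" x] s by simp
        then have "norm (E s x - E t x) \<le> norm (E (?t n) x - E t x)" by (rule power2_le_imp_le) simp
        then show ?thesis using n by (simp add: dist_norm)
      qed
      then show "\<forall>\<^sub>F s in at_right t. dist (E s x) (E t x) < r"
        unfolding eventually_at_right_field by (intro exI[of _ "?t n"]) auto
    qed
  qed
  obtain K where K: "K > 0" "\<And>x. norm (H x) \<le> K * norm x"
    using bounded_clinear_bound[OF selfadjoint_bounded[OF H]] by metis
  have HK: "\<bar>inner (H x) x\<bar> \<le> K * (norm x)\<^sup>2" for x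
    using Cauchy_Schwarz_ineq2[of "H x" x] mult_right_mono[OF K(2), of "norm x" x]
    by (simp add: power2_eq_square mult.assoc)
  have E_low: "E t = 0" if "t < - K" for t
  proof
    fix x
    define y where "y = E t x"
    have "inner (H y) y \<le> t * (norm y)\<^sup>2" by (rule low) (simp add: y_def e(3))
    moreover have "- (K * (norm y)\<^sup>2) \<le> inner (H y) y" using HK[of y] by linarith
    ultimately have "0 \<le> (t + K) * (norm y)\<^sup>2" by (simp add: distrib_right)
    then have "y = 0" using that by (auto simp: zero_le_mult_iff)
    then show "E t x = 0 x" by (simp add: y_def)
  qed
  have E_high: "E t = id" if "K \<le> t" for t
  proof
    fix x
    define y where "y = x - E t x"
    have "y = 0"
    proof (rule ccontr)
      assume "y \<noteq> 0"
      moreover have "E t y = 0" by (simp add: y_def es e(3))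
      ultimately have "t * (norm y)\<^sup>2 < inner (H y) y" using high by blast
      also have "\<dots> \<le> K * (norm y)\<^sup>2" using HK[of y] by linarith
      finally show False using mult_right_mono[OF that, of "(norm y)\<^sup>2"] by simp
    qed
    then show "E t x = id x" by (simp add: y_def)
  qed
  have F_eq: "Re (cinner (E t x) x) = (norm (E t x))\<^sup>2" for t x
    using orth_projection_norm(1)[OF E(1)] by (simp add: inner_eq_Re_cinner)
  have integral: "cinner (H x) x = complex_of_real (\<integral>t. t \<partial>stieltjes E x)" for x
  proof -
    let ?F = "\<lambda>t. (norm (E t x))\<^sup>2"
    have "stieltjes_primitive ?F (\<lambda>t. inner (H (E t x)) x)"
      unfolding stieltjes_primitive_def
    proof (intro allI impI)
      fix s t :: real assume st: "s \<le> t"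
      define z where "z = E t x - E s x"
      have Ez: "E t z = z" "E s z = 0"
        using np(1,2)[OF st] by (simp_all add: z_def es e(3))
      have nz: "(norm z)\<^sup>2 = ?F t - ?F s" unfolding z_def by (rule np(3)[OF st])
      have "inner (H z) x = inner (H (E t z - E s z)) x" by (simp add: Ez)
      also have "\<dots> = inner (H z) (E t x - E s x)"
        by (simp add: h es inner_diff_left inner_diff_right selfadjoint_inner[OF e(1)] flip: EH)
      finally have "inner (H (E t x)) x - inner (H (E s x)) x = inner (H z) z"
        by (simp add: z_def h inner_diff_left)
      then show "s * (?F t - ?F s) \<le> inner (H (E t x)) x - inner (H (E s x)) x \<and>
          inner (H (E t x)) x - inner (H (E s x)) x \<le> t * (?F t - ?F s)"
        using low[OF Ez(1)] high'[OF Ez(2)] by (simp add: nz)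
    qed
    \<comment> \<open>The left end has to lie strictly below -K, where \<open>E\<close> vanishes; at
      K itself \<open>E\<close> is already the identity.\<close>
    then have "(\<integral>t. t \<partial>interval_measure ?F) = inner (H (E K x)) x - inner (H (E (- K - 1) x)) x"
    proof (rule stieltjes_integral_primitive[rotated 4, where c="(norm x)\<^sup>2"])
      show "(?F \<longlongrightarrow> ?F t) (at_right t)" for t by (intro tendsto_intros right)
      show "?F s \<le> ?F t" if "s \<le> t" for s t by (rule F_mono[OF that])
    qed (use K in \<open>auto simp: E_low E_high\<close>)
    also have "\<dots> = inner (H x) x" using K by (simp add: E_low E_high h)
    finally show ?thesis by (simp add: cinner_selfadjoint[OF H] stieltjes_def F_eq)
  qed
  have "is_spectral_family H E"
    unfolding is_spectral_family_def using E(1) nest right integral E_low E_high by blast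
  then show ?thesis by blast
qed

section \<open>The negative spectral projection\<close>

context
  fixes H :: "'a::complex_hilbert \<Rightarrow> 'a" and E :: "real \<Rightarrow> 'a \<Rightarrow> 'a"
  assumes H: "selfadjoint H" and sf: "is_spectral_family H E"
begin

text \<open>\<open>spectral_family\<close> is an arbitrary choice, so everything below is derived
  from \<open>is_spectral_family\<close> and not from the family constructed above.\<close>

private lemma E: "orth_projection (E t)" and nest: "s \<le> t \<Longrightarrow> range (E s) \<subseteq> range (E t)"
  and right: "((\<lambda>s. E s x) \<longlongrightarrow> E t x) (at_right t)"
  and form: "cinner (H x) x = complex_of_real (\<integral>t. t \<partial>stieltjes E x)"
  using sf unfolding is_spectral_family_def by blast+

private lemmas e = orth_projectionD[OF E]
private lemmas es = clinear_simps[OF orth_projectionD(2)[OF E]]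
private lemmas np = nested_projections[OF E E nest]

private abbreviation (input) "F x t \<equiv> (norm (E t x))\<^sup>2"

private lemma bounds: "\<exists>r. (\<forall>t < - r. E t = 0) \<and> (\<forall>t\<ge>r. E t = id)"
  using sf unfolding is_spectral_family_def by blast

private lemma stieltjes_eq: "stieltjes E x = interval_measure (F x)"
  using orth_projection_norm(1)[OF E] by (simp add: stieltjes_def inner_eq_Re_cinner)

private lemma F_mono: "s \<le> t \<Longrightarrow> F x s \<le> F x t"
  using np(3)[of s t x] by (metis diff_ge_0_iff_ge zero_le_power2)

private lemma F_right: "(F x \<longlongrightarrow> F x t) (at_right t)"
  by (intro tendsto_intros right)

private lemma primitive: "\<exists>d. stieltjes_primitive (F x) d"
proof -
  obtain r where "\<And>t. t < - r \<Longrightarrow> E t = 0" "\<And>t. r \<le> t \<Longrightarrow> E t = id" using bounds by blast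
  then show ?thesis
    by (intro stieltjes_primitive_exists[where r=r and c="(norm x)\<^sup>2"] F_right F_mono) simp_all
qed

text \<open>The radius \<open>r\<close> is uniform in \<open>x\<close>, so that the forms at x, y
  and x + y can be evaluated over one common interval.\<close>

private lemma form_primitive:
  "\<exists>r. \<forall>x d a b. stieltjes_primitive (F x) d \<longrightarrow> a < - r \<longrightarrow> r \<le> b \<longrightarrow> a \<le> b
     \<longrightarrow> E a = 0 \<and> E b = id \<and> inner (H x) x = d b - d a"
proof -
  obtain r where r: "\<And>t. t < - r \<Longrightarrow> E t = 0" "\<And>t. r \<le> t \<Longrightarrow> E t = id" using bounds by blast
  have "inner (H x) x = d b - d a"
    if "stieltjes_primitive (F x) d" "a < - r" "r \<le> b" "a \<le> b" for x d a b
  proof -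
    have "(\<integral>t. t \<partial>interval_measure (F x)) = d b - d a"
    proof (rule stieltjes_integral_primitive[where r=r and c="(norm x)\<^sup>2" and F="F x" and d=d])
      show "(F x \<longlongrightarrow> F x t) (at_right t)" for t by (rule F_right)
      show "F x s \<le> F x t" if "s \<le> t" for s t by (rule F_mono[OF that])
    qed (use that in \<open>auto simp: r\<close>)
    then show ?thesis using form[of x]
      unfolding cinner_selfadjoint[OF H] stieltjes_eq of_real_eq_iff by simp
  qed
  with r show ?thesis by blast
qed

text \<open>As \<open>E s x = x\<close>, the distribution function is constant to the right of
  \<open>s\<close>. A primitive has no increment there, and to the left its increment is at most
  \<open>s\<close> times the total mass.\<close>

private lemma E_upper: "inner (H x) x \<le> s * (norm x)\<^sup>2" if x: "E s x = x"
proof -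
  obtain d where d: "stieltjes_primitive (F x) d" using primitive by blast
  obtain r where r: "\<And>a b. a < - r \<Longrightarrow> r \<le> b \<Longrightarrow> a \<le> b \<Longrightarrow>
      E a = 0 \<and> E b = id \<and> inner (H x) x = d b - d a" using form_primitive d by blast
  define a b where "a = min (- r - 1) s" and "b = max (max r s) (- r)"
  have ab: "a \<le> s" "s \<le> b" "E a = 0" "E b = id" "inner (H x) x = d b - d a"
    using r[of a b] by (auto simp: a_def b_def)
  have "d s - d a \<le> s * (F x s - F x a)" "d b - d s \<le> b * (F x b - F x s)"
    using d ab(1,2) by (auto simp: stieltjes_primitive_def)
  then show ?thesis using ab x by simp
qed

private lemma E_lower: "s * (norm x)\<^sup>2 \<le> inner (H x) x" if x: "E s x = 0"
proof -
  obtain d where d: "stieltjes_primitive (F x) d" using primitive by blast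
  obtain r where r: "\<And>a b. a < - r \<Longrightarrow> r \<le> b \<Longrightarrow> a \<le> b \<Longrightarrow>
      E a = 0 \<and> E b = id \<and> inner (H x) x = d b - d a" using form_primitive d by blast
  define a b where "a = min (- r - 1) s" and "b = max (max r s) (- r)"
  have ab: "a \<le> s" "s \<le> b" "E a = 0" "E b = id" "inner (H x) x = d b - d a"
    using r[of a b] by (auto simp: a_def b_def)
  have "a * (F x s - F x a) \<le> d s - d a" "s * (F x b - F x s) \<le> d b - d s"
    using d ab(1,2) by (auto simp: stieltjes_primitive_def)
  then show ?thesis using ab x by simp
qed

text \<open>For \<open>x\<close> in the range and \<open>y\<close> in the kernel of \<open>E s\<close> the distribution functions add up.\<close>

private lemma E_cross: "inner (H x) y = 0" if x: "E s x = x" and y: "E s y = 0"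
proof -
  obtain d1 where d1: "stieltjes_primitive (F x) d1" using primitive by blast
  obtain d2 where d2: "stieltjes_primitive (F y) d2" using primitive by blast
  have add: "F (x + y) t = F x t + F y t" for t
  proof -
    have "inner (E t x) (E t y) = inner (E t x) y"
      by (metis e(1,3) selfadjoint_inner)
    also have "\<dots> = 0"
    proof (cases "t \<le> s")
      case True
      have "E s (E t x) = E t x" by (rule np(1)[OF True])
      then show ?thesis by (metis e(1) inner_zero_right selfadjoint_inner y)
    next
      case False
      then have "E t x = x" using np(1)[of s t x] x by simp
      then show ?thesis by (metis e(1) inner_zero_right selfadjoint_inner x y)
    qed
    finally show ?thesis
      by (simp add: es power2_norm_eq_inner inner_add_left inner_add_right inner_commute)
  qed
  have "stieltjes_primitive (F (x + y)) (\<lambda>t. d1 t + d2 t)"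
    unfolding stieltjes_primitive_def
  proof (intro allI impI)
    fix u t :: real assume ut: "u \<le> t"
    have "u * (F x t - F x u) \<le> d1 t - d1 u \<and> d1 t - d1 u \<le> t * (F x t - F x u)"
      "u * (F y t - F y u) \<le> d2 t - d2 u \<and> d2 t - d2 u \<le> t * (F y t - F y u)"
      using d1 d2 ut by (auto simp: stieltjes_primitive_def)
    then show "u * (F (x + y) t - F (x + y) u) \<le> d1 t + d2 t - (d1 u + d2 u) \<and>
        d1 t + d2 t - (d1 u + d2 u) \<le> t * (F (x + y) t - F (x + y) u)"
      unfolding add by (simp add: algebra_simps)
  qed
  moreover obtain r where r: "\<And>x d a b. stieltjes_primitive (F x) d \<Longrightarrow> a < - r \<Longrightarrow> r \<le> b \<Longrightarrow> a \<le> b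
     \<Longrightarrow> inner (H x) x = d b - d a" using form_primitive by blast
  moreover define a b where "a = - \<bar>r\<bar> - 1" and "b = \<bar>r\<bar>"
  ultimately have "inner (H (x + y)) (x + y) = inner (H x) x + inner (H y) y"
    using r[OF d1, of a b] r[OF d2, of a b] r[of "x + y" "\<lambda>t. d1 t + d2 t" a b] by simp
  then have "inner (H x) y + inner (H y) x = 0"
    by (simp add: clinear_simps[OF selfadjoint_bounded[OF H]] inner_add_left inner_add_right)
  moreover have "inner (H y) x = inner (H x) y" by (metis H inner_commute selfadjoint_inner)
  ultimately show ?thesis by simp
qed

text \<open>Commutation is not among the defining properties of a spectral family. By
  \<open>E_cross\<close>, \<open>H\<close> maps the range of \<open>E s\<close> into the complement
  of the kernel, that is, into the range again.\<close>

private lemma E_commute: "E s (H x) = H (E s x)"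
proof (rule orth_projection_commute_selfadjoint[OF E H])
  fix x assume x: "E s x = x"
  have "inner (H x) (z - E s z) = 0" for z
    by (rule E_cross[OF x]) (simp add: es e(3))
  then have "inner (E s (H x)) z = inner (H x) z" for z
    by (metis diff_eq_diff_eq e(1) eq_iff_diff_eq_0 inner_diff_right selfadjoint_inner)
  then show "E s (H x) = H x" by (metis vector_eq_rdot)
qed

text \<open>\<open>Q\<close> is the left limit of \<open>E\<close> at 0, the strong limit of the
  projections at -1 / (n + 1); the two integrals identify it, and the sign, within the functional
  calculus. If the range of \<open>Q\<close> is finite-dimensional, the increasing ranges become
  stationary, so \<open>Q\<close> equals one of the approximating projections and inherits its form
  bound as a gap.\<close>

lemma negative_projection_of_family:
  "\<exists>Q. orth_projection Q \<and> (\<forall>x. Q (H x) = H (Q x)) \<and>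
     (\<forall>x. Q x = x \<longrightarrow> x \<noteq> 0 \<longrightarrow> inner (H x) x < 0) \<and>
     (\<forall>x. Q x = 0 \<longrightarrow> 0 \<le> inner (H x) x) \<and>
     (\<forall>x. (\<integral>t. indicat_real {..<0} t \<partial>stieltjes E x) = inner (Q x) x) \<and>
     (\<forall>x. (\<integral>t. (if 0 \<le> t then 1 else - 1 :: real) \<partial>stieltjes E x) = (norm x)\<^sup>2 - 2 * inner (Q x) x) \<and>
     (cdim (range Q) \<noteq> \<infinity> \<longrightarrow> (\<exists>\<delta>>0. \<forall>x. Q x = x \<longrightarrow> inner (H x) x \<le> - \<delta> * (norm x)\<^sup>2))"
proof -
  define P where "P n = E (- 1 / real (Suc n))" for n
  have PE: "orth_projection (P n)" for n by (simp add: P_def E)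
  note p = orth_projectionD[OF PE] and ps = clinear_simps[OF orth_projectionD(2)[OF PE]]
  have Pnest: "range (P m) \<subseteq> range (P n)" if "m \<le> n" for m n
    unfolding P_def by (rule nest) (use that in \<open>simp add: frac_le\<close>)
  obtain Q where Q: "orth_projection Q" "\<And>x. (\<lambda>n. P n x) \<longlonglongrightarrow> Q x"
    using nested_projections_limit[of P] PE Pnest by blast
  note q = orth_projectionD[OF Q(1)] and qs = clinear_simps[OF orth_projectionD(2)[OF Q(1)]]
  note h = clinear_simps[OF selfadjoint_bounded[OF H]]
  have PQ: "P n (Q x) = P n x" for n x
  proof (rule LIMSEQ_unique[OF bounded_clinear_tendsto[OF p(2) Q(2)]])
    show "(\<lambda>m. P n (P m x)) \<longlonglongrightarrow> P n x"
    proof (rule Lim_transform_eventually[OF tendsto_const])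
      show "\<forall>\<^sub>F m in sequentially. P n x = P n (P m x)"
        unfolding eventually_sequentially
        by (intro exI[of _ n] allI impI nested_projections(2)[symmetric] PE Pnest)
    qed
  qed
  have QP: "Q (P n x) = P n x" for n x
  proof (rule vector_eq_rdot[THEN iffD1], rule)
    show "inner (Q (P n x)) z = inner (P n x) z" for z
      by (metis PQ p(1) q(1) selfadjoint_inner)
  qed
  have QH: "Q (H x) = H (Q x)" for x
    using LIMSEQ_unique[OF Q(2)[of "H x"]] bounded_clinear_tendsto[OF selfadjoint_bounded[OF H] Q(2)[of x]]
    by (simp add: P_def E_commute)
  have le0: "inner (H x) x \<le> 0" if x: "Q x = x" for x
  proof -
    have "(\<lambda>n. inner (H (P n x)) (P n x)) \<longlonglongrightarrow> inner (H (Q x)) (Q x)"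
      by (intro tendsto_inner bounded_clinear_tendsto[OF selfadjoint_bounded[OF H]] Q(2))
    moreover have "inner (H (P n x)) (P n x) \<le> 0" for n
    proof -
      have "inner (H (P n x)) (P n x) \<le> - 1 / real (Suc n) * (norm (P n x))\<^sup>2"
        unfolding P_def by (rule E_upper) (rule e(3))
      also have "\<dots> \<le> 0" by simp
      finally show ?thesis .
    qed
    ultimately have "inner (H (Q x)) (Q x) \<le> 0" by (intro LIMSEQ_le_const2) auto
    then show ?thesis using x by simp
  qed
  have neg: "inner (H x) x < 0" if x: "Q x = x" "x \<noteq> 0" for x
  proof -
    have "\<exists>n. P n x \<noteq> 0"
    proof (rule ccontr)
      assume "\<nexists>n. P n x \<noteq> 0"
      then have "(\<lambda>n. P n x) = (\<lambda>_. 0)" by blast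
      then show False using Q(2)[of x] x LIMSEQ_unique[OF tendsto_const] by metis
    qed
    then obtain n where n: "P n x \<noteq> 0" by blast
    \<comment> \<open>Since \<open>Q x = x\<close> is nonzero, some \<open>P n x\<close> is nonzero
      and has strictly negative form; the remainder \<open>z\<close> contributes at most 0 and the
      cross terms vanish.\<close>
    define y z where "y = P n x" and "z = x - P n x"
    have y: "inner (H y) y \<le> - 1 / real (Suc n) * (norm y)\<^sup>2"
      unfolding y_def P_def by (rule E_upper) (rule e(3))
    also have "\<dots> < 0" using n by (simp add: y_def divide_neg_pos)
    finally have y: "inner (H y) y < 0" .
    have z: "inner (H z) z \<le> 0" by (rule le0) (simp add: z_def qs QP x)
    have c: "inner (H y) z = 0"
      unfolding y_def z_def P_def by (rule E_cross[of "- 1 / real (Suc n)"]) (simp_all only: es e(3) diff_self)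
    have c': "inner (H z) y = 0" using c by (metis H inner_commute selfadjoint_inner)
    have "x = y + z" by (simp add: y_def z_def)
    then have "inner (H x) x = inner (H y) y + inner (H z) z"
      by (simp add: h inner_add_left inner_add_right c c')
    then show ?thesis using y z by simp
  qed
  have nn: "0 \<le> inner (H x) x" if x: "Q x = 0" for x
  proof (rule LIMSEQ_le_const2)
    have "P n x = 0" for n using PQ[of n x] x by (simp add: ps)
    then have "- 1 / real (Suc n) * (norm x)\<^sup>2 \<le> inner (H x) x" for n
      unfolding P_def by (rule E_lower)
    then show "\<exists>N. \<forall>n\<ge>N. - 1 / real (Suc n) * (norm x)\<^sup>2 \<le> inner (H x) x" by blast
    have "(\<lambda>n. - inverse (real (Suc n)) * (norm x)\<^sup>2) \<longlonglongrightarrow> - 0 * (norm x)\<^sup>2"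
      by (intro tendsto_intros LIMSEQ_inverse_real_of_nat)
    then show "(\<lambda>n. - 1 / real (Suc n) * (norm x)\<^sup>2) \<longlonglongrightarrow> 0"
      by (simp add: inverse_eq_divide del: of_nat_Suc)
  qed
  have meas: "measure (interval_measure (F x)) {..<0} = inner (Q x) x"
    and sgn: "(\<integral>t. (if 0 \<le> t then 1 else - 1 :: real) \<partial>interval_measure (F x))
      = (norm x)\<^sup>2 - 2 * inner (Q x) x" for x
  proof -
    obtain r where r: "\<And>t. t < - r \<Longrightarrow> E t = 0" "\<And>t. r \<le> t \<Longrightarrow> E t = id" using bounds by blast
    have 1: "(\<lambda>n. F x (- 1 / real (Suc n))) \<longlonglongrightarrow> measure (interval_measure (F x)) {..<0}"
    proof (rule stieltjes_negative_limit[where r=r and c="(norm x)\<^sup>2" and F="F x"])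
      show "(F x \<longlongrightarrow> F x t) (at_right t)" for t by (rule F_right)
      show "F x s \<le> F x t" if "s \<le> t" for s t by (rule F_mono[OF that])
    qed (auto simp: r)
    have 2: "(\<lambda>n. (norm (P n x))\<^sup>2) \<longlonglongrightarrow> (norm (Q x))\<^sup>2" by (intro tendsto_intros Q)
    show m: "measure (interval_measure (F x)) {..<0} = inner (Q x) x"
      using LIMSEQ_unique[OF 1 2[unfolded P_def]] by (simp add: orth_projection_norm(1)[OF Q(1)])
    have "(\<integral>t. (if 0 \<le> t then 1 else - 1 :: real) \<partial>interval_measure (F x))
        = (norm x)\<^sup>2 - 2 * measure (interval_measure (F x)) {..<0}"
    proof (rule integral_stieltjes_sign[where r=r and c="(norm x)\<^sup>2" and F="F x"])
      show "(F x \<longlongrightarrow> F x t) (at_right t)" for t by (rule F_right)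
      show "F x s \<le> F x t" if "s \<le> t" for s t by (rule F_mono[OF that])
    qed (auto simp: r)
    then show "(\<integral>t. (if 0 \<le> t then 1 else - 1 :: real) \<partial>interval_measure (F x))
      = (norm x)\<^sup>2 - 2 * inner (Q x) x" by (simp add: m)
  qed
  have gap: "\<exists>\<delta>>0. \<forall>x. Q x = x \<longrightarrow> inner (H x) x \<le> - \<delta> * (norm x)\<^sup>2" if fin: "cdim (range Q) \<noteq> \<infinity>"
  proof -
    have sub: "cvec.subspace (range (P n))" for n by (rule csubspace_range[OF p(2)])
    have PQr: "range (P n) \<subseteq> range Q" for n
      by (metis QP image_subsetI rangeI)
    obtain k where k: "cdim (range Q) = enat k" using fin by auto
    have dle: "cdim (range (P n)) \<le> enat k" for n
      using cdim_mono[OF sub PQr] k by metis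
    define d where "d n = the_enat (cdim (range (P n)))" for n
    have d: "cdim (range (P n)) = enat (d n)" "d n \<le> k" for n
      using dle[of n] by (cases "cdim (range (P n))"; simp add: d_def)+
    \<comment> \<open>The dimensions are bounded by \<open>k\<close>, so their maximum is attained;
      from that index on all ranges coincide.\<close>
    define M where "M = Max (range d)"
    have fd: "finite (range d)" using d(2) by (auto intro: finite_subset[of _ "{..k}"])
    then have "M \<in> range d" unfolding M_def by (rule Max_in) simp
    then obtain n where n: "d n = M" by blast
    have stab: "range (P m) = range (P n)" if "n \<le> m" for m
    proof -
      have "cdim (range (P n)) \<le> cdim (range (P m))" by (rule cdim_mono[OF sub Pnest[OF that]])
      moreover have "d m \<le> M" using fd by (simp add: M_def)
      ultimately have "cdim (range (P n)) = cdim (range (P m))" using d n by simp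
      from cdim_eq_subset[OF sub Pnest[OF that] _ this] show ?thesis using d by simp
    qed
    have PnQ: "P n x = x" if x: "Q x = x" for x
    proof (rule LIMSEQ_unique)
      show "(\<lambda>m. P m x) \<longlonglongrightarrow> x" using Q(2)[of x] x by simp
      show "(\<lambda>m. P m x) \<longlonglongrightarrow> P n x"
      proof (rule Lim_transform_eventually[OF tendsto_const])
        have "P n x = P m x" if "n \<le> m" for m
        proof -
          have "P m x = P n (P m x)"
            using stab[OF that] range_orth_projection[OF PE, of "P m x" n] by auto
          also have "\<dots> = P n x" by (rule nested_projections(2)[OF PE PE Pnest[OF that]])
          finally show ?thesis by simp
        qed
        then show "\<forall>\<^sub>F m in sequentially. P n x = P m x"
          unfolding eventually_sequentially by blast
      qed
    qed
    show ?thesis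
    proof (intro exI[of _ "1 / real (Suc n)"] conjI allI impI)
      fix x assume "Q x = x"
      from E_upper[OF PnQ[OF this, unfolded P_def]]
      show "inner (H x) x \<le> - (1 / real (Suc n)) * (norm x)\<^sup>2" by simp
    qed simp
  qed
  show ?thesis
    using Q(1) QH neg nn meas sgn gap by (intro exI[of _ Q]) (simp add: stieltjes_eq)
qed

end

lemma fun_calc_eqI:
  assumes A: "bounded_clinear A"
    and "\<And>x. cinner (A x) x = complex_of_real (\<integral>t. f t \<partial>stieltjes (spectral_family H) x)"
  shows "fun_calc f H = A"
  unfolding fun_calc_def
proof (rule the_equality)
  fix B assume B: "bounded_clinear B \<and>
    (\<forall>x. cinner (B x) x = complex_of_real (\<integral>t. f t \<partial>stieltjes (spectral_family H) x))"
  then have bB: "bounded_clinear B" by blast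
  have "(B - A) x = 0" for x
  proof (rule form_eq_0[of "B - A"])
    show "bounded_clinear (B - A)" using bB A by blast
    show "cinner ((B - A) y) y = 0" for y
      using B assms(2) by (simp add: cinner_eq_inner inner_diff_left complex_eq_iff)
  qed
  then show "B = A" by (auto simp: fun_eq_iff)
qed (use assms in blast)

definition neg_proj :: "('a::complex_hilbert \<Rightarrow> 'a) \<Rightarrow> 'a \<Rightarrow> 'a" where
  "neg_proj H = fun_calc (indicat_real {..<0}) H"

context
  fixes H :: "'a::complex_hilbert \<Rightarrow> 'a"
  assumes H: "selfadjoint H"
begin

private lemma neg_proj_all: "orth_projection (neg_proj H) \<and> (\<forall>x. neg_proj H (H x) = H (neg_proj H x)) \<and>
     (\<forall>x. neg_proj H x = x \<longrightarrow> x \<noteq> 0 \<longrightarrow> inner (H x) x < 0) \<and>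
     (\<forall>x. neg_proj H x = 0 \<longrightarrow> 0 \<le> inner (H x) x) \<and>
     op_sign H = id - (\<lambda>x. 2 *\<^sub>R neg_proj H x) \<and>
     (cdim (range (neg_proj H)) \<noteq> \<infinity> \<longrightarrow>
       (\<exists>\<delta>>0. \<forall>x. neg_proj H x = x \<longrightarrow> inner (H x) x \<le> - \<delta> * (norm x)\<^sup>2))"
proof -
  have sf: "is_spectral_family H (spectral_family H)"
    unfolding spectral_family_def by (rule someI_ex[OF spectral_family_exists[OF H]])
  from negative_projection_of_family[OF H sf] obtain Q where
    Q: "orth_projection Q" "\<forall>x. Q (H x) = H (Q x)"
     "\<forall>x. Q x = x \<longrightarrow> x \<noteq> 0 \<longrightarrow> inner (H x) x < 0"
     "\<forall>x. Q x = 0 \<longrightarrow> 0 \<le> inner (H x) x"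
     "\<forall>x. (\<integral>t. indicat_real {..<0} t \<partial>stieltjes (spectral_family H) x) = inner (Q x) x"
     "\<forall>x. (\<integral>t. (if 0 \<le> t then 1 else - 1 :: real) \<partial>stieltjes (spectral_family H) x)
       = (norm x)\<^sup>2 - 2 * inner (Q x) x"
     "cdim (range Q) \<noteq> \<infinity> \<longrightarrow> (\<exists>\<delta>>0. \<forall>x. Q x = x \<longrightarrow> inner (H x) x \<le> - \<delta> * (norm x)\<^sup>2)"
    by (elim exE conjE) (rule that)
  note q = orth_projectionD[OF Q(1)]
  have NQ: "neg_proj H = Q"
    unfolding neg_proj_def by (rule fun_calc_eqI[OF q(2)]) (simp only: cinner_selfadjoint[OF q(1)] Q(5)[rule_format])
  have sa: "selfadjoint (id - (\<lambda>x. 2 *\<^sub>R Q x))"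
    by (intro selfadjoint_diff selfadjoint_id selfadjoint_scaleR q(1))
  have "op_sign H = id - (\<lambda>x. 2 *\<^sub>R Q x)"
    unfolding op_sign_def
  proof (rule fun_calc_eqI[OF selfadjoint_bounded[OF sa]])
    show "cinner ((id - (\<lambda>x. 2 *\<^sub>R Q x)) x) x = complex_of_real
        (\<integral>t. (if 0 \<le> t then 1 else - 1) \<partial>stieltjes (spectral_family H) x)" for x
      unfolding cinner_selfadjoint[OF sa] Q(6)[rule_format]
      by (simp add: inner_diff_left power2_norm_eq_inner)
  qed
  then show ?thesis unfolding NQ using Q by blast
qed

lemma orth_projection_neg_proj: "orth_projection (neg_proj H)"
  and neg_proj_commute: "neg_proj H (H x) = H (neg_proj H x)"
  and neg_proj_neg: "neg_proj H x = x \<Longrightarrow> x \<noteq> 0 \<Longrightarrow> inner (H x) x < 0"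
  and neg_proj_nonneg: "neg_proj H x = 0 \<Longrightarrow> 0 \<le> inner (H x) x"
  and op_sign_eq: "op_sign H = id - (\<lambda>x. 2 *\<^sub>R neg_proj H x)"
proof -
  note all = neg_proj_all
  show "orth_projection (neg_proj H)" using all by (elim conjE)
  show "neg_proj H (H x) = H (neg_proj H x)" using all by (elim conjE) (rule spec)
  show "inner (H x) x < 0" if "neg_proj H x = x" "x \<noteq> 0"
    using all that by (elim conjE allE[of _ x]) simp
  show "0 \<le> inner (H x) x" if "neg_proj H x = 0"
    using all that by (elim conjE allE[of _ x]) simp
  show "op_sign H = id - (\<lambda>x. 2 *\<^sub>R neg_proj H x)" using all by (elim conjE)
qed

lemma nu_minus_eq: "nu_minus H = cdim (range (neg_proj H))"
  by (simp add: nu_minus_def spectral_subspace_def neg_proj_def)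

lemma neg_proj_gap:
  assumes "nu_minus H \<noteq> \<infinity>"
  obtains \<delta> where "\<delta> > 0" "\<And>x. neg_proj H x = x \<Longrightarrow> inner (H x) x \<le> - \<delta> * (norm x)\<^sup>2"
proof -
  have "\<exists>\<delta>>0. \<forall>x. neg_proj H x = x \<longrightarrow> inner (H x) x \<le> - \<delta> * (norm x)\<^sup>2"
    using neg_proj_all assms unfolding nu_minus_eq by (elim conjE) (erule mp)
  then show ?thesis using that by metis
qed

end

section \<open>Negative index of quadratic forms\<close>

lemma linear_neg_proj:
  "selfadjoint B \<Longrightarrow> Vector_Spaces.linear scaleC scaleC f \<Longrightarrow>
    Vector_Spaces.linear scaleC scaleC (\<lambda>x. neg_proj B (f x))"
  using orth_projectionD(2)[OF orth_projection_neg_proj[of B]]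
  by (simp add: Vector_Spaces.linear_iff clinear_simps)

text \<open>\<open>neg_proj B\<close> composed with \<open>f\<close> is injective on
  \<open>W\<close>, because the form of \<open>B\<close> is nonnegative on the kernel of
  \<open>neg_proj B\<close>. The substitution \<open>f\<close> allows \<open>W\<close> to live in a
  parameter space where its dimension is easy to count.\<close>

lemma cdim_le_nu_minus:
  assumes B: "selfadjoint B" and W: "cvec.subspace W" and f: "Vector_Spaces.linear scaleC scaleC f"
    and neg: "\<And>x. x \<in> W \<Longrightarrow> x \<noteq> 0 \<Longrightarrow> inner (B (f x)) (f x) < 0"
  shows "cdim W \<le> nu_minus B"
  unfolding nu_minus_eq[OF B]
proof (rule cdim_inj_le[OF linear_neg_proj[OF B f] W])
  fix x assume "x \<in> W" "neg_proj B (f x) = 0"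
  then show "x = 0" using neg neg_proj_nonneg[OF B] by (meson not_less)
qed simp

text \<open>The kernel of \<open>f\<close> meets the range of \<open>neg_proj A\<close> only in 0,
  so \<open>f\<close> embeds that range into \<open>W\<close>.\<close>

lemma nu_minus_le_cdim:
  assumes A: "selfadjoint A" and f: "Vector_Spaces.linear scaleC scaleC f"
    and W: "\<And>x. f x \<in> W" and nonneg: "\<And>x. f x = 0 \<Longrightarrow> 0 \<le> inner (A x) x"
  shows "nu_minus A \<le> cdim W"
  unfolding nu_minus_eq[OF A]
proof (rule cdim_inj_le[OF f])
  have P: "orth_projection (neg_proj A)" by (rule orth_projection_neg_proj[OF A])
  show "cvec.subspace (range (neg_proj A))" by (rule csubspace_range[OF orth_projectionD(2)[OF P]])
  fix x assume "x \<in> range (neg_proj A)" "f x = 0"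
  then show "x = 0"
    using nonneg neg_proj_neg[OF A] range_orth_projection[OF P] by (meson not_less)
qed (rule W)

text \<open>The index is monotone under substitution in a form. The factor \<open>k\<close> absorbs
  the 2 and 1/2 that arise from passing to sums and differences in
  \<open>nu_minus_square\<close>.\<close>

lemma nu_minus_mono:
  assumes A: "selfadjoint A" and B: "selfadjoint B" and f: "Vector_Spaces.linear scaleC scaleC f"
    and k: "k > 0" and le: "\<And>x. inner (B (f x)) (f x) \<le> k * inner (A x) x"
  shows "nu_minus A \<le> nu_minus B"
  unfolding nu_minus_eq[OF A]
proof (rule cdim_le_nu_minus[OF B _ f])
  have P: "orth_projection (neg_proj A)" by (rule orth_projection_neg_proj[OF A])
  show "cvec.subspace (range (neg_proj A))" by (rule csubspace_range[OF orth_projectionD(2)[OF P]])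
  fix x assume "x \<in> range (neg_proj A)" "x \<noteq> 0"
  then have "inner (A x) x < 0"
    using neg_proj_neg[OF A] range_orth_projection[OF P] by blast
  then have "k * inner (A x) x < 0" using k by (simp add: mult_pos_neg)
  then show "inner (B (f x)) (f x) < 0" using le[of x] by simp
qed

section \<open>Block operators and orthogonal sums\<close>

lemma block_op_apply: "block_op A B C D (x, y) = (A x + B y, C x + D y)"
  by (simp add: block_op_def)

lemma bounded_clinear_block_op:
  assumes A: "bounded_clinear A" and B: "bounded_clinear B"
    and C: "bounded_clinear C" and D: "bounded_clinear D"
  shows "bounded_clinear (block_op A B C D)"
proof -
  obtain a b c d where K: "\<And>x. norm (A x) \<le> a * norm x" "\<And>x. norm (B x) \<le> b * norm x"
    "\<And>x. norm (C x) \<le> c * norm x" "\<And>x. norm (D x) \<le> d * norm x"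
    and p: "a > 0" "b > 0" "c > 0" "d > 0"
    using bounded_clinear_bound A B C D by metis
  show ?thesis
  proof (rule bounded_clinearI[where K="a + b + c + d"])
    fix z :: "'a \<times> 'b"
    obtain x y where z: "z = (x, y)" by (cases z)
    have n: "norm x \<le> norm z" "norm y \<le> norm z" using norm_fst_le[of x y] norm_snd_le[of y x] by (auto simp: z)
    have "norm (A x) \<le> a * norm z" "norm (B y) \<le> b * norm z" "norm (C x) \<le> c * norm z" "norm (D y) \<le> d * norm z"
      using K n p by (meson mult_left_mono less_imp_le order_trans)+
    moreover have "norm (block_op A B C D z) \<le> norm (A x + B y) + norm (C x + D y)"
      using norm_Pair_le by (simp add: z block_op_apply)
    moreover have "norm (A x + B y) \<le> norm (A x) + norm (B y)" "norm (C x + D y) \<le> norm (C x) + norm (D y)"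
      by (rule norm_triangle_ineq)+
    ultimately show "norm (block_op A B C D z) \<le> (a + b + c + d) * norm z" by (simp add: algebra_simps)
  next
    show "block_op A B C D (z + w) = block_op A B C D z + block_op A B C D w" for z w
      by (cases z; cases w) (simp add: block_op_apply clinear_simps assms)
    show "block_op A B C D (scaleC c z) = scaleC c (block_op A B C D z)" for c z
      by (cases z) (simp add: block_op_apply clinear_simps assms scaleC_prod_def scaleC_add_right)
  qed
qed

lemma cadj_block_op:
  assumes "bounded_clinear A" "bounded_clinear B" "bounded_clinear C" "bounded_clinear D"
  shows "cadj (block_op A B C D) = block_op (cadj A) (cadj C) (cadj B) (cadj D)"
proof (rule cadj_eqI[OF bounded_clinear_block_op[OF assms]])
  fix z w :: "'a \<times> 'b"
  obtain x y u v where "z = (x, y)" "w = (u, v)" by (cases z; cases w)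
  then show "inner (block_op A B C D z) w = inner z (block_op (cadj A) (cadj C) (cadj B) (cadj D) w)"
    by (simp add: block_op_apply inner_add_left inner_add_right inner_cadj assms)
qed

lemma selfadjoint_block_op:
  assumes "selfadjoint A" "bounded_clinear C" "selfadjoint D"
  shows "selfadjoint (block_op A (cadj C) C D)"
proof -
  have b: "bounded_clinear A" "bounded_clinear (cadj C)" "bounded_clinear C" "bounded_clinear D"
    using assms by auto
  have "cadj (block_op A (cadj C) C D) = block_op A (cadj C) C D"
    unfolding cadj_block_op[OF b] using assms by (simp add: cadj_cadj selfadjoint_def)
  then show ?thesis using bounded_clinear_block_op[OF b] by (simp add: selfadjoint_def)
qed

lemma cadj_zero: "cadj (0 :: 'a::complex_hilbert \<Rightarrow> 'b::complex_hilbert) = 0"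
  by (rule cadj_eqI) auto

lemma selfadjoint_diag_symmetry:
  "selfadjoint A \<Longrightarrow> selfadjoint B \<Longrightarrow> selfadjoint (diag_symmetry A B)"
  using selfadjoint_block_op[of A 0 B] unfolding diag_symmetry_def by (simp add: cadj_zero bounded_clinear_zero)

lemma diag_symmetry_apply: "diag_symmetry A B (x, y) = (A x, B y)"
  by (simp add: diag_symmetry_def block_op_apply)

lemma nu_minus_diag_symmetry:
  assumes A: "selfadjoint A" and B: "selfadjoint B"
  shows "nu_minus (diag_symmetry A B) = nu_minus A + nu_minus B"
proof -
  note P = orth_projection_neg_proj[OF A] and Q = orth_projection_neg_proj[OF B]
  note p = orth_projectionD[OF P] and q = orth_projectionD[OF Q]
  let ?W = "range (neg_proj A) \<times> range (neg_proj B)"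
  have sub: "cvec.subspace (range (neg_proj A))" "cvec.subspace (range (neg_proj B))"
    by (rule csubspace_range[OF p(2)], rule csubspace_range[OF q(2)])
  then have subW: "cvec.subspace ?W"
    by (auto simp: cvec.subspace_def scaleC_prod_def zero_prod_def)
  have "nu_minus (diag_symmetry A B) \<le> cdim ?W"
  proof (rule nu_minus_le_cdim[OF selfadjoint_diag_symmetry[OF A B]])
    let ?f = "\<lambda>z. (neg_proj A (fst z), neg_proj B (snd z))"
    show "Vector_Spaces.linear scaleC scaleC ?f"
      by (auto simp: Vector_Spaces.linear_iff vector_space_scaleC scaleC_prod_def
          clinear_simps[OF p(2)] clinear_simps[OF q(2)])
    show "0 \<le> inner (diag_symmetry A B z) z" if "?f z = 0" for z
      using that neg_proj_nonneg[OF A] neg_proj_nonneg[OF B]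
      by (cases z) (simp add: diag_symmetry_apply zero_prod_def)
  qed simp
  moreover have "cdim ?W \<le> nu_minus (diag_symmetry A B)"
  proof (rule cdim_le_nu_minus[OF selfadjoint_diag_symmetry[OF A B] subW])
    show "Vector_Spaces.linear scaleC scaleC (id :: 'a \<times> 'b \<Rightarrow> _)"
      by (rule bounded_clinear_is_linear[OF bounded_clinear_id])
    fix z :: "'a \<times> 'b" assume z: "z \<in> ?W" "z \<noteq> 0"
    obtain x y where xy: "z = (x, y)" by (cases z)
    have "neg_proj A x = x" "neg_proj B y = y"
      using z(1) by (auto simp: xy range_orth_projection[OF P] range_orth_projection[OF Q])
    then have "x \<noteq> 0 \<longrightarrow> inner (A x) x < 0" "y \<noteq> 0 \<longrightarrow> inner (B y) y < 0"
      using neg_proj_neg[OF A] neg_proj_neg[OF B] by blast+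
    then show "inner (diag_symmetry A B (id z)) (id z) < 0"
      using z(2) by (cases "x = 0"; cases "y = 0") (auto simp: xy diag_symmetry_apply zero_prod_def)
  qed
  ultimately show ?thesis
    using cdim_Times[OF sub] by (simp add: nu_minus_eq[OF A] nu_minus_eq[OF B])
qed

section \<open>The index identity for I - T^2\<close>

context
  fixes J T :: "'a::complex_hilbert \<Rightarrow> 'a"
  assumes J: "selfadjoint J" and T: "bounded_clinear T"
    and JT: "\<And>x y. inner (J (T x)) y = inner x (J (T y))"
begin

private lemmas J_simps = clinear_simps[OF selfadjoint_bounded[OF J]]
private lemmas T_simps = clinear_simps[OF T]

private lemma J_square: "inner (J (T (T x))) y = inner (J (T x)) (T y)"
  using JT[of "T x" y] selfadjoint_inner[OF J, of "T x" "T y"] by simp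

lemma selfadjoint_one_minus_square: "selfadjoint (J \<circ> (id - (T \<circ> T)))"
proof (rule selfadjointI)
  show "bounded_clinear (J \<circ> (id - (T \<circ> T)))" using selfadjoint_bounded[OF J] T by blast
  show "inner ((J \<circ> (id - (T \<circ> T))) x) y = inner x ((J \<circ> (id - (T \<circ> T))) y)" for x y
    using J_square[of x y] JT[of x "T y"] selfadjoint_inner[OF J, of x y]
    by (simp add: J_simps inner_diff_left inner_diff_right)
qed

lemma selfadjoint_one_plus: "selfadjoint (J \<circ> (id + T))"
proof (rule selfadjointI)
  show "bounded_clinear (J \<circ> (id + T))" using selfadjoint_bounded[OF J] T by blast
  show "inner ((J \<circ> (id + T)) x) y = inner x ((J \<circ> (id + T)) y)" for x y
    using JT[of x y] selfadjoint_inner[OF J, of x y]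
    by (simp add: J_simps inner_add_left inner_add_right)
qed

lemma selfadjoint_one_minus: "selfadjoint (J \<circ> (id - T))"
proof (rule selfadjointI)
  show "bounded_clinear (J \<circ> (id - T))" using selfadjoint_bounded[OF J] T by blast
  show "inner ((J \<circ> (id - T)) x) y = inner x ((J \<circ> (id - T)) y)" for x y
    using JT[of x y] selfadjoint_inner[OF J, of x y]
    by (simp add: J_simps inner_diff_left inner_diff_right)
qed

text \<open>
  Both sides count the negative squares of the form with matrix \<open>(J, J T; J T, J)\<close>: once after
  completing the square, once in the coordinates \<open>x + y\<close>, \<open>x - y\<close>.
\<close>

lemma nu_minus_square:
  "nu_minus J + nu_minus (J \<circ> (id - (T \<circ> T)))
    = nu_minus (J \<circ> (id + T)) + nu_minus (J \<circ> (id - T))"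
proof -
  note s1 = selfadjoint_one_minus_square and s2 = selfadjoint_one_plus selfadjoint_one_minus
  let ?L = "diag_symmetry J (J \<circ> (id - (T \<circ> T)))"
  let ?R = "diag_symmetry (J \<circ> (id + T)) (J \<circ> (id - T))"
  have L: "selfadjoint ?L" and R: "selfadjoint ?R"
    by (intro selfadjoint_diag_symmetry J s1 s2)+
  have key: "inner (?R (x + y, x - y)) (x + y, x - y) = 2 * inner (?L (x + T y, y)) (x + T y, y)" for x y
  proof -
    have e: "inner (J y) x = inner (J x) y" "inner (J (T x)) y = inner (J (T y)) x"
      "inner (J x) (T y) = inner (J (T y)) x"
      using selfadjoint_inner[OF J, of y x] JT[of x y] selfadjoint_inner[OF J, of x "T y"]
      by (simp_all add: inner_commute)
    show ?thesis
      by (simp add: diag_symmetry_apply J_simps T_simps inner_add_left inner_add_right inner_diff_left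
          inner_diff_right J_square e)
  qed
  have "nu_minus ?L \<le> nu_minus ?R"
  proof (rule nu_minus_mono[OF L R])
    let ?f = "\<lambda>z. (fst z - T (snd z) + snd z, fst z - T (snd z) - snd z)"
    show "Vector_Spaces.linear scaleC scaleC ?f"
      by (auto simp: Vector_Spaces.linear_iff vector_space_scaleC scaleC_prod_def T_simps scaleC_add_right
          cvec.scale_right_diff_distrib)
    show "inner (?R (?f z)) (?f z) \<le> 2 * inner (?L z) z" for z
      using key[of "fst z - T (snd z)" "snd z"] by simp
  qed simp
  moreover have "nu_minus ?R \<le> nu_minus ?L"
  proof (rule nu_minus_mono[OF R L])
    let ?x = "\<lambda>z. (1/2) *\<^sub>R (fst z + snd z)" and ?y = "\<lambda>z. (1/2) *\<^sub>R (fst z - snd z)"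
    let ?f = "\<lambda>z. (?x z + T (?y z), ?y z)"
    have sc: "scaleC c (r *\<^sub>R x) = r *\<^sub>R scaleC c x" for c r and x :: 'a
      by (simp add: scaleC_of_real[symmetric] scaleC_scaleC mult.commute)
    show "Vector_Spaces.linear scaleC scaleC ?f"
      by (auto simp: Vector_Spaces.linear_iff vector_space_scaleC scaleC_prod_def T_simps scaleC_add_right
          cvec.scale_right_diff_distrib sc algebra_simps)
    have "?x z + ?y z = fst z" "?x z - ?y z = snd z" for z :: "'a \<times> 'a"
      by (simp_all add: scaleR_add_right scaleR_diff_right)
        (metis scaleR_half_double scaleR_add_right)+
    then show "inner (?L (?f z)) (?f z) \<le> (1/2) * inner (?R z) z" for z
      using key[of "?x z" "?y z"] by simp
  qed simp
  ultimately have "nu_minus ?L = nu_minus ?R" by simp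
  then show ?thesis by (simp add: nu_minus_diag_symmetry J s1 s2)
qed

end

text \<open>The one extra dimension contributed by the scalar parameter in
  \<open>nu_minus_block_le_form\<close>.\<close>

lemma cdim_complex: "1 \<le> cdim (UNIV :: complex set)"
proof -
  have span: "(UNIV :: complex set) \<subseteq> cvec.span {1}"
  proof
    fix c :: complex
    have "scaleC c (1::complex) \<in> cvec.span {1}" by (intro cvec.span_scale cvec.span_base) simp
    then show "c \<in> cvec.span {1}" by (simp add: scaleC_complex_def)
  qed
  have "cvec.independent {1 :: complex}" by (subst cvec.dependent_single) simp
  then have "cvec.dim (UNIV :: complex set) = 1"
    using cvec.dim_unique[OF _ span] by simp
  moreover have "\<exists>B. finite B \<and> (UNIV :: complex set) \<subseteq> cvec.span B" using span by blast
  ultimately show ?thesis unfolding cdim_def by (simp add: one_enat_def)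
qed

text \<open>On the negative subspace the gap gives \<delta> |y| <= |A y|, hence (A y, y) >= -|A y|^2
  / \<delta>; the complementary part only adds to the form. The bound involves \<open>x\<close> only
  through \<open>A x\<close> and the form, and both may converge when \<open>x\<close> does
  not.\<close>

lemma neg_proj_form_bound:
  assumes A: "selfadjoint A" and d: "\<delta> > 0"
    and gap: "\<And>x. neg_proj A x = x \<Longrightarrow> inner (A x) x \<le> - \<delta> * (norm x)\<^sup>2"
  shows "- (norm (neg_proj A (A x)))\<^sup>2 \<le> \<delta> * inner (A x) x"
proof -
  let ?Q = "neg_proj A"
  note Q = orth_projection_neg_proj[OF A]
  note q = orth_projectionD[OF Q] and qs = clinear_simps[OF orth_projectionD(2)[OF Q]]
  note a = clinear_simps[OF selfadjoint_bounded[OF A]]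
  define y z where "y = ?Q x" and "z = x - ?Q x"
  have Qy: "?Q y = y" and Qz: "?Q z = 0" by (simp_all add: y_def z_def qs q(3))
  have Ay: "A y = ?Q (A x)" by (simp add: y_def neg_proj_commute[OF A])
  have yz: "inner (A y) z = 0"
    by (metis Ay Qz inner_zero_right q(1,3) selfadjoint_inner)
  have zy: "inner (A z) y = 0" using yz by (metis A inner_commute selfadjoint_inner)
  have "x = y + z" by (simp add: y_def z_def)
  then have "inner (A x) x = inner (A y) y + inner (A z) z"
    by (simp add: a inner_add_left inner_add_right yz zy)
  moreover have "0 \<le> inner (A z) z" by (rule neg_proj_nonneg[OF A Qz])
  ultimately have 1: "inner (A y) y \<le> inner (A x) x" by simp
  have 2: "- (norm (A y) * norm y) \<le> inner (A y) y"
    using Cauchy_Schwarz_ineq2[of "A y" y] by linarith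
  have "\<delta> * norm y * norm y \<le> norm (A y) * norm y"
    using gap[OF Qy] 2 by (simp add: power2_eq_square)
  then have 3: "\<delta> * norm y \<le> norm (A y)"
    by (cases "norm y = 0") (auto dest: mult_right_le_imp_le)
  have "\<delta> * inner (A x) x \<ge> \<delta> * inner (A y) y" using 1 d by simp
  moreover have "\<delta> * inner (A y) y \<ge> \<delta> * - (norm (A y) * norm y)" using 2 d by (intro mult_left_mono) auto
  moreover have "norm (A y) * (\<delta> * norm y) \<le> norm (A y) * norm (A y)" using 3 by (intro mult_left_mono) auto
  ultimately show ?thesis unfolding Ay[symmetric] by (simp add: power2_eq_square algebra_simps)
qed

section \<open>Block operators whose upper left corner has a spectral gap\<close>

context
  fixes A :: "'a::complex_hilbert \<Rightarrow> 'a" and C :: "'a \<Rightarrow> 'b::complex_hilbert" and Z :: "'b \<Rightarrow> 'b"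
    and \<delta> :: real
  assumes A: "selfadjoint A" and C: "bounded_clinear C" and Z: "selfadjoint Z"
    and fin: "nu_minus A \<noteq> \<infinity>" and d: "\<delta> > 0"
    and gap: "\<And>x. neg_proj A x = x \<Longrightarrow> inner (A x) x \<le> - \<delta> * (norm x)\<^sup>2"
begin

lemma block_form:
  "inner (block_op A (cadj C) C Z (u, f)) (u, f)
     = inner (A u) u + 2 * inner (C u) f + inner (Z f) f"
  by (simp add: block_op_apply inner_add_left inner_cadj[OF C] inner_commute[of "cadj C f"])

lemma nu_minus_block_ge: "nu_minus A \<le> nu_minus (block_op A (cadj C) C Z)"
proof (rule nu_minus_mono[OF A selfadjoint_block_op[OF A C Z]])
  show "Vector_Spaces.linear scaleC scaleC (\<lambda>x::'a. (x, 0::'b))"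
    by (auto simp: Vector_Spaces.linear_iff vector_space_scaleC scaleC_prod_def)
  show "inner (block_op A (cadj C) C Z (x, 0)) (x, 0) \<le> 1 * inner (A x) x" for x
    unfolding block_form by simp
qed simp

text \<open>If the inequality fails at (u, f), the form is negative on the negative subspace of
  \<open>A\<close> extended by the line through (u, f), which is one dimension too many. Indeed,
  with g = A u + \<open>cadj C f\<close>, \<delta> times the form at (n, 0) + k (u, f) is at most
  -(\<delta> |n| - |k| |Q g|)^2 + |k|^2 (\<delta> m + |Q g|^2).\<close>

lemma nu_minus_block_le_form:
  assumes le: "nu_minus (block_op A (cadj C) C Z) \<le> nu_minus A"
  shows "- (norm (neg_proj A (A u + cadj C f)))\<^sup>2
    \<le> \<delta> * (inner (A u) u + 2 * inner (C u) f + inner (Z f) f)"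
proof (rule ccontr)
  let ?M = "block_op A (cadj C) C Z" and ?Q = "neg_proj A"
  define m where "m = inner (A u) u + 2 * inner (C u) f + inner (Z f) f"
  define g where "g = A u + cadj C f"
  assume "\<not> ?thesis"
  then have neg: "\<delta> * m + (norm (?Q g))\<^sup>2 < 0" by (simp add: m_def g_def)
  note Q = orth_projection_neg_proj[OF A]
  note q = orth_projectionD[OF Q] and qs = clinear_simps[OF orth_projectionD(2)[OF Q]]
  note a = clinear_simps[OF selfadjoint_bounded[OF A]] and c = clinear_simps[OF C]
    and ca = clinear_simps[OF bounded_clinear_cadj[OF C]] and z = clinear_simps[OF selfadjoint_bounded[OF Z]]
  let ?W = "(UNIV :: complex set) \<times> range ?Q"
  let ?f = "\<lambda>w::complex \<times> 'a. (snd w + scaleC (fst w) u, scaleC (fst w) f)"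
  have sub: "cvec.subspace (range ?Q)" by (rule csubspace_range[OF q(2)])
  then have subW: "cvec.subspace ?W"
    by (auto simp: cvec.subspace_def scaleC_prod_def zero_prod_def)
  have "cdim ?W \<le> nu_minus ?M"
  proof (rule cdim_le_nu_minus[OF selfadjoint_block_op[OF A C Z] subW])
    show "Vector_Spaces.linear scaleC scaleC ?f"
      by (auto simp: Vector_Spaces.linear_iff vector_space_scaleC scaleC_prod_def scaleC_add_right
          scaleC_add_left scaleC_scaleC scaleC_complex_def algebra_simps)
    fix w assume w: "w \<in> ?W" "w \<noteq> 0"
    obtain k n where kn: "w = (k, n)" by (cases w)
    have Qn: "?Q n = n" using w(1) by (simp add: kn range_orth_projection[OF Q])
    have sym: "inner (A (scaleC k u)) n = inner (A n) (scaleC k u)"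
      by (metis A inner_commute selfadjoint_inner)
    have cc: "inner (C n) (scaleC k f) = inner (cadj C (scaleC k f)) n"
      by (metis C inner_cadj inner_commute)
    have "inner (?M (?f w)) (?f w) = inner (A n) n + 2 * inner (scaleC k g) n + (cmod k)\<^sup>2 * m"
    proof -
      have "inner (?M (?f w)) (?f w) = inner (A n) n
          + 2 * (inner (A (scaleC k u)) n + inner (cadj C (scaleC k f)) n)
          + (inner (A (scaleC k u)) (scaleC k u) + 2 * inner (C (scaleC k u)) (scaleC k f)
             + inner (Z (scaleC k f)) (scaleC k f))"
        by (simp add: kn block_form a(2) c(2) inner_add_left inner_add_right sym cc del: bounded_clinear_scaleC)
      also have "inner (A (scaleC k u)) n + inner (cadj C (scaleC k f)) n = inner (scaleC k g) n"
        by (simp add: g_def a ca scaleC_add_right inner_add_left)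
      also have "inner (A (scaleC k u)) (scaleC k u) + 2 * inner (C (scaleC k u)) (scaleC k f)
             + inner (Z (scaleC k f)) (scaleC k f) = (cmod k)\<^sup>2 * m"
        by (simp add: a(1) c(1) z(1) inner_scaleC_scaleC m_def algebra_simps)
      finally show ?thesis .
    qed
    also have "inner (scaleC k g) n \<le> cmod k * norm (?Q g) * norm n"
    proof -
      have "inner (scaleC k g) n = inner (scaleC k (?Q g)) n"
        by (metis Qn q(1) qs(1) selfadjoint_inner)
      also have "\<dots> \<le> norm (scaleC k (?Q g)) * norm n" by (rule norm_cauchy_schwarz)
      finally show ?thesis by (simp add: norm_scaleC)
    qed
    finally have 1: "inner (?M (?f w)) (?f w)
        \<le> - \<delta> * (norm n)\<^sup>2 + 2 * (cmod k * norm (?Q g) * norm n) + (cmod k)\<^sup>2 * m"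
      using gap[OF Qn] by simp
    have "\<delta> * (- \<delta> * (norm n)\<^sup>2 + 2 * (cmod k * norm (?Q g) * norm n) + (cmod k)\<^sup>2 * m)
      = - (\<delta> * norm n - cmod k * norm (?Q g))\<^sup>2 + (cmod k)\<^sup>2 * (\<delta> * m + (norm (?Q g))\<^sup>2)"
      by (simp add: power2_eq_square algebra_simps)
    also have "\<dots> < 0"
    proof (cases "k = 0")
      case True
      then have "n \<noteq> 0" using w(2) by (simp add: kn zero_prod_def)
      then show ?thesis using True d by simp
    next
      case False
      then have "(cmod k)\<^sup>2 * (\<delta> * m + (norm (?Q g))\<^sup>2) < 0" using neg by (simp add: mult_pos_neg)
      then show ?thesis by (smt (verit) zero_le_power2)
    qed
    finally have "- \<delta> * (norm n)\<^sup>2 + 2 * (cmod k * norm (?Q g) * norm n) + (cmod k)\<^sup>2 * m < 0"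
      using d by (simp add: mult_less_0_iff)
    with 1 show "inner (?M (?f w)) (?f w) < 0" by linarith
  qed
  moreover have "1 + nu_minus A \<le> cdim ?W"
  proof -
    have "cdim ?W = cdim (UNIV :: complex set) + nu_minus A"
      unfolding nu_minus_eq[OF A] by (rule cdim_Times[OF cvec.subspace_UNIV sub])
    then show ?thesis using add_right_mono[OF cdim_complex, of "nu_minus A"] by simp
  qed
  ultimately have "1 + nu_minus A \<le> nu_minus A" using le by (meson order_trans)
  then show False using fin by (cases "nu_minus A") (auto simp: one_enat_def)
qed

text \<open>The map from (u, f) to the negative part of \<open>A u + cadj C f\<close> takes values
  in the negative subspace of \<open>A\<close>, and the hypothesis makes the block form nonnegative
  on its kernel.\<close>

lemma nu_minus_block_form_le:
  assumes ge: "\<And>u f. - (norm (neg_proj A (A u + cadj C f)))\<^sup>2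
    \<le> \<delta> * (inner (A u) u + 2 * inner (C u) f + inner (Z f) f)"
  shows "nu_minus (block_op A (cadj C) C Z) \<le> nu_minus A"
  unfolding nu_minus_eq[OF A]
proof (rule nu_minus_le_cdim[OF selfadjoint_block_op[OF A C Z]])
  let ?f = "\<lambda>z. neg_proj A (A (fst z) + cadj C (snd z))"
  note q = orth_projectionD(2)[OF orth_projection_neg_proj[OF A]]
  show "Vector_Spaces.linear scaleC scaleC ?f"
    by (auto simp: Vector_Spaces.linear_iff vector_space_scaleC scaleC_prod_def scaleC_add_right
        clinear_simps[OF q] clinear_simps[OF selfadjoint_bounded[OF A]]
        clinear_simps[OF bounded_clinear_cadj[OF C]])
  fix z assume z: "?f z = 0"
  have "0 \<le> \<delta> * inner (block_op A (cadj C) C Z (fst z, snd z)) (fst z, snd z)"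
    using ge[of "fst z" "snd z"] z unfolding block_form by simp
  then show "0 \<le> inner (block_op A (cadj C) C Z z) z" using d by (simp add: zero_le_mult_iff)
qed simp

end

section \<open>Factorization through a selfadjoint operator\<close>

lemma bounded_clinear_col_op:
  assumes A: "bounded_clinear A" and B: "bounded_clinear B"
  shows "bounded_clinear (col_op A B)"
proof -
  obtain a b where K: "\<And>x. norm (A x) \<le> a * norm x" "\<And>x. norm (B x) \<le> b * norm x"
    using bounded_clinear_bound A B by metis
  show ?thesis
  proof (rule bounded_clinearI[where K="a + b"])
    fix x
    have "norm (col_op A B x) \<le> norm (A x) + norm (B x)" unfolding col_op_def by (rule norm_Pair_le)
    then show "norm (col_op A B x) \<le> (a + b) * norm x"
      using K[of x] by (simp add: distrib_right)
  qed (simp_all add: col_op_def clinear_simps A B scaleC_prod_def)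
qed

lemma proj_closure_range_ker:
  assumes D: "selfadjoint D" and x: "D x = 0"
  shows "proj (closure (range D)) x = 0"
proof -
  have "cvec.subspace (closure (range D))"
    using D by (intro csubspace_closure csubspace_range) blast
  then show ?thesis
    by (rule proj_eq_0) (use closure_range_orth_ker[OF D _ x] in \<open>auto simp: inner_commute\<close>)
qed

lemma ker_minus_proj_closure_range:
  assumes D: "selfadjoint D"
  shows "D (x - proj (closure (range D)) x) = 0"
proof -
  let ?S = "closure (range D)"
  have S: "cvec.subspace ?S" "closed ?S"
    using D by (auto intro: csubspace_closure csubspace_range)
  have "inner (D (x - proj ?S x)) y = 0" for y
    using proj_orth[OF S, of "D y" x] closure_subset[of "range D"]
    by (auto simp: selfadjoint_inner[OF D])
  then show ?thesis by (metis inner_eq_zero_iff)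
qed

lemma closure_range_orth_eq_0:
  assumes D: "selfadjoint D" and x: "x \<in> closure (range D)" "D x = 0"
  shows "x = 0"
  using closure_range_orth_ker[OF D x] by simp

lemma closure_range_sequence:
  fixes x :: "'a::metric_space"
  assumes "x \<in> closure (range D)" obtains w :: "nat \<Rightarrow> _" where "(\<lambda>n. D (w n)) \<longlonglongrightarrow> x"
proof -
  obtain v where v: "\<And>n. v n \<in> range D" "v \<longlonglongrightarrow> x"
    using assms unfolding closure_sequential by metis
  have "D (inv D (v n)) = v n" for n by (rule f_inv_into_f[OF v(1)])
  then show ?thesis using v(2) that[of "\<lambda>n. inv D (v n)"] by simp
qed

text \<open>The closure \<open>R\<close> of the pairs (D x, B x) is a subspace on which the norm
  estimate persists, so it is the graph of a bounded operator on the closed range of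
  \<open>D\<close>. Linearity of \<open>V\<close> is read off from \<open>R\<close> being a
  subspace, and \<open>V\<close> is extended by 0 through the projection onto the closed
  range.\<close>

lemma douglas_factorization:
  assumes D: "selfadjoint D" and B: "bounded_clinear B"
    and le: "\<And>x. norm (B x) \<le> K * norm (D x)"
  shows "\<exists>V. bounded_clinear V \<and> (\<forall>x. V (D x) = B x) \<and> (\<forall>x. D x = 0 \<longrightarrow> V x = 0)"
proof -
  let ?S = "closure (range D)"
  have bD: "bounded_clinear D" using D by blast
  have S: "cvec.subspace ?S" "closed ?S"
    using D by (auto intro: csubspace_closure csubspace_range)
  note P = orth_projection_proj[OF S]
  note p = orth_projectionD[OF P]
  define R where "R = closure (range (col_op D B))"
  have R: "cvec.subspace R"
    unfolding R_def by (intro csubspace_closure csubspace_range bounded_clinear_col_op bD B)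
  have inR: "(D x, B x) \<in> R" for x
    using closure_subset[of "range (col_op D B)"] by (auto simp: R_def col_op_def)
  have bound: "norm z \<le> K * norm y" if yz: "(y, z) \<in> R" for y z
  proof -
    obtain w where w: "\<And>n. w n \<in> range (col_op D B)" "w \<longlonglongrightarrow> (y, z)"
      using yz unfolding R_def closure_sequential by metis
    have "norm (snd (w n)) \<le> K * norm (fst (w n))" for n
      using w(1)[of n] le by (auto simp: col_op_def)
    moreover have "(\<lambda>n. norm (snd (w n))) \<longlonglongrightarrow> norm z" "(\<lambda>n. K * norm (fst (w n))) \<longlonglongrightarrow> K * norm y"
      using tendsto_fst[OF w(2)] tendsto_snd[OF w(2)] by (auto intro!: tendsto_intros)
    ultimately show ?thesis by (meson LIMSEQ_le)
  qed
  have unique: "z = z'" if "(y, z) \<in> R" "(y, z') \<in> R" for y z z'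
    using bound[of 0 "z - z'"] cvec.subspace_diff[OF R that] by simp
  have ex: "\<exists>z. (y, z) \<in> R" if y: "y \<in> ?S" for y
  proof -
    obtain w where v: "(\<lambda>n. D (w n)) \<longlonglongrightarrow> y" by (rule closure_range_sequence[OF y])
    have "Cauchy (\<lambda>n. B (w n))"
      unfolding Cauchy_def
    proof (intro allI impI)
      fix e :: real assume e: "0 < e"
      \<comment> \<open>\<open>K\<close> is an arbitrary real number; adding 1 keeps the denominator
        positive.\<close>
      have "0 < e / (\<bar>K\<bar> + 1)" using e by (intro divide_pos_pos) auto
      then obtain M where M: "\<And>m n. m \<ge> M \<Longrightarrow> n \<ge> M \<Longrightarrow> dist (D (w m)) (D (w n)) < e / (\<bar>K\<bar> + 1)"
        using LIMSEQ_imp_Cauchy[OF v] unfolding Cauchy_def by meson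
      have "dist (B (w m)) (B (w n)) < e" if "m \<ge> M" "n \<ge> M" for m n
      proof -
        have "dist (B (w m)) (B (w n)) \<le> K * dist (D (w m)) (D (w n))"
          using le[of "w m - w n"] by (simp add: dist_norm clinear_simps[OF B] clinear_simps[OF bD])
        also have "\<dots> \<le> (\<bar>K\<bar> + 1) * dist (D (w m)) (D (w n))" by (intro mult_right_mono) auto
        also have "\<dots> < e" using M[OF that] by (simp add: pos_less_divide_eq mult.commute)
        finally show ?thesis .
      qed
      then show "\<exists>M. \<forall>m\<ge>M. \<forall>n\<ge>M. dist (B (w m)) (B (w n)) < e" by blast
    qed
    then obtain z where z: "(\<lambda>n. B (w n)) \<longlonglongrightarrow> z" using Cauchy_convergent convergent_def by blast
    have "(\<lambda>n. (D (w n), B (w n))) \<longlonglongrightarrow> (y, z)" by (intro tendsto_Pair v z)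
    then have "(y, z) \<in> R"
      using closed_sequentially[of R "\<lambda>n. (D (w n), B (w n))"] inR by (simp add: R_def)
    then show ?thesis by blast
  qed
  define V where "V x = (THE z. (proj ?S x, z) \<in> R)" for x
  have V: "(proj ?S x, V x) \<in> R" for x
    unfolding V_def using ex[OF proj_mem[OF S, of x]] unique by (metis theI)
  have Veq: "V x = z" if "(proj ?S x, z) \<in> R" for x z using unique V that by blast
  have "bounded_clinear V"
  proof (rule bounded_clinearI[where K="\<bar>K\<bar>"])
    show "V (x + y) = V x + V y" for x y
      using cvec.subspace_add[OF R V[of x] V[of y]] by (intro Veq) (simp add: clinear_simps[OF p(2)])
    show "V (scaleC c x) = scaleC c (V x)" for c x
      using cvec.subspace_scale[OF R V[of x], of c]
      by (intro Veq) (simp add: clinear_simps[OF p(2)] scaleC_prod_def)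
    show "norm (V x) \<le> \<bar>K\<bar> * norm x" for x
    proof -
      have "norm (V x) \<le> K * norm (proj ?S x)" by (rule bound[OF V])
      also have "\<dots> \<le> \<bar>K\<bar> * norm (proj ?S x)" by (intro mult_right_mono) auto
      also have "\<dots> \<le> \<bar>K\<bar> * norm x" by (intro mult_left_mono orth_projection_norm(2)[OF P]) auto
      finally show ?thesis .
    qed
  qed
  moreover have "V (D x) = B x" for x
  proof (rule Veq)
    have "D x \<in> ?S" by (rule subsetD[OF closure_subset rangeI])
    then show "(proj ?S (D x), B x) \<in> R" by (simp add: proj_fix[OF S] inR)
  qed
  moreover have "V x = 0" if "D x = 0" for x
    using cvec.subspace_0[OF R] by (intro Veq) (simp add: proj_closure_range_ker[OF D that] zero_prod_def)
  ultimately show ?thesis by blast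
qed

text \<open>The operator inside the closure is a restriction of \<open>V\<close> to the sum of the
  range and the kernel of \<open>D\<close>. That domain is dense and the graph of \<open>V\<close>
  is closed, so the closure is the whole graph.\<close>

lemma op_graph_clos_comp_mp_inverse:
  assumes D: "selfadjoint D" and V: "bounded_clinear V"
    and VD: "\<And>x. V (D x) = B x" and ker: "\<forall>x. D x = 0 \<longrightarrow> V x = 0"
  shows "op_graph V = clos_comp_mp_inverse B D"
proof -
  note V0 = ker[rule_format]
  let ?S = "closure (range D)"
  have S: "cvec.subspace ?S" "closed ?S"
    using D by (auto intro: csubspace_closure csubspace_range)
  define G where "G = mp_inverse_graph D O op_graph B"
  have G: "(y, v) \<in> G \<longleftrightarrow> (\<exists>x z. x \<in> ?S \<and> D z = 0 \<and> y = D x + z \<and> v = B x)" for y v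
    by (auto simp: G_def mp_inverse_graph_def op_graph_def)
  have GV: "v = V y" if "(y, v) \<in> G" for y v
    using that by (auto simp: G clinear_simps[OF V] VD V0)
  have "closed (op_graph V)"
  proof -
    have "op_graph V = {p. snd p = V (fst p)}" by (auto simp: op_graph_def)
    moreover have "closed {p. snd p = V (fst p)}"
      by (intro closed_Collect_eq continuous_intros bounded_linear.continuous_on[OF bounded_clinear_linear[OF V]])
    ultimately show ?thesis by simp
  qed
  moreover have "G \<subseteq> op_graph V" using GV by (auto simp: op_graph_def)
  ultimately have "closure G \<subseteq> op_graph V" by (rule closure_minimal[rotated])
  moreover have "(y, V y) \<in> closure G" for y
  proof -
    obtain w where w: "\<And>n. w n \<in> range D" "w \<longlonglongrightarrow> proj ?S y"
      using proj_mem[OF S, of y] unfolding closure_sequential by metis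
    define u where "u n = w n + (y - proj ?S y)" for n
    have "(u n, V (u n)) \<in> G" for n
    proof -
      obtain x where x: "w n = D x" using w(1)[of n] by blast
      \<comment> \<open>\<open>mp_inverse_graph\<close> admits only preimages in the closed range of
        \<open>D\<close>.\<close>
      have "D x = D (proj ?S x)"
        using ker_minus_proj_closure_range[OF D, of x] clinear_simps[OF selfadjoint_bounded[OF D]] by simp
      moreover have "V (u n) = V (D x) + V (y - proj ?S y)"
        unfolding u_def x by (rule bounded_clinear_add[OF V])
      moreover have "V (y - proj ?S y) = 0" by (rule V0[OF ker_minus_proj_closure_range[OF D]])
      ultimately show ?thesis
        using proj_mem[OF S, of x] ker_minus_proj_closure_range[OF D, of y]
        unfolding G by (intro exI[of _ "proj ?S x"] exI[of _ "y - proj ?S y"]) (simp add: u_def x VD)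
    qed
    moreover have "u \<longlonglongrightarrow> y"
      unfolding u_def using tendsto_add[OF w(2) tendsto_const[of "y - proj ?S y"]] by simp
    then have "(\<lambda>n. (u n, V (u n))) \<longlonglongrightarrow> (y, V y)"
      by (intro tendsto_Pair bounded_clinear_tendsto[OF V])
    ultimately show ?thesis
      unfolding closure_sequential by (intro exI[of _ "\<lambda>n. (u n, V (u n))"]) auto
  qed
  ultimately show ?thesis
    unfolding clos_comp_mp_inverse_def G_def[symmetric] by (auto simp: op_graph_def)
qed

section \<open>Completions of minimal negative index\<close>

context
  fixes A X D S Y :: "'a::complex_hilbert \<Rightarrow> 'a" and V :: "'a \<Rightarrow> 'b::complex_hilbert"
  assumes A: "selfadjoint A" and fin: "nu_minus A \<noteq> \<infinity>"
    and X: "bounded_clinear X" and D: "selfadjoint D"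
    and S: "bounded_clinear S" and SS: "\<And>x. S (S x) = x" and SD: "\<And>x. S (D x) = D (S x)"
    and AX: "\<And>x. A (X x) = D (S (D x))"
    and Y: "bounded_clinear Y" and YD: "\<And>x. Y (D x) = D (X x)"
    and V: "bounded_clinear V" and V0: "\<forall>x. D x = 0 \<longrightarrow> V x = 0"
begin

text \<open>\<open>V\<close> vanishes on the kernel of \<open>D\<close>, so the range of its adjoint
  lies in the closed range of \<open>D\<close>, and \<open>S\<close> permutes the range of
  \<open>D\<close>. Only the images under \<open>S D\<close> converge, not the \<open>w n\<close>
  themselves.\<close>

private lemma approx: "\<exists>w. (\<lambda>n. S (D (w n))) \<longlonglongrightarrow> cadj V f"
proof -
  have "cadj V f \<in> closure (range D)"
    by (rule closure_range_ker[OF D]) (simp add: inner_cadj'[OF V] V0)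
  then obtain w where w: "(\<lambda>n. D (w n)) \<longlonglongrightarrow> cadj V f" by (rule closure_range_sequence)
  have "S (D (S (w n))) = D (w n)" for n by (simp add: SD SS)
  then show ?thesis using w by (intro exI[of _ "\<lambda>n. S (w n)"]) simp
qed

text \<open>At v = S D w the sesquilinear form of Y S becomes that of \<open>A\<close> at
  \<open>X w\<close>. This is how the symmetry of \<open>A\<close> reaches the product Y S, and how
  the unbounded passage from v to w leaves the estimates.\<close>

private lemma form_on_range:
  "inner (Y (S (S (D w)))) (S (D w')) = inner (X w) (A (X w'))"
  by (simp add: SS YD AX selfadjoint_inner[OF D])

lemma selfadjoint_minimal_entry: "selfadjoint (V \<circ> Y \<circ> S \<circ> cadj V)"
proof (rule selfadjointI)
  show "bounded_clinear (V \<circ> Y \<circ> S \<circ> cadj V)" using V Y S by blast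
  fix f g
  obtain w where w: "(\<lambda>n. S (D (w n))) \<longlonglongrightarrow> cadj V f" using approx by blast
  obtain w' where w': "(\<lambda>n. S (D (w' n))) \<longlonglongrightarrow> cadj V g" using approx by blast
  note t = bounded_clinear_tendsto[OF Y] bounded_clinear_tendsto[OF S]
  have "(\<lambda>n. inner (Y (S (S (D (w n))))) (S (D (w' n)))) \<longlonglongrightarrow> inner (Y (S (cadj V f))) (cadj V g)"
    "(\<lambda>n. inner (S (D (w n))) (Y (S (S (D (w' n)))))) \<longlonglongrightarrow> inner (cadj V f) (Y (S (cadj V g)))"
    by (intro tendsto_inner t w w')+
  moreover have "inner (Y (S (S (D u)))) (S (D v)) = inner (S (D u)) (Y (S (S (D v))))" for u v
    by (metis A form_on_range inner_commute selfadjoint_inner)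
  ultimately have "inner (Y (S (cadj V f))) (cadj V g) = inner (cadj V f) (Y (S (cadj V g)))"
    using LIMSEQ_unique by simp
  then show "inner ((V \<circ> Y \<circ> S \<circ> cadj V) f) g = inner f ((V \<circ> Y \<circ> S \<circ> cadj V) g)"
    by (simp add: inner_cadj[OF V] inner_cadj'[OF V])
qed

text \<open>Minimality of the index is equivalent to the gap inequality at all (u, f). Necessity of
  the bound on \<open>Z\<close> comes from testing at u = -X w, sufficiency from the bound for the
  form of \<open>A\<close> at u + X w, in both cases with \<open>S (D w)\<close> tending to
  \<open>cadj V f\<close>.\<close>

lemma completion_index:
  assumes Z: "selfadjoint Z"
  shows "nu_minus (block_op A (D \<circ> cadj V) (V \<circ> D) Z) = nu_minus A
    \<longleftrightarrow> (\<forall>f. inner ((V \<circ> Y \<circ> S \<circ> cadj V) f) f \<le> inner (Z f) f)"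
proof -
  let ?Q = "neg_proj A"
  obtain \<delta> where d: "\<delta> > 0" and gap: "\<And>x. ?Q x = x \<Longrightarrow> inner (A x) x \<le> - \<delta> * (norm x)\<^sup>2"
    using neg_proj_gap[OF A fin] by metis
  have bD: "bounded_clinear D" using D by blast
  have C: "bounded_clinear (V \<circ> D)" using V bD by blast
  have cC: "cadj (V \<circ> D) = D \<circ> cadj V"
    using D cadj_comp[OF V bD] by (simp add: selfadjoint_def)
  note a = clinear_simps[OF selfadjoint_bounded[OF A]] and x = clinear_simps[OF X]
  note q = orth_projectionD[OF orth_projection_neg_proj[OF A]]
    and Qn = orth_projection_norm(2)[OF orth_projection_neg_proj[OF A]]
  note t = bounded_clinear_tendsto[OF Y] bounded_clinear_tendsto[OF S]
    bounded_clinear_tendsto[OF bD] bounded_clinear_tendsto[OF q(2)]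
  have ge: "nu_minus A \<le> nu_minus (block_op A (D \<circ> cadj V) (V \<circ> D) Z)"
    using nu_minus_block_ge[OF A C Z fin d gap] by (simp add: cC)
  have YS: "inner (Y (S (S (D w)))) (S (D w)) = inner (A (X w)) (X w)" for w
    unfolding form_on_range by (rule inner_commute)
  show ?thesis
  proof (intro iffI allI)
    fix f assume eq: "nu_minus (block_op A (D \<circ> cadj V) (V \<circ> D) Z) = nu_minus A"
    define e where "e = cadj V f"
    obtain w where w: "(\<lambda>n. S (D (w n))) \<longlonglongrightarrow> e" using approx unfolding e_def by blast
    have "0 \<le> \<delta> * (inner (Y (S (S (D w)))) (S (D w)) - 2 * inner (Y (S (S (D w)))) e + inner (Z f) f)
        + (norm (D (e - S (D w))))\<^sup>2" for w
    proof -
      \<comment> \<open>For u = -X w the vector A u + \<open>cadj (V \<circ> D) f\<close> is D (e -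
        S D w). It tends to 0, so the error term disappears and the remaining form is (Z f, f) - (Y
        S e, e).\<close>
      have ineq: "- (norm (?Q (A (- X w) + cadj (V \<circ> D) f)))\<^sup>2
        \<le> \<delta> * (inner (A (- X w)) (- X w) + 2 * inner ((V \<circ> D) (- X w)) f + inner (Z f) f)"
        using eq by (intro nu_minus_block_le_form[OF A C Z fin d gap]) (simp_all add: cC)
      have e1: "A (- X w) + cadj (V \<circ> D) f = D (e - S (D w))"
        by (simp add: cC a AX e_def clinear_simps[OF bD])
      have e2: "inner (A (- X w)) (- X w) = inner (Y (S (S (D w)))) (S (D w))"
        by (simp add: a YS)
      have e3: "inner ((V \<circ> D) (- X w)) f = - inner (Y (S (S (D w)))) e"
        by (simp add: clinear_simps[OF V] clinear_simps[OF bD] SS YD e_def inner_cadj[OF V])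
      have "(norm (?Q (D (e - S (D w)))))\<^sup>2 \<le> (norm (D (e - S (D w))))\<^sup>2"
        by (intro power_mono Qn) simp
      with ineq show ?thesis
        unfolding e1 e2 e3 mult_minus_right add_uminus_conv_diff by linarith
    qed
    moreover have "(\<lambda>n. \<delta> * (inner (Y (S (S (D (w n))))) (S (D (w n))) - 2 * inner (Y (S (S (D (w n))))) e
        + inner (Z f) f) + (norm (D (e - S (D (w n)))))\<^sup>2)
      \<longlonglongrightarrow> \<delta> * (inner (Y (S e)) e - 2 * inner (Y (S e)) e + inner (Z f) f) + (norm (D (e - e)))\<^sup>2"
      by (intro tendsto_intros tendsto_inner t w)
    ultimately have "0 \<le> \<delta> * (inner (Y (S e)) e - 2 * inner (Y (S e)) e + inner (Z f) f) + (norm (D (e - e)))\<^sup>2"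
      by (meson LIMSEQ_le_const)
    then have "0 \<le> \<delta> * (inner (Z f) f - inner (Y (S e)) e)"
      by (simp add: clinear_simps[OF bD] algebra_simps)
    then have "inner (Y (S e)) e \<le> inner (Z f) f" using d by (simp add: zero_le_mult_iff)
    then show "inner ((V \<circ> Y \<circ> S \<circ> cadj V) f) f \<le> inner (Z f) f"
      by (simp add: e_def inner_cadj[OF V])
  next
    assume le: "\<forall>f. inner ((V \<circ> Y \<circ> S \<circ> cadj V) f) f \<le> inner (Z f) f"
    have "nu_minus (block_op A (cadj (V \<circ> D)) (V \<circ> D) Z) \<le> nu_minus A"
    proof (rule nu_minus_block_form_le[OF A C Z fin d gap])
      fix u f
      define e where "e = cadj V f"
      obtain w where w: "(\<lambda>n. S (D (w n))) \<longlonglongrightarrow> e" using approx unfolding e_def by blast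
      have "- (norm (?Q (A u + D (S (D w)))))\<^sup>2
        \<le> \<delta> * (inner (A u) u + 2 * inner (D u) (S (D w)) + inner (Y (S (S (D w)))) (S (D w)))" for w
      proof -
        \<comment> \<open>At u + X w every term depends on \<open>w\<close> through
          \<open>S (D w)\<close> alone, so the estimate passes to the limit
          \<open>e\<close>.\<close>
        have "- (norm (?Q (A (u + X w))))\<^sup>2 \<le> \<delta> * inner (A (u + X w)) (u + X w)"
          by (rule neg_proj_form_bound[OF A d gap])
        moreover have "A (u + X w) = A u + D (S (D w))" by (simp add: a AX)
        moreover have "inner (A u) (X w) = inner (D u) (S (D w))" "inner (A (X w)) u = inner (D u) (S (D w))"
          by (simp_all add: selfadjoint_inner[OF A] AX selfadjoint_inner[OF D] inner_commute)
        moreover have "inner (A (u + X w)) (u + X w)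
            = inner (A u) u + inner (A u) (X w) + inner (A (X w)) u + inner (A (X w)) (X w)"
          by (simp add: a inner_add_left inner_add_right)
        ultimately show ?thesis by (simp add: YS add.commute add.left_commute)
      qed
      moreover have "(\<lambda>n. - (norm (?Q (A u + D (S (D (w n))))))\<^sup>2) \<longlonglongrightarrow> - (norm (?Q (A u + D e)))\<^sup>2"
        by (intro tendsto_intros t w)
      moreover have "(\<lambda>n. \<delta> * (inner (A u) u + 2 * inner (D u) (S (D (w n)))
          + inner (Y (S (S (D (w n))))) (S (D (w n)))))
        \<longlonglongrightarrow> \<delta> * (inner (A u) u + 2 * inner (D u) e + inner (Y (S e)) e)"
        by (intro tendsto_intros tendsto_inner t w)
      ultimately have "- (norm (?Q (A u + D e)))\<^sup>2
          \<le> \<delta> * (inner (A u) u + 2 * inner (D u) e + inner (Y (S e)) e)"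
        by (meson LIMSEQ_le)
      also have "\<dots> \<le> \<delta> * (inner (A u) u + 2 * inner (D u) e + inner (Z f) f)"
        using d le[rule_format, of f] by (simp add: e_def inner_cadj[OF V])
      finally show "- (norm (?Q (A u + cadj (V \<circ> D) f)))\<^sup>2
          \<le> \<delta> * (inner (A u) u + 2 * inner ((V \<circ> D) u) f + inner (Z f) f)"
        by (simp add: cC e_def inner_cadj[OF V])
    qed
    then show "nu_minus (block_op A (D \<circ> cadj V) (V \<circ> D) Z) = nu_minus A"
      using ge by (simp add: cC)
  qed
qed

end

section \<open>The polar decomposition of a selfadjoint operator\<close>

context
  fixes H :: "'a::complex_hilbert \<Rightarrow> 'a"
  assumes H: "selfadjoint H"
begin

private abbreviation (input) "Q \<equiv> neg_proj H"
private abbreviation (input) "S \<equiv> op_sign H"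
private abbreviation (input) "D \<equiv> op_sqrt (op_abs H)"

private lemmas P = orth_projection_neg_proj[OF H]
private lemmas q = orth_projectionD[OF P]
private lemmas qs = clinear_simps[OF q(2)]
private lemmas h = clinear_simps[OF selfadjoint_bounded[OF H]]

private lemma S_apply: "S x = x - 2 *\<^sub>R Q x"
  by (simp add: op_sign_eq[OF H])

lemma selfadjoint_op_sign: "selfadjoint S"
  unfolding op_sign_eq[OF H] by (intro selfadjoint_diff selfadjoint_id selfadjoint_scaleR q(1))

lemma op_sign_involution: "S (S x) = x"
  by (simp add: S_apply qs q(3) scaleR_2)

lemma op_sign_commute: "S (H x) = H (S x)"
  by (simp add: S_apply h neg_proj_commute[OF H])

lemma norm_op_sign: "norm (S x) = norm x"
  by (simp add: norm_eq_sqrt_inner selfadjoint_inner[OF selfadjoint_op_sign] op_sign_involution)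

private lemma split_form: "inner (H x) (S x) = inner (H (x - Q x)) (x - Q x) - inner (H (Q x)) (Q x)"
proof -
  have "inner (H (Q x)) (x - Q x) = 0"
    by (simp add: inner_diff_right neg_proj_commute[OF H, symmetric] selfadjoint_inner[OF q(1)] q(3))
  moreover have "inner (H (x - Q x)) (Q x) = 0"
    by (metis H calculation inner_commute selfadjoint_inner)
  ultimately show ?thesis
    by (simp add: S_apply h inner_diff_left inner_diff_right)
qed

lemma nonneg_op_sign_form: "0 \<le> inner (H x) (S x)"
proof -
  have "0 \<le> inner (H (x - Q x)) (x - Q x)" by (rule neg_proj_nonneg[OF H]) (simp add: qs q(3))
  moreover have "inner (H (Q x)) (Q x) \<le> 0"
    using neg_proj_neg[OF H q(3)[of x]] by (cases "Q x = 0") (auto simp: h)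
  ultimately show ?thesis by (simp add: split_form)
qed

lemma op_abs_eq_sign: "op_abs H = H \<circ> S"
proof (rule op_abs_spec(4)[OF H])
  have "selfadjoint (H \<circ> S)"
  proof (rule selfadjointI)
    show "bounded_clinear (H \<circ> S)" using H selfadjoint_op_sign by blast
    show "inner ((H \<circ> S) x) y = inner x ((H \<circ> S) y)" for x y
      by (simp add: selfadjoint_inner[OF H] selfadjoint_inner[OF selfadjoint_op_sign] op_sign_commute)
  qed
  moreover have "0 \<le> inner ((H \<circ> S) x) x" for x
    using nonneg_op_sign_form[of x]
    by (simp add: selfadjoint_inner[OF selfadjoint_op_sign] flip: op_sign_commute)
  ultimately show "nonneg_op (H \<circ> S)" by (simp add: nonneg_op_inner)
  show "(H \<circ> S) ((H \<circ> S) x) = H (H x)" for x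
    by (simp add: op_sign_commute op_sign_involution)
qed

private lemmas nabs = op_abs_spec(1)[OF H]

lemma selfadjoint_sqrt_abs: "selfadjoint D"
  using op_sqrt_spec(1)[OF nabs] by (simp add: nonneg_op_inner)

lemma sqrt_abs_square: "D (D x) = H (S x)"
  using op_sqrt_spec(2)[OF nabs] by (simp add: op_abs_eq_sign)

lemma sign_sqrt_abs_commute: "S (D x) = D (S x)"
  by (rule op_sqrt_spec(3)[OF nabs selfadjoint_bounded[OF selfadjoint_op_sign]])
    (simp add: op_abs_eq_sign op_sign_commute)

text \<open>Supplies the factorization D S D required of A X in the completion lemmas; there A X is
  the operator J1 (I - T11 T11), whichever sign is taken in A.\<close>

lemma sqrt_abs_polar: "D (S (D x)) = H x"
  by (simp add: sign_sqrt_abs_commute sqrt_abs_square op_sign_involution)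

lemma norm_sqrt_abs: "(norm (D x))\<^sup>2 = inner (H x) (S x)"
  by (simp add: power2_norm_eq_inner selfadjoint_inner[OF selfadjoint_sqrt_abs] sqrt_abs_square
      selfadjoint_inner[OF H])

lemma inner_le_norm_sqrt_abs: "inner (H x) x \<le> (norm (D x))\<^sup>2"
proof -
  have "inner (H x) x = inner (S (D x)) (D x)"
    by (simp add: selfadjoint_inner[OF selfadjoint_sqrt_abs] flip: sqrt_abs_polar)
  also have "\<dots> \<le> norm (S (D x)) * norm (D x)" by (rule norm_cauchy_schwarz)
  finally show ?thesis by (simp add: norm_op_sign power2_eq_square)
qed

private lemma Q_D: "Q (D x) = D (Q x)"
proof -
  note d = clinear_simps[OF selfadjoint_bounded[OF selfadjoint_sqrt_abs]]
  have "2 *\<^sub>R Q (D x) = 2 *\<^sub>R D (Q x)"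
    using sign_sqrt_abs_commute[of x] by (simp add: S_apply d)
  then show ?thesis by simp
qed

lemma norm_sqrt_abs_pos_part: "norm (D (x - Q x)) \<le> norm (D x)"
proof -
  note d = clinear_simps[OF selfadjoint_bounded[OF selfadjoint_sqrt_abs]]
  have "D (x - Q x) = (id - Q) (D x)" by (simp add: d Q_D)
  then show ?thesis using orth_projection_norm(2)[OF orth_projection_compl[OF P]] by simp
qed

text \<open>On the negative subspace |H| is -H, so the gap of \<open>H\<close> bounds
  \<open>D\<close> from below there; the positive part only enlarges the right-hand side.\<close>

lemma norm_sqrt_abs_neg_part:
  assumes "\<And>x. Q x = x \<Longrightarrow> inner (H x) x \<le> - \<delta> * (norm x)\<^sup>2"
  shows "\<delta> * (norm (Q x))\<^sup>2 \<le> (norm (D x))\<^sup>2"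
proof -
  have "0 \<le> inner (H (x - Q x)) (x - Q x)" by (rule neg_proj_nonneg[OF H]) (simp add: qs q(3))
  then show ?thesis
    using assms[OF q(3)[of x]] by (simp add: norm_sqrt_abs split_form)
qed

lemma inner_eq_norm_sqrt_abs: "Q x = 0 \<Longrightarrow> inner (H x) x = (norm (D x))\<^sup>2"
  by (simp add: norm_sqrt_abs S_apply)

end

section \<open>Krein spaces\<close>

lemma fundamental_symmetryD:
  assumes "fundamental_symmetry J"
  shows "selfadjoint J" "J (J x) = x" "norm (J x) = norm x" "inner (J x) (J y) = inner x y"
proof -
  show J: "selfadjoint J" and JJ: "J (J x) = x" for x
    using assms by (auto simp: fundamental_symmetry_def fun_eq_iff)
  show i: "inner (J x) (J y) = inner x y" for x y by (simp add: selfadjoint_inner[OF J] JJ)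
  show "norm (J x) = norm x" by (simp add: norm_eq_sqrt_inner i)
qed

lemma krein_selfadjoint_iff:
  assumes J: "fundamental_symmetry J"
  shows "krein_selfadjoint J X \<longleftrightarrow> bounded_clinear X \<and> selfadjoint (J \<circ> X)"
proof -
  note j = fundamental_symmetryD[OF J]
  have bJ: "bounded_clinear J" using j(1) by blast
  have "kadj J J X = X \<longleftrightarrow> cadj (J \<circ> X) = J \<circ> X" if X: "bounded_clinear X"
  proof -
    have c: "cadj (J \<circ> X) = cadj X \<circ> J"
      using cadj_comp[OF bJ X] j(1) by (simp add: selfadjoint_def)
    have "kadj J J X = X \<longleftrightarrow> (\<forall>x. J (cadj X (J x)) = X x)" by (simp add: kadj_def fun_eq_iff)
    also have "\<dots> \<longleftrightarrow> (\<forall>x. cadj X (J x) = J (X x))" by (metis j(2))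
    finally show ?thesis by (simp add: c fun_eq_iff)
  qed
  then show ?thesis using bJ by (auto simp: krein_selfadjoint_def selfadjoint_def)
qed

lemma fundamental_symmetry_diag:
  assumes "fundamental_symmetry J1" "fundamental_symmetry J2"
  shows "fundamental_symmetry (diag_symmetry J1 J2)"
  using selfadjoint_diag_symmetry fundamental_symmetryD(1,2) assms
  by (auto simp: fundamental_symmetry_def diag_symmetry_apply fun_eq_iff)

lemma diag_symmetry_comp_block:
  assumes "bounded_clinear J1" "bounded_clinear J2"
  shows "diag_symmetry J1 J2 \<circ> block_op A B C D = block_op (J1 \<circ> A) (J1 \<circ> B) (J2 \<circ> C) (J2 \<circ> D)"
  by (auto simp: fun_eq_iff block_op_apply diag_symmetry_apply clinear_simps[OF assms(1)] clinear_simps[OF assms(2)])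

context
  fixes J1 :: "'a::complex_hilbert \<Rightarrow> 'a" and J2 :: "'b::complex_hilbert \<Rightarrow> 'b"
  assumes J1: "fundamental_symmetry J1" and J2: "fundamental_symmetry J2"
begin

private lemmas sym1 = fundamental_symmetryD[OF J1]
private lemmas sym2 = fundamental_symmetryD[OF J2]

private lemma bJ: "bounded_clinear J1" "bounded_clinear J2"
  using sym1(1) sym2(1) by blast+

lemma cadj_symmetry_comp: "bounded_clinear B \<Longrightarrow> cadj (J2 \<circ> B) = J1 \<circ> kadj J1 J2 B"
  using cadj_comp[OF bJ(2)] sym2(1) by (simp add: selfadjoint_def kadj_def fun_eq_iff sym1(2))

lemma diag_symmetry_comp_completion:
  "bounded_clinear B \<Longrightarrow> diag_symmetry J1 J2 \<circ> block_op A (kadj J1 J2 B) B Z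
    = block_op (J1 \<circ> A) (cadj (J2 \<circ> B)) (J2 \<circ> B) (J2 \<circ> Z)"
  by (simp add: diag_symmetry_comp_block[OF bJ] cadj_symmetry_comp)

lemma krein_selfadjoint_block:
  assumes A: "bounded_clinear A" "selfadjoint (J1 \<circ> A)" and B: "bounded_clinear B"
    and Z: "selfadjoint (J2 \<circ> Z)"
  shows "krein_selfadjoint (diag_symmetry J1 J2) (block_op A (kadj J1 J2 B) B Z)"
proof -
  have "Z = J2 \<circ> (J2 \<circ> Z)" by (simp add: fun_eq_iff sym2(2))
  then have bZ: "bounded_clinear Z" using Z bJ by (metis bounded_clinear_comp selfadjoint_bounded)
  have "bounded_clinear (kadj J1 J2 B)" unfolding kadj_def using bJ B by blast
  then show ?thesis
    unfolding krein_selfadjoint_iff[OF fundamental_symmetry_diag[OF J1 J2]]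
      diag_symmetry_comp_completion[OF B]
    using A B Z bZ bJ by (auto intro: selfadjoint_block_op bounded_clinear_block_op)
qed

text \<open>Symmetry of J T fixes the upper right block through the first column, so only the lower
  right corner is free.\<close>

lemma krein_selfadjoint_block_form:
  assumes T: "krein_selfadjoint (diag_symmetry J1 J2) T" and col: "\<And>x. T (x, 0) = col_op A B x"
    and B: "bounded_clinear B"
  shows "\<exists>Z. T = block_op A (kadj J1 J2 B) B Z \<and> selfadjoint (J2 \<circ> Z)"
proof -
  let ?J = "diag_symmetry J1 J2"
  have bT: "bounded_clinear T" and sT: "selfadjoint (?J \<circ> T)"
    using T by (auto simp: krein_selfadjoint_iff[OF fundamental_symmetry_diag[OF J1 J2]])
  have sym: "inner (?J (T z)) w = inner z (?J (T w))" for z w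
    using selfadjoint_inner[OF sT, of z w] by simp
  define Z where "Z y = snd (T (0, y))" for y
  have k: "fst (T (0, y)) = kadj J1 J2 B y" for y
  proof -
    have "inner x (cadj (J2 \<circ> B) y) = inner x (J1 (fst (T (0, y))))" for x
    proof -
      have "inner x (J1 (fst (T (0, y)))) = inner (x, 0) (?J (T (0, y)))"
        by (cases "T (0, y)") (simp add: diag_symmetry_apply)
      also have "\<dots> = inner ((J2 \<circ> B) x) y"
        by (simp add: sym[symmetric] col col_op_def diag_symmetry_apply)
      finally show ?thesis using B bJ by (simp add: inner_cadj[of "J2 \<circ> B", symmetric] bounded_clinear_comp)
    qed
    then have "J1 (fst (T (0, y))) = J1 (kadj J1 J2 B y)"
      using cadj_symmetry_comp[OF B] by (metis comp_apply vector_eq_ldot)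
    then show ?thesis by (metis sym1(2))
  qed
  have "T (x, y) = block_op A (kadj J1 J2 B) B Z (x, y)" for x y
  proof -
    have "T (x, y) = T (x, 0) + T (0, y)" by (simp flip: bounded_clinear_add[OF bT])
    then show ?thesis by (simp add: col col_op_def block_op_apply k Z_def prod_eq_iff)
  qed
  moreover have "selfadjoint (J2 \<circ> Z)"
  proof (rule selfadjointI)
    have "bounded_clinear Z"
    proof -
      obtain K where K: "\<And>z. norm (T z) \<le> K * norm z" using bounded_clinear_bound[OF bT] by metis
      show ?thesis
      proof (rule bounded_clinearI[where K=K])
        show "Z (x + y) = Z x + Z y" for x y
          using bounded_clinear_add[OF bT, of "(0, x)" "(0, y)"] by (simp add: Z_def)
        show "Z (scaleC c x) = scaleC c (Z x)" for c x
          using bounded_clinear_scaleC[OF bT, of c "(0, x)"] by (simp add: Z_def scaleC_prod_def)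
        show "norm (Z x) \<le> K * norm x" for x
        proof -
          have "norm (Z x) \<le> norm (T (0, x))"
            unfolding Z_def by (cases "T (0, x)") (simp add: norm_snd_le)
          then show ?thesis using K[of "(0, x)"] by simp
        qed
      qed
    qed
    then show "bounded_clinear (J2 \<circ> Z)" using bJ by blast
    show "inner ((J2 \<circ> Z) x) y = inner x ((J2 \<circ> Z) y)" for x y
      using sym[of "(0, x)" "(0, y)"]
      by (cases "T (0, x)"; cases "T (0, y)") (simp add: Z_def diag_symmetry_apply)
  qed
  ultimately show ?thesis by (intro exI[of _ Z]) (auto simp: fun_eq_iff)
qed

lemma completion_solutions_iff:
  assumes A: "bounded_clinear A" "selfadjoint (J1 \<circ> A)" and B: "bounded_clinear B"
  shows "M \<in> completion_solutions J1 J2 A B \<longleftrightarrow>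
    (\<exists>Z. M = block_op A (kadj J1 J2 B) B Z \<and> selfadjoint (J2 \<circ> Z) \<and>
      nu_minus (block_op (J1 \<circ> A) (cadj (J2 \<circ> B)) (J2 \<circ> B) (J2 \<circ> Z)) = nu_minus (J1 \<circ> A))"
    (is "_ \<longleftrightarrow> ?R")
proof
  assume M: "M \<in> completion_solutions J1 J2 A B"
  then obtain Z where Z: "M = block_op A (kadj J1 J2 B) B Z"
    and k: "krein_selfadjoint (diag_symmetry J1 J2) M"
    and nu: "krein_nu (diag_symmetry J1 J2) M = krein_nu J1 A"
    by (auto simp: completion_solutions_def)
  have "bounded_clinear (kadj J1 J2 B)" unfolding kadj_def using bJ B by blast
  \<comment> \<open>\<open>completion_solutions\<close> quantifies over arbitrary functions in the
    lower right corner; the first column can be read off from \<open>M\<close> only once this value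
    is known.\<close>
  moreover have "Z 0 = 0"
  proof -
    have "bounded_clinear M" using k by (simp add: krein_selfadjoint_def)
    from bounded_clinear_0[OF this] show ?thesis
      by (simp add: Z zero_prod_def block_op_apply bounded_clinear_0[OF B])
  qed
  ultimately have "M (x, 0) = col_op A B x" for x
    by (simp add: Z block_op_apply col_op_def bounded_clinear_0)
  then obtain Z' where Z': "M = block_op A (kadj J1 J2 B) B Z'" "selfadjoint (J2 \<circ> Z')"
    using krein_selfadjoint_block_form[OF k _ B] by blast
  then show ?R
    using nu diag_symmetry_comp_completion[OF B, of A Z'] by (intro exI[of _ Z']) (simp add: krein_nu_def)
next
  assume ?R
  then show "M \<in> completion_solutions J1 J2 A B"
    using krein_selfadjoint_block[OF A B] diag_symmetry_comp_completion[OF B]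
    by (auto simp: completion_solutions_def krein_nu_def)
qed

lemma krein_le_block:
  "krein_le (diag_symmetry J1 J2) (block_op A C B Z) (block_op A C B Z')
    \<longleftrightarrow> (\<forall>f. inner (J2 (Z f)) f \<le> inner (J2 (Z' f)) f)"
proof -
  have "Re (krein_inner (diag_symmetry J1 J2) ((block_op A C B Z' - block_op A C B Z) (x, f)) (x, f))
      = inner (J2 (Z' f)) f - inner (J2 (Z f)) f" for x f
    by (simp add: krein_inner_def block_op_apply diag_symmetry_apply inner_eq_Re_cinner[symmetric]
        clinear_simps[OF bJ(1)] clinear_simps[OF bJ(2)] inner_diff_left)
  then show ?thesis unfolding krein_le_def by (auto simp: split_paired_All)
qed

text \<open>Two minimal completions dominate each other, so their lower right corners have equal
  forms after multiplication by \<open>J2\<close>, and a complex form determines its operator. This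
  gives meaning to the definite description in \<open>minimal_completion\<close>.\<close>

lemma minimal_completion_unique:
  assumes A: "bounded_clinear A" "selfadjoint (J1 \<circ> A)" and B: "bounded_clinear B"
    and M: "is_minimal_completion J1 J2 A B M"
  shows "minimal_completion J1 J2 A B = M"
  unfolding minimal_completion_def
proof (rule the_equality, rule M)
  fix N assume N: "is_minimal_completion J1 J2 A B N"
  obtain Z where Z: "M = block_op A (kadj J1 J2 B) B Z" "selfadjoint (J2 \<circ> Z)"
    using M completion_solutions_iff[OF A B] unfolding is_minimal_completion_def by blast
  obtain Y where Y: "N = block_op A (kadj J1 J2 B) B Y" "selfadjoint (J2 \<circ> Y)"
    using N completion_solutions_iff[OF A B] unfolding is_minimal_completion_def by blast
  have "krein_le (diag_symmetry J1 J2) M N" "krein_le (diag_symmetry J1 J2) N M"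
    using M N unfolding is_minimal_completion_def by blast+
  then have eq: "inner (J2 (Z f)) f = inner (J2 (Y f)) f" for f
    unfolding Z Y krein_le_block by (simp add: eq_iff)
  have sa: "selfadjoint ((J2 \<circ> Z) - (J2 \<circ> Y))" using Z Y by blast
  have "((J2 \<circ> Z) - (J2 \<circ> Y)) f = 0" for f
  proof (rule form_eq_0[OF selfadjoint_bounded[OF sa]])
    show "cinner (((J2 \<circ> Z) - (J2 \<circ> Y)) g) g = 0" for g
      unfolding cinner_selfadjoint[OF sa] by (simp add: inner_diff_left eq)
  qed
  then have "Z = Y" by (metis fun_diff_def comp_apply eq_iff_diff_eq_0 ext sym2(2))
  then show "N = M" by (simp add: Z Y)
qed

text \<open>\<open>completion_index\<close> turns the index condition into J2 Z >= Z0. As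
  \<open>J2\<close> is an involution, the least solution is Z = J2 Z0.\<close>

lemma minimal_completion_formula:
  assumes A: "bounded_clinear A" "selfadjoint (J1 \<circ> A)" and fin: "nu_minus (J1 \<circ> A) \<noteq> \<infinity>"
    and B: "bounded_clinear B" and VD: "J2 \<circ> B = V \<circ> D"
    and X: "bounded_clinear X" and D: "selfadjoint D"
    and S: "bounded_clinear S" and SS: "\<And>x. S (S x) = x" and SD: "\<And>x. S (D x) = D (S x)"
    and AX: "\<And>x. J1 (A (X x)) = D (S (D x))"
    and Y: "bounded_clinear Y" and YD: "\<And>x. Y (D x) = D (X x)"
    and V: "bounded_clinear V" and V0: "\<forall>x. D x = 0 \<longrightarrow> V x = 0"
  defines "Z0 \<equiv> V \<circ> Y \<circ> S \<circ> cadj V"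
  shows "M \<in> completion_solutions J1 J2 A B \<longleftrightarrow>
      (\<exists>Z. M = block_op A (kadj J1 J2 B) B Z \<and> selfadjoint (J2 \<circ> Z) \<and>
        (\<forall>f. inner (Z0 f) f \<le> inner (J2 (Z f)) f))"
    and "is_minimal_completion J1 J2 A B (block_op A (kadj J1 J2 B) B (J2 \<circ> Z0))"
    and "minimal_completion J1 J2 A B = block_op A (kadj J1 J2 B) B (J2 \<circ> Z0)"
    and "selfadjoint Z0"
proof -
  have AX': "(J1 \<circ> A) (X x) = D (S (D x))" for x by (simp add: AX)
  have bD: "bounded_clinear D" using D by blast
  have cVD: "cadj (V \<circ> D) = D \<circ> cadj V" using D cadj_comp[OF V bD] by (simp add: selfadjoint_def)
  note idx = completion_index[OF A(2) fin X D S SS SD AX' Y YD V V0]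
  show sZ0: "selfadjoint Z0"
    unfolding Z0_def by (rule selfadjoint_minimal_entry[OF A(2) fin X D S SS SD AX' Y YD V V0])
  show sol: "M \<in> completion_solutions J1 J2 A B \<longleftrightarrow>
      (\<exists>Z. M = block_op A (kadj J1 J2 B) B Z \<and> selfadjoint (J2 \<circ> Z) \<and>
        (\<forall>f. inner (Z0 f) f \<le> inner (J2 (Z f)) f))" for M
    unfolding completion_solutions_iff[OF A B] VD cVD Z0_def using idx by (metis comp_apply)
  have J2Z0: "J2 \<circ> (J2 \<circ> Z0) = Z0" by (simp add: fun_eq_iff sym2(2))
  show min: "is_minimal_completion J1 J2 A B (block_op A (kadj J1 J2 B) B (J2 \<circ> Z0))"
    unfolding is_minimal_completion_def
  proof (intro conjI ballI)
    show "block_op A (kadj J1 J2 B) B (J2 \<circ> Z0) \<in> completion_solutions J1 J2 A B"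
      unfolding sol by (intro exI[of _ "J2 \<circ> Z0"]) (simp add: J2Z0 sZ0 sym2(2))
    fix N assume "N \<in> completion_solutions J1 J2 A B"
    then obtain Z where "N = block_op A (kadj J1 J2 B) B Z" "\<And>f. inner (Z0 f) f \<le> inner (J2 (Z f)) f"
      unfolding sol by blast
    then show "krein_le (diag_symmetry J1 J2) (block_op A (kadj J1 J2 B) B (J2 \<circ> Z0)) N"
      by (simp add: krein_le_block sym2(2))
  qed
  show "minimal_completion J1 J2 A B = block_op A (kadj J1 J2 B) B (J2 \<circ> Z0)"
    by (rule minimal_completion_unique[OF A B min])
qed

end

section \<open>The defect and link operators of a Krein-selfadjoint operator\<close>

text \<open>On the kernel of the negative projection the block inequality is tested at f = -t C u,
  which bounds t |C u|^2 by |D u|^2. On the negative subspace \<open>D\<close> is bounded below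
  because of the gap, so boundedness of \<open>C\<close> suffices.\<close>

lemma sqrt_abs_dominates_column:
  fixes H :: "'a::complex_hilbert \<Rightarrow> 'a" and C :: "'a \<Rightarrow> 'b::complex_hilbert"
  assumes H: "selfadjoint H" and fin: "nu_minus H \<noteq> \<infinity>" and C: "bounded_clinear C"
    and Z: "selfadjoint Z" and le: "nu_minus (block_op H (cadj C) C Z) \<le> nu_minus H"
  obtains K where "\<And>u. norm (C u) \<le> K * norm (op_sqrt (op_abs H) u)"
proof -
  let ?Q = "neg_proj H" and ?D = "op_sqrt (op_abs H)"
  note P = orth_projection_neg_proj[OF H]
  note q = orth_projectionD[OF P] and qs = clinear_simps[OF orth_projectionD(2)[OF P]]
  obtain \<delta> where d: "\<delta> > 0" and gap: "\<And>x. ?Q x = x \<Longrightarrow> inner (H x) x \<le> - \<delta> * (norm x)\<^sup>2"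
    using neg_proj_gap[OF H fin] by metis
  obtain M where M: "M > 0" "\<And>f. norm (cadj C f) \<le> M * norm f"
    using bounded_clinear_bound[OF bounded_clinear_cadj[OF C]] by metis
  obtain N where N: "N > 0" "\<And>f. norm (C f) \<le> N * norm f" using bounded_clinear_bound[OF C] by metis
  obtain k where k: "k > 0" "\<And>f. norm (Z f) \<le> k * norm f"
    using bounded_clinear_bound[OF selfadjoint_bounded[OF Z]] by metis
  \<comment> \<open>The maximizer of 2 \<delta> t - (\<delta> k + M^2) t^2, the coefficient of |C
    u|^2 obtained from f = -t C u.\<close>
  define t where "t = \<delta> / (\<delta> * k + M\<^sup>2)"
  have s0: "\<delta> * k + M\<^sup>2 > 0" using d k M by (simp add: add_pos_pos)
  then have t: "t > 0" using d by (simp add: t_def)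
  have pos: "norm (C u) \<le> sqrt (1 / t) * norm (?D u)" if u: "?Q u = 0" for u
  proof -
    define c where "c = (norm (C u))\<^sup>2"
    define f where "f = - t *\<^sub>R C u"
    have nf: "(norm f)\<^sup>2 = t\<^sup>2 * c" using t by (simp add: f_def c_def power_mult_distrib)
    have "- (norm (?Q (H u + cadj C f)))\<^sup>2 \<le> \<delta> * (inner (H u) u + 2 * inner (C u) f + inner (Z f) f)"
      by (rule nu_minus_block_le_form[OF H C Z fin d gap le])
    also have "inner (H u) u = (norm (?D u))\<^sup>2" by (rule inner_eq_norm_sqrt_abs[OF H u])
    also have "inner (C u) f = - t * c" by (simp add: f_def c_def power2_norm_eq_inner)
    finally have 1: "- (norm (?Q (H u + cadj C f)))\<^sup>2
        \<le> \<delta> * ((norm (?D u))\<^sup>2 + 2 * (- t * c) + inner (Z f) f)" .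
    have "?Q (H u + cadj C f) = ?Q (cadj C f)"
      using u by (simp add: qs neg_proj_commute[OF H] clinear_simps[OF selfadjoint_bounded[OF H]])
    then have "norm (?Q (H u + cadj C f)) \<le> M * norm f"
      using orth_projection_norm(2)[OF P, of "cadj C f"] M(2)[of f] by simp
    then have "(norm (?Q (H u + cadj C f)))\<^sup>2 \<le> (M * norm f)\<^sup>2" by (intro power_mono) auto
    then have 2: "(norm (?Q (H u + cadj C f)))\<^sup>2 \<le> M\<^sup>2 * (t\<^sup>2 * c)" by (simp add: power_mult_distrib nf)
    have "inner (Z f) f \<le> k * norm f * norm f"
      using norm_cauchy_schwarz[of "Z f" f] mult_right_mono[OF k(2)[of f], of "norm f"] by simp
    also have "\<dots> = k * (t\<^sup>2 * c)" unfolding nf[symmetric] by (simp add: power2_eq_square)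
    finally have "\<delta> * inner (Z f) f \<le> \<delta> * (k * (t\<^sup>2 * c))" using d by simp
    with 1 2 have 3: "- (M\<^sup>2 * (t\<^sup>2 * c))
        \<le> \<delta> * (norm (?D u))\<^sup>2 - 2 * (\<delta> * (t * c)) + \<delta> * (k * (t\<^sup>2 * c))"
      by (simp add: algebra_simps)
    have "M\<^sup>2 * (t\<^sup>2 * c) + \<delta> * (k * (t\<^sup>2 * c)) = ((\<delta> * k + M\<^sup>2) * t) * (t * c)"
      by (simp add: power2_eq_square algebra_simps)
    also have "(\<delta> * k + M\<^sup>2) * t = \<delta>" using s0 by (simp add: t_def)
    finally have "\<delta> * (t * c) \<le> \<delta> * (norm (?D u))\<^sup>2" using 3 by linarith
    then have "c \<le> (1 / t) * (norm (?D u))\<^sup>2" using d t by (simp add: field_simps)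
    then have "(norm (C u))\<^sup>2 \<le> (sqrt (1 / t) * norm (?D u))\<^sup>2"
      using t by (simp add: c_def power_mult_distrib)
    then show ?thesis by (rule power2_le_imp_le) (use t in simp)
  qed
  have "norm (C u) \<le> (sqrt (1 / t) + N / sqrt \<delta>) * norm (?D u)" for u
  proof -
    have "norm (C (u - ?Q u)) \<le> sqrt (1 / t) * norm (?D (u - ?Q u))"
      by (rule pos) (simp add: qs q(3))
    also have "\<dots> \<le> sqrt (1 / t) * norm (?D u)"
      using t by (intro mult_left_mono norm_sqrt_abs_pos_part[OF H]) simp
    finally have 1: "norm (C (u - ?Q u)) \<le> sqrt (1 / t) * norm (?D u)" .
    have "(sqrt \<delta> * norm (?Q u))\<^sup>2 \<le> (norm (?D u))\<^sup>2"
      using norm_sqrt_abs_neg_part[OF H gap, of u] d by (simp add: power_mult_distrib)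
    then have "sqrt \<delta> * norm (?Q u) \<le> norm (?D u)" by (rule power2_le_imp_le) simp
    then have "norm (?Q u) \<le> norm (?D u) / sqrt \<delta>" using d by (simp add: field_simps)
    then have "N * norm (?Q u) \<le> N * (norm (?D u) / sqrt \<delta>)"
      by (intro mult_left_mono) (use N in simp_all)
    then have 2: "norm (C (?Q u)) \<le> N / sqrt \<delta> * norm (?D u)" using N(2)[of "?Q u"] by simp
    have "norm (C u) \<le> norm (C (u - ?Q u)) + norm (C (?Q u))"
      using norm_triangle_ineq[of "C (u - ?Q u)" "C (?Q u)"] by (simp add: clinear_simps[OF C])
    with 1 2 show ?thesis by (simp add: distrib_right)
  qed
  then show ?thesis by (rule that)
qed

context
  fixes J T :: "'a::complex_hilbert \<Rightarrow> 'a"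
  assumes J: "fundamental_symmetry J" and T: "krein_selfadjoint J T"
begin

private abbreviation (input) "H\<^sub>T \<equiv> J \<circ> (id - (T \<circ> T))"
private abbreviation (input) "D\<^sub>T \<equiv> op_sqrt (op_abs H\<^sub>T)"

private lemmas j = fundamental_symmetryD[OF J]
private lemmas js = clinear_simps[OF selfadjoint_bounded[OF j(1)]]

private lemma bounded_T: "bounded_clinear T" and JT_sym: "inner (J (T x)) y = inner x (J (T y))"
proof -
  have "bounded_clinear T \<and> selfadjoint (J \<circ> T)" using T krein_selfadjoint_iff[OF J] by blast
  then show "bounded_clinear T" "inner (J (T x)) y = inner x (J (T y))"
    using selfadjoint_inner[of "J \<circ> T" x y] by auto
qed

private lemmas ts = clinear_simps[OF bounded_T]

private lemma H\<^sub>T: "selfadjoint H\<^sub>T"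
  by (rule selfadjoint_one_minus_square[OF j(1) bounded_T JT_sym])

private lemmas D\<^sub>T = selfadjoint_sqrt_abs[OF H\<^sub>T]

text \<open>\<open>T\<close> commutes with I - T T and is symmetric for the form of
  \<open>J\<close>, hence also for that of J (I - T T).\<close>

private lemma HT: "inner (H\<^sub>T (T x)) y = inner (H\<^sub>T x) (T y)"
  using JT_sym[of "x - T (T x)" y] selfadjoint_inner[OF j(1), of "x - T (T x)" "T y"]
  by (simp add: ts)

private lemma cadj_T: "cadj T = J \<circ> T \<circ> J"
proof (rule cadj_eqI[OF bounded_T])
  show "inner (T x) y = inner x ((J \<circ> T \<circ> J) y)" for x y
    using j(4)[of "T x" y] JT_sym[of x "J y"] by simp
qed

text \<open>\<open>J\<close> is unitary and cancels in the product of \<open>cadj H\<^sub>T\<close>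
  and \<open>H\<^sub>T\<close>, so both descriptions of the defect operator agree.\<close>

lemma sqrt_abs_one_minus_square: "op_sqrt (op_abs (id - (T \<circ> T))) = D\<^sub>T"
proof -
  have b: "bounded_clinear (id - (T \<circ> T))" using bounded_T by blast
  have "cadj H\<^sub>T \<circ> H\<^sub>T = cadj (id - (T \<circ> T)) \<circ> (id - (T \<circ> T))"
    unfolding cadj_comp[OF selfadjoint_bounded[OF j(1)] b]
    using j(1,2) by (simp add: selfadjoint_def fun_eq_iff)
  then show ?thesis by (simp add: op_abs_def)
qed

lemma defect_op_eq: "defect_op J T = D\<^sub>T"
proof -
  have "J - (cadj T \<circ> J \<circ> T) = H\<^sub>T" by (simp add: cadj_T fun_eq_iff j(2) js)
  then show ?thesis by (simp add: defect_op_def)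
qed

text \<open>As the adjoint of \<open>T\<close> is J T J, the operator under the absolute value is
  the conjugate of \<open>H\<^sub>T\<close> by \<open>J\<close>, and conjugation by a selfadjoint
  unitary passes through absolute value and root.\<close>

lemma defect_op_adj_eq: "defect_op_adj J T = J \<circ> D\<^sub>T \<circ> J"
proof -
  have e: "J - (T \<circ> J \<circ> cadj T) = J \<circ> H\<^sub>T \<circ> J"
    by (simp add: cadj_T fun_eq_iff j(2) js)
  have sa: "selfadjoint (J \<circ> A \<circ> J)" if "selfadjoint A" for A
    using that j(1)
    by (intro selfadjointI) (auto simp: selfadjoint_inner[OF j(1)] selfadjoint_inner[OF that])
  have nn: "nonneg_op (J \<circ> A \<circ> J)" if "nonneg_op A" for A
    using that sa by (auto simp: nonneg_op_inner selfadjoint_inner[OF j(1)])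
  have abs: "op_abs (J \<circ> H\<^sub>T \<circ> J) = J \<circ> op_abs H\<^sub>T \<circ> J"
    by (rule op_abs_spec(4)[OF sa[OF H\<^sub>T] nn[OF op_abs_spec(1)[OF H\<^sub>T]]])
      (use op_abs_spec(2)[OF H\<^sub>T] in \<open>simp only: comp_apply j(2)\<close>)
  have "op_sqrt (J \<circ> op_abs H\<^sub>T \<circ> J) = J \<circ> D\<^sub>T \<circ> J"
    by (rule op_sqrt_spec(4)[OF nn[OF op_abs_spec(1)[OF H\<^sub>T]] nn[OF op_sqrt_spec(1)[OF op_abs_spec(1)[OF H\<^sub>T]]]])
      (simp add: j(2) op_sqrt_spec(2)[OF op_abs_spec(1)[OF H\<^sub>T]])
  then show ?thesis unfolding defect_op_adj_def e abs .
qed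

text \<open>
  \<open>(H\<^sub>T T u, T u) = (H\<^sub>T u, u) - (J H\<^sub>T u, H\<^sub>T u)\<close> settles the form of
  \<open>H\<^sub>T\<close>; its negative part is bounded below, which turns this into an estimate for \<open>|H\<^sub>T|\<close>.
\<close>

lemma defect_intertwining:
  assumes fin: "nu_minus H\<^sub>T \<noteq> \<infinity>"
  shows "\<exists>W. bounded_clinear W \<and> (\<forall>x. W (D\<^sub>T x) = D\<^sub>T (T x)) \<and> (\<forall>x. D\<^sub>T x = 0 \<longrightarrow> W x = 0)"
proof -
  let ?Q = "neg_proj H\<^sub>T"
  note P = orth_projection_neg_proj[OF H\<^sub>T]
  note q = orth_projectionD[OF P]
  obtain \<delta> where d: "\<delta> > 0" and gap: "\<And>x. ?Q x = x \<Longrightarrow> inner (H\<^sub>T x) x \<le> - \<delta> * (norm x)\<^sup>2"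
    using neg_proj_gap[OF H\<^sub>T fin] by metis
  obtain K where K: "K > 0" "\<And>x. norm (D\<^sub>T x) \<le> K * norm x"
    using bounded_clinear_bound[OF selfadjoint_bounded[OF D\<^sub>T]] by metis
  obtain M where M: "M > 0" "\<And>x. norm (cadj T x) \<le> M * norm x"
    using bounded_clinear_bound[OF bounded_clinear_cadj[OF bounded_T]] by metis
  \<comment> \<open>With p = T u, |D p|^2 is (H p, p) minus twice its negative part. The form is at
    most |D u|^2 + |H u|^2, the negative part at least -M^2 |H u|^2 / \<delta> because H p is the
    adjoint of T applied to H u, and |H u| <= K |D u|; \<open>c\<close> collects these terms after
    multiplication by \<delta>.\<close>
  define c where "c = \<delta> + \<delta> * K\<^sup>2 + 2 * (M\<^sup>2 * K\<^sup>2)"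
  have c: "c \<ge> 0" using d by (simp add: c_def)
  have "norm ((D\<^sub>T \<circ> T) u) \<le> sqrt (c / \<delta>) * norm (D\<^sub>T u)" for u
  proof -
    define p where "p = T u"
    have Hu: "(norm (H\<^sub>T u))\<^sup>2 \<le> K\<^sup>2 * (norm (D\<^sub>T u))\<^sup>2"
    proof -
      have "norm (H\<^sub>T u) \<le> K * norm (D\<^sub>T u)"
        using K(2)[of "op_sign H\<^sub>T (D\<^sub>T u)"] unfolding norm_op_sign[OF H\<^sub>T] sqrt_abs_polar[OF H\<^sub>T] .
      then have "(norm (H\<^sub>T u))\<^sup>2 \<le> (K * norm (D\<^sub>T u))\<^sup>2" by (intro power_mono) auto
      then show ?thesis by (simp add: power_mult_distrib)
    qed
    have 1: "inner (H\<^sub>T p) p \<le> (norm (D\<^sub>T u))\<^sup>2 + (norm (H\<^sub>T u))\<^sup>2"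
    proof -
      have "T p = u - J (H\<^sub>T u)" by (simp add: p_def j(2))
      then have "inner (H\<^sub>T p) p = inner (H\<^sub>T u) u - inner (H\<^sub>T u) (J (H\<^sub>T u))"
        unfolding p_def by (simp only: HT inner_diff_right)
      moreover have "\<bar>inner (H\<^sub>T u) (J (H\<^sub>T u))\<bar> \<le> norm (H\<^sub>T u) * norm (H\<^sub>T u)"
        using Cauchy_Schwarz_ineq2[of "H\<^sub>T u" "J (H\<^sub>T u)"] unfolding j(3) .
      ultimately show ?thesis
        using inner_le_norm_sqrt_abs[OF H\<^sub>T, of u] by (simp only: power2_eq_square)
    qed
    have Hp: "norm (?Q (H\<^sub>T (?Q p))) \<le> M * norm (H\<^sub>T u)"
    proof -
      have "inner (H\<^sub>T p) y = inner (cadj T (H\<^sub>T u)) y" for y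
        unfolding p_def by (simp only: HT inner_cadj'[OF bounded_T])
      then have "H\<^sub>T p = cadj T (H\<^sub>T u)" by (metis vector_eq_rdot)
      moreover have "norm (?Q (H\<^sub>T (?Q p))) \<le> norm (H\<^sub>T p)"
        using orth_projection_norm(2)[OF P, of "H\<^sub>T p"]
        by (simp only: neg_proj_commute[OF H\<^sub>T, symmetric] q(3))
      ultimately show ?thesis using M(2)[of "H\<^sub>T u"] by simp
    qed
    then have "(norm (?Q (H\<^sub>T (?Q p))))\<^sup>2 \<le> (M * norm (H\<^sub>T u))\<^sup>2" by (intro power_mono) auto
    then have "- (M\<^sup>2 * (norm (H\<^sub>T u))\<^sup>2) \<le> \<delta> * inner (H\<^sub>T (?Q p)) (?Q p)"
      using neg_proj_form_bound[OF H\<^sub>T d gap, of "?Q p"] unfolding power_mult_distrib by linarith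
    moreover have "inner (H\<^sub>T (?Q p)) (?Q p) = inner (H\<^sub>T p) (?Q p)"
      by (simp only: neg_proj_commute[OF H\<^sub>T, symmetric] selfadjoint_inner[OF q(1)] q(3))
    moreover have "(norm (D\<^sub>T p))\<^sup>2 = inner (H\<^sub>T p) p - 2 * inner (H\<^sub>T p) (?Q p)"
      unfolding norm_sqrt_abs[OF H\<^sub>T] op_sign_eq[OF H\<^sub>T]
      by (simp only: fun_diff_def id_apply inner_diff_right inner_scaleR_right)
    ultimately have "\<delta> * (norm (D\<^sub>T p))\<^sup>2 \<le> \<delta> * inner (H\<^sub>T p) p + 2 * (M\<^sup>2 * (norm (H\<^sub>T u))\<^sup>2)"
      by (simp only: right_diff_distrib)
    also have "\<delta> * inner (H\<^sub>T p) p \<le> \<delta> * ((norm (D\<^sub>T u))\<^sup>2 + (norm (H\<^sub>T u))\<^sup>2)"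
      using 1 d by (intro mult_left_mono) auto
    also have "\<delta> * ((norm (D\<^sub>T u))\<^sup>2 + (norm (H\<^sub>T u))\<^sup>2) + 2 * (M\<^sup>2 * (norm (H\<^sub>T u))\<^sup>2)
        \<le> \<delta> * ((norm (D\<^sub>T u))\<^sup>2 + K\<^sup>2 * (norm (D\<^sub>T u))\<^sup>2) + 2 * (M\<^sup>2 * (K\<^sup>2 * (norm (D\<^sub>T u))\<^sup>2))"
      using Hu d by (intro add_mono mult_left_mono order_refl) auto
    also have "\<dots> = c * (norm (D\<^sub>T u))\<^sup>2" unfolding c_def by (simp only: distrib_left distrib_right mult.assoc)
    finally have "\<delta> * (norm (D\<^sub>T p))\<^sup>2 \<le> c * (norm (D\<^sub>T u))\<^sup>2" by (simp only: add_right_mono)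
    then have "(norm (D\<^sub>T p))\<^sup>2 \<le> (c / \<delta>) * (norm (D\<^sub>T u))\<^sup>2"
      using d by (simp only: pos_le_divide_eq times_divide_eq_left) (simp only: mult.commute)
    also have "\<dots> = (sqrt (c / \<delta>) * norm (D\<^sub>T u))\<^sup>2" using c d by (simp add: power_mult_distrib)
    finally have "norm (D\<^sub>T p) \<le> sqrt (c / \<delta>) * norm (D\<^sub>T u)"
      by (rule power2_le_imp_le) (use c d in simp)
    then show ?thesis by (simp only: p_def comp_apply)
  qed
  moreover have "bounded_clinear (D\<^sub>T \<circ> T)" using D\<^sub>T bounded_T by blast
  ultimately show ?thesis using douglas_factorization[OF D\<^sub>T, of "D\<^sub>T \<circ> T"] by (simp only: comp_apply) blast
qed

text \<open>Taking adjoints in W D = D T gives D \<open>cadj W\<close> = \<open>cadj T\<close> D.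
  Multiplied by \<open>J\<close>, this is the defining relation of the link operator, since J
  \<open>cadj T\<close> = T J and the second defect operator is J D J.\<close>

lemma link_op_eq:
  assumes W: "bounded_clinear W" and WD: "\<And>x. W (D\<^sub>T x) = D\<^sub>T (T x)" and ker: "\<forall>x. D\<^sub>T x = 0 \<longrightarrow> W x = 0"
  shows "link_op J T = J \<circ> cadj W"
proof -
  note W0 = ker[rule_format]
  have bD: "bounded_clinear D\<^sub>T" and bJ: "bounded_clinear J" using D\<^sub>T j(1) by blast+
  note bcW = bounded_clinear_cadj[OF W]
  let ?D' = "J \<circ> D\<^sub>T \<circ> J"
  have D': "selfadjoint ?D'"
    using D\<^sub>T j(1) by (intro selfadjointI) (auto simp: selfadjoint_inner[OF j(1)] selfadjoint_inner[OF D\<^sub>T])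
  have adj: "D\<^sub>T (cadj W x) = cadj T (D\<^sub>T x)" for x
  proof (rule vector_eq_rdot[THEN iffD1], rule)
    fix z
    have "inner (D\<^sub>T (cadj W x)) z = inner x (W (D\<^sub>T z))"
      by (simp only: selfadjoint_inner[OF D\<^sub>T] inner_cadj'[OF W])
    also have "\<dots> = inner (cadj T (D\<^sub>T x)) z"
      by (simp only: WD selfadjoint_inner[OF D\<^sub>T, symmetric] inner_cadj'[OF bounded_T])
    finally show "inner (D\<^sub>T (cadj W x)) z = inner (cadj T (D\<^sub>T x)) z" .
  qed
  let ?P = "\<lambda>L. bounded_clinear L \<and> (\<forall>x \<in> closure (range D\<^sub>T).
        L x \<in> closure (range ?D') \<and> ?D' (L x) = T (J (D\<^sub>T x))) \<and> (\<forall>x. D\<^sub>T x = 0 \<longrightarrow> L x = 0)"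
  have P: "?P (J \<circ> cadj W)"
  proof (intro conjI ballI allI impI)
    show "bounded_clinear (J \<circ> cadj W)" using bJ bcW by blast
    show "(J \<circ> cadj W) x \<in> closure (range ?D')" for x
    proof (rule closure_range_ker[OF D'])
      fix y assume "?D' y = 0"
      then have "D\<^sub>T (J y) = 0" using j(2) bounded_clinear_0[OF bJ] by (metis comp_apply)
      then have "W (J y) = 0" by (rule W0)
      then show "inner ((J \<circ> cadj W) x) y = 0"
        by (simp add: selfadjoint_inner[OF j(1)] inner_cadj'[OF W])
    qed
    show "?D' ((J \<circ> cadj W) x) = T (J (D\<^sub>T x))" for x
      using adj[of x] unfolding cadj_T by (simp add: j(2))
    \<comment> \<open>The adjoint of \<open>W\<close> sends the kernel of D into itself, and
      \<open>W\<close> vanishes there, so |\<open>cadj W x\<close>|^2 = (x, W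
      (\<open>cadj W x\<close>)) = 0.\<close>
    fix x assume x: "D\<^sub>T x = 0"
    then have "D\<^sub>T (cadj W x) = 0" using adj bounded_clinear_0[OF bounded_clinear_cadj[OF bounded_T]] by metis
    then have "inner (cadj W x) (cadj W x) = 0" by (simp only: inner_cadj'[OF W] W0 inner_zero_right)
    then show "(J \<circ> cadj W) x = 0" by (simp add: js)
  qed
  have "L = J \<circ> cadj W" if L: "?P L" for L
  proof
    fix x
    let ?S = "closure (range D\<^sub>T)" and ?S' = "closure (range ?D')"
    have S: "cvec.subspace ?S" "closed ?S" using bD by (auto intro: csubspace_closure csubspace_range)
    have S': "cvec.subspace ?S'"
      by (intro csubspace_closure csubspace_range selfadjoint_bounded[OF D'])
    let ?M = "J \<circ> cadj W"
    define y where "y = proj ?S x"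
    have y: "y \<in> ?S" by (simp add: y_def proj_mem[OF S])
    have "L y - ?M y \<in> ?S'" using L P y by (intro cvec.subspace_diff[OF S']) blast+
    moreover have "?D' (L y - ?M y) = 0"
    proof -
      have "?D' (L y) = T (J (D\<^sub>T y))" "?D' (?M y) = T (J (D\<^sub>T y))" using L P y by blast+
      then show ?thesis unfolding bounded_clinear_diff[OF selfadjoint_bounded[OF D']] by simp
    qed
    ultimately have "L y - ?M y = 0" by (rule closure_range_orth_eq_0[OF D'])
    moreover have "D\<^sub>T (x - y) = 0" unfolding y_def by (rule ker_minus_proj_closure_range[OF D\<^sub>T])
    then have "L (x - y) = 0" "?M (x - y) = 0" using L P by blast+
    moreover have "L x = L y + L (x - y)" "?M x = ?M y + ?M (x - y)"
      using bounded_clinear_add[OF conjunct1[OF L], of y "x - y"]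
        bounded_clinear_add[OF conjunct1[OF P], of y "x - y"] by simp_all
    ultimately show "L x = ?M x" by simp
  qed
  then show ?thesis
    unfolding link_op_def defect_op_eq defect_op_adj_eq by (intro the_equality P)
qed

end

section \<open>Extremal extensions\<close>

lemma bounded_clinear_col_opD:
  assumes T: "bounded_clinear (col_op A B)" shows "bounded_clinear B"
proof -
  obtain K where K: "\<And>x. norm (col_op A B x) \<le> K * norm x" using bounded_clinear_bound[OF T] by metis
  show ?thesis
  proof (rule bounded_clinearI[where K=K])
    show "B (x + y) = B x + B y" for x y
      using bounded_clinear_add[OF T, of x y] by (simp add: col_op_def)
    show "B (scaleC c x) = scaleC c (B x)" for c x
      using bounded_clinear_scaleC[OF T, of c x] by (simp add: col_op_def scaleC_prod_def)
    show "norm (B x) \<le> K * norm x" for x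
      using K[of x] norm_snd_le[of "B x" "A x"] by (simp add: col_op_def)
  qed
qed

lemma block_op_inject:
  fixes D D' :: "'b::complex_hilbert \<Rightarrow> 'b"
  assumes "block_op A B C D = block_op A B C D'" shows "D = D'"
proof
  fix y
  have "block_op A B C D (undefined, y) = block_op A B C D' (undefined, y)" by (simp add: assms)
  then show "D y = D' y" by (simp add: block_op_apply)
qed

lemma id_plus_block: "id + block_op A B C D = block_op (id + A) B C (id + (D :: 'b::complex_hilbert \<Rightarrow> 'b))"
  for A :: "'a::complex_hilbert \<Rightarrow> 'a"
  by (auto simp: fun_eq_iff block_op_apply add.assoc add.left_commute)

lemma id_minus_block:
  "id - block_op A B C D = block_op (id - A) (- B) (- C) (id - (D :: 'b::complex_hilbert \<Rightarrow> 'b))"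
  for A :: "'a::complex_hilbert \<Rightarrow> 'a"
  by (auto simp: fun_eq_iff block_op_apply)

context
  fixes J1 :: "'a::complex_hilbert \<Rightarrow> 'a" and J2 :: "'b::complex_hilbert \<Rightarrow> 'b"
    and T11 :: "'a \<Rightarrow> 'a" and T21 :: "'a \<Rightarrow> 'b"
  assumes J1: "fundamental_symmetry J1" and J2: "fundamental_symmetry J2"
    and T11: "krein_selfadjoint J1 T11" and T21: "bounded_clinear T21"
begin

private abbreviation (input) "J \<equiv> diag_symmetry J1 J2"
private abbreviation (input) "T1 \<equiv> col_op T11 T21"
private abbreviation (input) "H\<^sub>1 \<equiv> J1 \<circ> (id - (T11 \<circ> T11))"
private abbreviation (input) "H\<^sub>1' \<equiv> J1 \<circ> (id - (kadj J1 J T1 \<circ> T1))"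
private abbreviation (input) "C \<equiv> J2 \<circ> T21"

private lemmas j1 = fundamental_symmetryD[OF J1]
private lemmas j2 = fundamental_symmetryD[OF J2]
private lemmas jj = fundamental_symmetryD[OF fundamental_symmetry_diag[OF J1 J2]]
private lemmas j1s = clinear_simps[OF selfadjoint_bounded[OF j1(1)]]
private lemmas j2s = clinear_simps[OF selfadjoint_bounded[OF j2(1)]]

private lemma bT: "bounded_clinear T11" and JT: "inner (J1 (T11 x)) y = inner x (J1 (T11 y))"
proof -
  have "bounded_clinear T11 \<and> selfadjoint (J1 \<circ> T11)" using T11 krein_selfadjoint_iff[OF J1] by blast
  then show "bounded_clinear T11" "inner (J1 (T11 x)) y = inner x (J1 (T11 y))"
    using selfadjoint_inner[of "J1 \<circ> T11" x y] by auto
qed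

private lemma JTT: "inner (J1 (T11 u)) (T11 v) = inner (J1 (T11 (T11 u))) v"
  using JT[of "T11 u" v] selfadjoint_inner[OF j1(1), of "T11 u" "T11 v"] by simp

private lemma bT1: "bounded_clinear T1"
  by (rule bounded_clinear_col_op[OF bT T21])

private lemmas sH = selfadjoint_one_minus_square[OF j1(1) bT JT]
private lemmas sP = selfadjoint_one_plus[OF j1(1) bT JT]
private lemmas sM = selfadjoint_one_minus[OF j1(1) bT JT]

private lemma bC: "bounded_clinear C"
  using j2(1) T21 by blast

private lemma H'_inner: "inner (H\<^sub>1' u) v = inner (H\<^sub>1 u) v - inner (J2 (T21 u)) (T21 v)"
proof -
  have "inner (H\<^sub>1' u) v = inner (J1 u) v - inner (cadj T1 (J (T1 u))) v"
    by (simp add: kadj_def j1(2) j1s inner_diff_left)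
  also have "inner (cadj T1 (J (T1 u))) v = inner (J1 (T11 u)) (T11 v) + inner (J2 (T21 u)) (T21 v)"
    by (simp add: inner_cadj'[OF bT1]) (simp add: col_op_def diag_symmetry_apply)
  also have "inner (J1 (T11 u)) (T11 v) = inner (J1 (T11 (T11 u))) v" by (rule JTT)
  finally show ?thesis by (simp add: j1s inner_diff_left)
qed

private lemma sH': "selfadjoint H\<^sub>1'"
proof (rule selfadjointI)
  have "bounded_clinear (kadj J1 J T1)"
    unfolding kadj_def using j1(1) jj(1) bT1 by blast
  then show "bounded_clinear H\<^sub>1'" using j1(1) bT1 by blast
  show "inner (H\<^sub>1' u) v = inner u (H\<^sub>1' v)" for u v
  proof -
    have "inner u (H\<^sub>1' v) = inner (H\<^sub>1 v) u - inner (J2 (T21 v)) (T21 u)"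
      by (subst inner_commute) (rule H'_inner)
    also have "inner (H\<^sub>1 v) u = inner (H\<^sub>1 u) v"
      using selfadjoint_inner[OF sH, of v u] by (simp only: inner_commute)
    also have "inner (J2 (T21 v)) (T21 u) = inner (J2 (T21 u)) (T21 v)"
      using selfadjoint_inner[OF j2(1), of "T21 v" "T21 u"] by (simp only: inner_commute)
    finally show ?thesis unfolding H'_inner by simp
  qed
qed

text \<open>The form of \<open>H\<^sub>1\<close> at x is the form of the orthogonal sum of
  \<open>H\<^sub>1'\<close> and \<open>J2\<close> at (x, T21 x). One half of the index condition
  thus always holds.\<close>

lemma nu_one_minus_square_le: "nu_minus H\<^sub>1 \<le> nu_minus H\<^sub>1' + nu_minus J2"
proof -
  have "nu_minus H\<^sub>1 \<le> nu_minus (diag_symmetry H\<^sub>1' J2)"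
  proof (rule nu_minus_mono[OF sH selfadjoint_diag_symmetry[OF sH' j2(1)]])
    show "Vector_Spaces.linear scaleC scaleC (\<lambda>x. (x, T21 x))"
      by (auto simp: Vector_Spaces.linear_iff vector_space_scaleC scaleC_prod_def clinear_simps[OF T21])
    show "inner (diag_symmetry H\<^sub>1' J2 (x, T21 x)) (x, T21 x) \<le> 1 * inner (H\<^sub>1 x) x" for x
      unfolding diag_symmetry_apply inner_Pair H'_inner by simp
  qed simp
  then show ?thesis by (simp only: nu_minus_diag_symmetry[OF sH' j2(1)])
qed

text \<open>The shear from (u, g) to (u, g + T21 u) completes the square. Under the index condition,
  the block operator with corner \<open>J2\<close> therefore has no more negative squares than
  \<open>H\<^sub>1\<close>; this one fact gives both the factor \<open>V\<close> and the bound of V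
  \<open>S\<^sub>1\<close> \<open>cadj V\<close> by \<open>J2\<close>.\<close>

private lemma nu_block_le: "nu_minus (block_op H\<^sub>1 (cadj C) C J2) \<le> nu_minus H\<^sub>1' + nu_minus J2"
proof -
  have "nu_minus (block_op H\<^sub>1 (cadj C) C J2) \<le> nu_minus (diag_symmetry H\<^sub>1' J2)"
  proof (rule nu_minus_mono[OF selfadjoint_block_op[OF sH bC j2(1)] selfadjoint_diag_symmetry[OF sH' j2(1)]])
    let ?f = "\<lambda>z::'a \<times> 'b. (fst z, snd z + T21 (fst z))"
    show "Vector_Spaces.linear scaleC scaleC ?f"
      by (auto simp: Vector_Spaces.linear_iff vector_space_scaleC scaleC_prod_def clinear_simps[OF T21]
          scaleC_add_right)
    fix z :: "'a \<times> 'b"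
    obtain u g where z: "z = (u, g)" by (cases z)
    have "inner (block_op H\<^sub>1 (cadj C) C J2 z) z = inner (H\<^sub>1 u) u + 2 * inner (C u) g + inner (J2 g) g"
      unfolding z block_op_apply inner_Pair inner_add_left inner_cadj'[OF bC]
      by (simp only: inner_commute[of g])
    moreover have "inner (J2 g) (T21 u) = inner (C u) g"
      by (simp add: selfadjoint_inner[OF j2(1)] inner_commute)
    ultimately show "inner (diag_symmetry H\<^sub>1' J2 (?f z)) (?f z) \<le> 1 * inner (block_op H\<^sub>1 (cadj C) C J2 z) z"
      unfolding z diag_symmetry_apply inner_Pair fst_conv snd_conv H'_inner
      by (simp add: j2s inner_add_left inner_add_right)
  qed simp
  then show ?thesis by (simp only: nu_minus_diag_symmetry[OF sH' j2(1)])
qed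

private lemma nu_square: "nu_minus J1 + nu_minus H\<^sub>1 = nu_minus (J1 \<circ> (id + T11)) + nu_minus (J1 \<circ> (id - T11))"
  by (rule nu_minus_square[OF j1(1) bT JT])

text \<open>The minimal index conditions equate the right-hand sides of the index identities for T
  and T11. For the second claim, the form of J (I - T T) restricted to the first summand is that of
  \<open>H\<^sub>1'\<close>, because it depends only on the first column of T.\<close>

lemma Ext_negative_index:
  assumes T: "T \<in> Ext J1 J2 T11 T21"
  shows "nu_minus J + nu_minus (J \<circ> (id - (T \<circ> T))) = nu_minus J1 + nu_minus H\<^sub>1"
    and "nu_minus H\<^sub>1' \<le> nu_minus (J \<circ> (id - (T \<circ> T)))"
proof -
  have k: "krein_selfadjoint J T" and col: "\<And>x. T (x, 0) = T1 x"
    and p: "nu_minus (J \<circ> (id + T)) = nu_minus (J1 \<circ> (id + T11))"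
    and m: "nu_minus (J \<circ> (id - T)) = nu_minus (J1 \<circ> (id - T11))"
    using T by (auto simp: Ext_def completion_solutions_def krein_nu_def)
  have b: "bounded_clinear T" and s: "selfadjoint (J \<circ> T)"
    using k krein_selfadjoint_iff[OF fundamental_symmetry_diag[OF J1 J2]] by blast+
  have JT: "inner (J (T z)) w = inner z (J (T w))" for z w
    using selfadjoint_inner[OF s, of z w] by simp
  show "nu_minus J + nu_minus (J \<circ> (id - (T \<circ> T))) = nu_minus J1 + nu_minus H\<^sub>1"
    unfolding nu_minus_square[OF jj(1) b JT] p m nu_square ..
  show "nu_minus H\<^sub>1' \<le> nu_minus (J \<circ> (id - (T \<circ> T)))"
  proof (rule nu_minus_mono[OF sH' selfadjoint_one_minus_square[OF jj(1) b JT]])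
    show "Vector_Spaces.linear scaleC scaleC (\<lambda>x::'a. (x, 0::'b))"
      by (auto simp: Vector_Spaces.linear_iff vector_space_scaleC scaleC_prod_def)
    fix x
    have "inner (J (T (T (x, 0)))) (x, 0) = inner (J (T (x, 0))) (T (x, 0))"
      using JT[of "T (x, 0)" "(x, 0)"] selfadjoint_inner[OF jj(1), of "T (x, 0)" "T (x, 0)"] by simp
    also have "\<dots> = inner (J1 (T11 x)) (T11 x) + inner (J2 (T21 x)) (T21 x)"
      by (simp add: col) (simp add: col_op_def diag_symmetry_apply)
    also have "inner (J1 (T11 x)) (T11 x) = inner (J1 (T11 (T11 x))) x" by (rule JTT)
    finally show "inner ((J \<circ> (id - (T \<circ> T))) (x, 0)) (x, 0) \<le> 1 * inner (H\<^sub>1' x) x"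
      unfolding H'_inner
      by (simp add: clinear_simps[OF selfadjoint_bounded[OF jj(1)]] inner_diff_left j1s)
        (simp add: diag_symmetry_apply)
  qed simp
qed

section \<open>Extremal extensions under the index condition\<close>

context
  assumes finJ1: "nu_minus J1 \<noteq> \<infinity>" and finH: "nu_minus H\<^sub>1 \<noteq> \<infinity>"
    and index: "nu_minus H\<^sub>1 = nu_minus H\<^sub>1' + nu_minus J2"
begin

private abbreviation (input) "D\<^sub>1 \<equiv> op_sqrt (op_abs H\<^sub>1)"
private abbreviation (input) "S\<^sub>1 \<equiv> op_sign H\<^sub>1"
private abbreviation (input) "k21 \<equiv> kadj J1 J2 T21"

private lemmas D\<^sub>1 = selfadjoint_sqrt_abs[OF sH]
private lemmas bS = selfadjoint_bounded[OF selfadjoint_op_sign[OF sH]]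

text \<open>Here the finite index of \<open>J1\<close> enters: by the index identity the indices of
  I + T11 and I - T11 have a finite sum, so both operators have a spectral gap.\<close>

private lemma fin: "nu_minus (J1 \<circ> (id + T11)) \<noteq> \<infinity>" "nu_minus (J1 \<circ> (id - T11)) \<noteq> \<infinity>"
  using nu_square finJ1 finH by (metis plus_eq_infty_iff_enat)+

text \<open>The problem for I - T arises from the one for I + T by changing the signs of
  \<open>T11\<close>, \<open>T21\<close>, \<open>V\<close> and \<open>W\<close>. The factor
  \<open>D\<^sub>1\<close> and the sign \<open>S\<^sub>1\<close> depend on the square of
  \<open>T11\<close> only and serve both problems, and the two signs of \<open>V\<close> cancel in
  the corner.\<close>

lemma extremal_extensions:
  obtains V W where "bounded_clinear V" "bounded_clinear W"
    "op_graph V = clos_comp_mp_inverse C D\<^sub>1" "C = V \<circ> D\<^sub>1" "link_op J1 T11 = J1 \<circ> cadj W"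
    "is_minimal_completion J1 J2 (id + T11) T21
      (block_op (id + T11) k21 T21 (J2 \<circ> (V \<circ> (id - W) \<circ> S\<^sub>1 \<circ> cadj V)))"
    "is_minimal_completion J1 J2 (id - T11) (- T21)
      (block_op (id - T11) (- k21) (- T21) (J2 \<circ> (V \<circ> (id + W) \<circ> S\<^sub>1 \<circ> cadj V)))"
    "\<And>T. T \<in> Ext J1 J2 T11 T21 \<longleftrightarrow> (\<exists>Z. T = block_op T11 k21 T21 Z \<and> selfadjoint (J2 \<circ> Z) \<and>
      (\<forall>f. inner ((V \<circ> (id - W) \<circ> S\<^sub>1 \<circ> cadj V) f) f \<le> inner (J2 (f + Z f)) f) \<and>
      (\<forall>f. inner ((V \<circ> (id + W) \<circ> S\<^sub>1 \<circ> cadj V) f) f \<le> inner (J2 (f - Z f)) f))"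
    "\<And>f. inner ((V \<circ> (id - W) \<circ> S\<^sub>1 \<circ> cadj V) f) f + inner ((V \<circ> (id + W) \<circ> S\<^sub>1 \<circ> cadj V) f) f
      \<le> 2 * inner (J2 f) f"
    "selfadjoint (V \<circ> (id - W) \<circ> S\<^sub>1 \<circ> cadj V)" "selfadjoint (V \<circ> (id + W) \<circ> S\<^sub>1 \<circ> cadj V)"
proof -
  have blk: "nu_minus (block_op H\<^sub>1 (cadj C) C J2) \<le> nu_minus H\<^sub>1"
    unfolding index by (rule nu_block_le)
  obtain K where "\<And>u. norm (C u) \<le> K * norm (D\<^sub>1 u)"
    using sqrt_abs_dominates_column[OF sH finH bC j2(1) blk] by metis
  then obtain V where V: "bounded_clinear V" "\<And>x. V (D\<^sub>1 x) = C x" "\<forall>x. D\<^sub>1 x = 0 \<longrightarrow> V x = 0"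
    using douglas_factorization[OF D\<^sub>1 bC] by metis
  obtain W where W: "bounded_clinear W" "\<And>x. W (D\<^sub>1 x) = D\<^sub>1 (T11 x)" "\<forall>x. D\<^sub>1 x = 0 \<longrightarrow> W x = 0"
    using defect_intertwining[OF J1 T11 finH] by metis
  have CV: "C = V \<circ> D\<^sub>1" using V(2) by (simp add: fun_eq_iff)
  have bD: "bounded_clinear D\<^sub>1" using D\<^sub>1 by blast
  note ts = clinear_simps[OF bT] and ds = clinear_simps[OF bD]
  have polar: "D\<^sub>1 (S\<^sub>1 (D\<^sub>1 x)) = J1 (x - T11 (T11 x))" for x
    using sqrt_abs_polar[OF sH, of x] by (simp only: comp_apply fun_diff_def id_apply)
  have bP: "bounded_clinear (id + T11)" and bM: "bounded_clinear (id - T11)"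
    and bWP: "bounded_clinear (id + W)" and bWM: "bounded_clinear (id - W)"
    using bT W(1) by blast+
  have VDm: "J2 \<circ> - T21 = (- V) \<circ> D\<^sub>1" using CV by (simp add: fun_eq_iff j2s)
  note SD = op_sign_involution[OF sH] sign_sqrt_abs_commute[OF sH]
  have AXp: "J1 ((id + T11) ((id - T11) x)) = D\<^sub>1 (S\<^sub>1 (D\<^sub>1 x))" for x
    unfolding polar by (simp add: ts)
  have AXm: "J1 ((id - T11) ((id + T11) x)) = D\<^sub>1 (S\<^sub>1 (D\<^sub>1 x))" for x
    unfolding polar by (simp add: ts)
  have YDp: "(id - W) (D\<^sub>1 x) = D\<^sub>1 ((id - T11) x)" for x by (simp add: W ds)
  have YDm: "(id + W) (D\<^sub>1 x) = D\<^sub>1 ((id + T11) x)" for x by (simp add: W ds)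
  have bVm: "bounded_clinear (- V)" and V0m: "\<forall>x. D\<^sub>1 x = 0 \<longrightarrow> (- V) x = 0" using V by auto
  have bT21m: "bounded_clinear (- T21)" using T21 by blast
  let ?Zp = "V \<circ> (id - W) \<circ> S\<^sub>1 \<circ> cadj V" and ?Zm = "V \<circ> (id + W) \<circ> S\<^sub>1 \<circ> cadj V"
  have Zm: "- V \<circ> (id + W) \<circ> S\<^sub>1 \<circ> cadj (- V) = ?Zm"
    by (simp add: cadj_uminus[OF V(1)] fun_eq_iff clinear_simps[OF bS] clinear_simps[OF bWP] clinear_simps[OF V(1)]
        del: plus_fun_apply id_apply)
  have km: "kadj J1 J2 (- T21) = - k21"
    by (simp add: kadj_def cadj_uminus[OF T21] fun_eq_iff j1s)
  note plus = minimal_completion_formula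
      [where A="id + T11" and B=T21 and V=V and D=D\<^sub>1 and X="id - T11" and S=S\<^sub>1 and Y="id - W",
        OF J1 J2 bP sP fin(1) T21 CV bM D\<^sub>1 bS SD AXp bWM YDp V(1,3)]
  note minus = minimal_completion_formula
      [where A="id - T11" and B="- T21" and V="- V" and D=D\<^sub>1 and X="id + T11" and S=S\<^sub>1 and Y="id + W",
        OF J1 J2 bM sM fin(2) bT21m VDm bP D\<^sub>1 bS SD AXm bWP YDm bVm V0m,
      unfolded Zm km]
  have Ext: "T \<in> Ext J1 J2 T11 T21 \<longleftrightarrow> (\<exists>Z. T = block_op T11 k21 T21 Z \<and> selfadjoint (J2 \<circ> Z) \<and>
      (\<forall>f. inner (?Zp f) f \<le> inner (J2 (f + Z f)) f) \<and>
      (\<forall>f. inner (?Zm f) f \<le> inner (J2 (f - Z f)) f))" (is "_ \<longleftrightarrow> ?R T") for T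
  proof
    assume T: "T \<in> Ext J1 J2 T11 T21"
    then have k: "krein_selfadjoint J T" "\<And>x. T (x, 0) = T1 x" by (auto simp: Ext_def)
    obtain Z where Z: "T = block_op T11 k21 T21 Z" "selfadjoint (J2 \<circ> Z)"
      using krein_selfadjoint_block_form[OF J1 J2 k T21] by blast
    have "id + T \<in> completion_solutions J1 J2 (id + T11) T21"
      and "id - T \<in> completion_solutions J1 J2 (id - T11) (- T21)"
      using T by (auto simp: Ext_def)
    then obtain Yp Ym where Yp: "id + T = block_op (id + T11) k21 T21 Yp"
        "\<forall>f. inner (?Zp f) f \<le> inner (J2 (Yp f)) f"
      and Ym: "id - T = block_op (id - T11) (- k21) (- T21) Ym"
        "\<forall>f. inner (?Zm f) f \<le> inner (J2 (Ym f)) f"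
      unfolding plus(1) minus(1) by blast
    have "Yp = id + Z"
      using Yp(1) unfolding Z id_plus_block by (rule block_op_inject[OF sym])
    then have p: "Yp f = f + Z f" for f by simp
    have "Ym = id - Z"
      using Ym(1) unfolding Z id_minus_block by (rule block_op_inject[OF sym])
    then have m: "Ym f = f - Z f" for f by simp
    show "?R T" using Z Yp(2) Ym(2) unfolding p m by blast
  next
    assume "?R T"
    then obtain Z where Z: "T = block_op T11 k21 T21 Z" "selfadjoint (J2 \<circ> Z)"
      "\<And>f. inner (?Zp f) f \<le> inner (J2 (f + Z f)) f" "\<And>f. inner (?Zm f) f \<le> inner (J2 (f - Z f)) f"
      by blast
    have sT: "selfadjoint (J1 \<circ> T11)" using T11 krein_selfadjoint_iff[OF J1] by blast
    have s1: "selfadjoint (J2 \<circ> (id + Z))" and s2: "selfadjoint (J2 \<circ> (id - Z))"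
    proof -
      have "J2 \<circ> (id + Z) = J2 + (J2 \<circ> Z)" "J2 \<circ> (id - Z) = J2 - (J2 \<circ> Z)"
        by (simp_all add: fun_eq_iff j2s)
      then show "selfadjoint (J2 \<circ> (id + Z))" "selfadjoint (J2 \<circ> (id - Z))"
        using selfadjoint_plus[OF j2(1) Z(2)] selfadjoint_diff[OF j2(1) Z(2)] by simp_all
    qed
    have Z0: "Z 0 = 0" using bounded_clinear_0[OF selfadjoint_bounded[OF Z(2)]] by (metis comp_apply j2(2) j2s(5))
    have "k21 0 = 0"
      by (simp add: kadj_def j1s j2s clinear_simps[OF bounded_clinear_cadj[OF T21]])
    then have "T (x, 0) = T1 x" for x by (simp add: Z(1) block_op_apply col_op_def Z0)
    moreover have "krein_selfadjoint J T"
      unfolding Z(1) by (rule krein_selfadjoint_block[OF J1 J2 bT sT T21 Z(2)])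
    moreover have "id + T \<in> completion_solutions J1 J2 (id + T11) T21"
      unfolding plus(1) Z(1) id_plus_block using s1 Z(3) by (intro exI[of _ "id + Z"]) simp
    moreover have "id - T \<in> completion_solutions J1 J2 (id - T11) (- T21)"
      unfolding minus(1) Z(1) id_minus_block using s2 Z(4) by (intro exI[of _ "id - Z"]) simp
    ultimately show "T \<in> Ext J1 J2 T11 T21" by (simp add: Ext_def)
  qed
  have cVD: "cadj C = D\<^sub>1 \<circ> cadj V"
    unfolding CV using D\<^sub>1 cadj_comp[OF V(1) bD] by (simp add: selfadjoint_def)
  have "nu_minus (block_op H\<^sub>1 (D\<^sub>1 \<circ> cadj V) (V \<circ> D\<^sub>1) J2) = nu_minus H\<^sub>1"
  proof -
    obtain \<delta> where d: "\<delta> > 0" "\<And>x. neg_proj H\<^sub>1 x = x \<Longrightarrow> inner (H\<^sub>1 x) x \<le> - \<delta> * (norm x)\<^sup>2"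
      using neg_proj_gap[OF sH finH] by metis
    have "nu_minus H\<^sub>1 \<le> nu_minus (block_op H\<^sub>1 (cadj C) C J2)"
      by (rule nu_minus_block_ge[OF sH bC j2(1) finH d])
    then show ?thesis using blk by (simp only: cVD CV[symmetric])
  qed
  moreover have "H\<^sub>1 (id x) = D\<^sub>1 (S\<^sub>1 (D\<^sub>1 x))" for x by (simp only: id_apply sqrt_abs_polar[OF sH])
  \<comment> \<open>Third use of \<open>completion_index\<close>, now over \<open>H\<^sub>1\<close>
    itself. The corners of the two minimal completions add up to twice this operator, so the bound
    by \<open>J2\<close> is their compatibility.\<close>
  ultimately have VSV: "inner ((V \<circ> id \<circ> S\<^sub>1 \<circ> cadj V) f) f \<le> inner (J2 f) f" for f
    using completion_index[OF sH finH bounded_clinear_id D\<^sub>1 bS SD _ bounded_clinear_id _ V(1,3) j2(1)]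
    by simp
  have sum: "inner (?Zp f) f + inner (?Zm f) f \<le> 2 * inner (J2 f) f" for f
  proof -
    have "?Zp f + ?Zm f = 2 *\<^sub>R (V \<circ> id \<circ> S\<^sub>1 \<circ> cadj V) f"
      by (simp add: clinear_simps[OF V(1)] scaleR_2)
    then have "inner (?Zp f) f + inner (?Zm f) f = 2 * inner ((V \<circ> id \<circ> S\<^sub>1 \<circ> cadj V) f) f"
      by (metis inner_add_left inner_scaleR_left)
    then show ?thesis using VSV[of f] by simp
  qed
  show ?thesis
    by (rule that[OF V(1) W(1) op_graph_clos_comp_mp_inverse[OF D\<^sub>1 V] CV link_op_eq[OF J1 T11 W]
          plus(2) minus(2) Ext sum plus(4) minus(4)])
qed

end

end

theorem theorem5p7:
  fixes J1 :: "'a::complex_hilbert \<Rightarrow> 'a"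
    and J2 :: "'b::complex_hilbert \<Rightarrow> 'b"
    and T11 :: "'a \<Rightarrow> 'a" and T21 :: "'a \<Rightarrow> 'b"
    and J :: "'a \<times> 'b \<Rightarrow> 'a \<times> 'b"
    and T1 :: "'a \<Rightarrow> 'a \<times> 'b"
    and \<kappa> :: nat
  defines "J \<equiv> diag_symmetry J1 J2"
    and "T1 \<equiv> col_op T11 T21"
  assumes "pontryagin_space J1" and "pontryagin_space J2"
    and "bounded_clinear T1"
    and "krein_selfadjoint J1 T11"
    and "krein_nu J1 (id - (T11 \<circ> T11)) = enat \<kappa>"
  shows
    "((\<exists>T \<in> Ext J1 J2 T11 T21. krein_nu J (id - (T \<circ> T)) + nu_minus J2 = enat \<kappa>) \<longleftrightarrow>
        krein_nu J1 (id - (T11 \<circ> T11)) =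
          krein_nu J1 (id - (kadj J1 J T1 \<circ> T1)) + nu_minus J2) \<and>
     (krein_nu J1 (id - (T11 \<circ> T11)) =
          krein_nu J1 (id - (kadj J1 J T1 \<circ> T1)) + nu_minus J2 \<longrightarrow>
       (let A_plus = minimal_completion J1 J2 (id + T11) T21;
            A_minus = minimal_completion J1 J2 (id - T11) (- T21);
            T_m = A_plus - id;
            T_M = id - A_minus;
            D = op_sqrt (op_abs (id - (T11 \<circ> T11)));
            L = link_op J1 T11;
            J11 = op_sign (J1 \<circ> (id - (T11 \<circ> T11)))
        in
          \<comment> \<open>(i)\<close>
          (is_minimal_completion J1 J2 (id + T11) T21 A_plus \<and>
           is_minimal_completion J1 J2 (id - T11) (- T21) A_minus) \<and>
          \<comment> \<open>(ii)\<close>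
          (T_m \<in> Ext J1 J2 T11 T21 \<and> T_M \<in> Ext J1 J2 T11 T21) \<and>
          \<comment> \<open>(iii)\<close>
          (\<exists>V :: 'a \<Rightarrow> 'b.
             bounded_clinear V \<and> op_graph V = clos_comp_mp_inverse (J2 \<circ> T21) D \<and>
             T_m = block_op T11 (J1 \<circ> D \<circ> cadj V) (J2 \<circ> V \<circ> D)
                     (- id + (J2 \<circ> V \<circ> (id - (cadj L \<circ> J1)) \<circ> J11 \<circ> cadj V)) \<and>
             T_M = block_op T11 (J1 \<circ> D \<circ> cadj V) (J2 \<circ> V \<circ> D)
                     (id - (J2 \<circ> V \<circ> (id + (cadj L \<circ> J1)) \<circ> J11 \<circ> cadj V))) \<and>
          \<comment> \<open>(iv)\<close>
          (\<forall>T. T \<in> Ext J1 J2 T11 T21 \<longleftrightarrow>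
               krein_selfadjoint J T \<and> krein_le J T_m T \<and> krein_le J T T_M) \<and>
          \<comment> \<open>(v)\<close>
          (T_min J1 J2 (- T11) (- T21) = - T_M \<and>
           T_max J1 J2 (- T11) (- T21) = - T_m)))"
proof -
  have J1: "fundamental_symmetry J1" and J2: "fundamental_symmetry J2"
    and fin1: "nu_minus J1 \<noteq> \<infinity>"
    using assms(3,4) by (auto simp: pontryagin_space_def)
  have T21: "bounded_clinear T21" using assms(5) unfolding T1_def by (rule bounded_clinear_col_opD)
  note T11 = assms(6)
  note j1 = fundamental_symmetryD[OF J1] and j2 = fundamental_symmetryD[OF J2]
  note j2s = clinear_simps[OF selfadjoint_bounded[OF j2(1)]]
  have bT: "bounded_clinear T11" using T11 by (simp add: krein_selfadjoint_def)
  let ?H = "J1 \<circ> (id - (T11 \<circ> T11))" and ?H' = "J1 \<circ> (id - (kadj J1 J T1 \<circ> T1))"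
  have nuH: "nu_minus ?H = enat \<kappa>" using assms(7) by (simp only: krein_nu_def)
  then have finH: "nu_minus ?H \<noteq> \<infinity>" by simp
  have nuJ: "nu_minus J = nu_minus J1 + nu_minus J2"
    unfolding J_def by (rule nu_minus_diag_symmetry[OF j1(1) j2(1)])
  have Ext_index: "nu_minus (J \<circ> (id - (T \<circ> T))) + nu_minus J2 = enat \<kappa>"
    if "T \<in> Ext J1 J2 T11 T21" for T
  proof -
    \<comment> \<open>Finiteness of this index is what allows it to be cancelled in the extended
      naturals.\<close>
    obtain k where k: "nu_minus J1 = enat k" using fin1 by auto
    have "enat k + nu_minus J2 + nu_minus (J \<circ> (id - (T \<circ> T))) = enat k + enat \<kappa>"
      using Ext_negative_index(1)[OF J1 J2 T11 T21 that] unfolding J_def[symmetric] nuJ nuH k .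
    then show ?thesis
      by (cases "nu_minus J2"; cases "nu_minus (J \<circ> (id - (T \<circ> T)))") auto
  qed
  have necessary: "nu_minus ?H = nu_minus ?H' + nu_minus J2" if "T \<in> Ext J1 J2 T11 T21" for T
  proof (rule antisym)
    show "nu_minus ?H \<le> nu_minus ?H' + nu_minus J2"
      unfolding J_def T1_def by (rule nu_one_minus_square_le[OF J1 J2 T11 T21])
    have "nu_minus ?H' \<le> nu_minus (J \<circ> (id - (T \<circ> T)))"
      using Ext_negative_index(2)[OF J1 J2 T11 T21 that] unfolding J_def[symmetric] T1_def[symmetric] .
    then show "nu_minus ?H' + nu_minus J2 \<le> nu_minus ?H"
      unfolding nuH Ext_index[OF that, symmetric] by (rule add_right_mono)
  qed
  let ?D = "op_sqrt (op_abs (id - (T11 \<circ> T11)))" and ?L = "link_op J1 T11"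
  let ?S = "op_sign ?H"
  let ?Ap = "minimal_completion J1 J2 (id + T11) T21"
  let ?Am = "minimal_completion J1 J2 (id - T11) (- T21)"
  have main: "(is_minimal_completion J1 J2 (id + T11) T21 ?Ap \<and>
           is_minimal_completion J1 J2 (id - T11) (- T21) ?Am) \<and>
          (?Ap - id \<in> Ext J1 J2 T11 T21 \<and> id - ?Am \<in> Ext J1 J2 T11 T21) \<and>
          (\<exists>V :: 'a \<Rightarrow> 'b.
             bounded_clinear V \<and> op_graph V = clos_comp_mp_inverse (J2 \<circ> T21) ?D \<and>
             ?Ap - id = block_op T11 (J1 \<circ> ?D \<circ> cadj V) (J2 \<circ> V \<circ> ?D)
                     (- id + (J2 \<circ> V \<circ> (id - (cadj ?L \<circ> J1)) \<circ> ?S \<circ> cadj V)) \<and>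
             id - ?Am = block_op T11 (J1 \<circ> ?D \<circ> cadj V) (J2 \<circ> V \<circ> ?D)
                     (id - (J2 \<circ> V \<circ> (id + (cadj ?L \<circ> J1)) \<circ> ?S \<circ> cadj V))) \<and>
          (\<forall>T. T \<in> Ext J1 J2 T11 T21 \<longleftrightarrow>
               krein_selfadjoint J T \<and> krein_le J (?Ap - id) T \<and> krein_le J T (id - ?Am))"
    if index: "nu_minus ?H = nu_minus ?H' + nu_minus J2"
  proof -
    have Deq: "?D = op_sqrt (op_abs ?H)" by (rule sqrt_abs_one_minus_square[OF J1 T11])
    let ?k = "kadj J1 J2 T21"
    obtain V W where V: "bounded_clinear V" and W: "bounded_clinear W"
      and graph: "op_graph V = clos_comp_mp_inverse (J2 \<circ> T21) ?D" and CV: "J2 \<circ> T21 = V \<circ> ?D"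
      and L: "?L = J1 \<circ> cadj W"
      and minp: "is_minimal_completion J1 J2 (id + T11) T21
        (block_op (id + T11) ?k T21 (J2 \<circ> (V \<circ> (id - W) \<circ> ?S \<circ> cadj V)))"
      and minm: "is_minimal_completion J1 J2 (id - T11) (- T21)
        (block_op (id - T11) (- ?k) (- T21) (J2 \<circ> (V \<circ> (id + W) \<circ> ?S \<circ> cadj V)))"
      and Ext: "\<And>T. T \<in> Ext J1 J2 T11 T21 \<longleftrightarrow> (\<exists>Z. T = block_op T11 ?k T21 Z \<and> selfadjoint (J2 \<circ> Z) \<and>
        (\<forall>f. inner ((V \<circ> (id - W) \<circ> ?S \<circ> cadj V) f) f \<le> inner (J2 (f + Z f)) f) \<and>
        (\<forall>f. inner ((V \<circ> (id + W) \<circ> ?S \<circ> cadj V) f) f \<le> inner (J2 (f - Z f)) f))"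
      and sum: "\<And>f. inner ((V \<circ> (id - W) \<circ> ?S \<circ> cadj V) f) f
          + inner ((V \<circ> (id + W) \<circ> ?S \<circ> cadj V) f) f \<le> 2 * inner (J2 f) f"
      and sp: "selfadjoint (V \<circ> (id - W) \<circ> ?S \<circ> cadj V)"
      and sm: "selfadjoint (V \<circ> (id + W) \<circ> ?S \<circ> cadj V)"
      using extremal_extensions[OF J1 J2 T11 T21 fin1 finH index[unfolded J_def T1_def]]
      unfolding Deq by blast
    define Zp where "Zp = V \<circ> (id - W) \<circ> ?S \<circ> cadj V"
    define Zm where "Zm = V \<circ> (id + W) \<circ> ?S \<circ> cadj V"
    note minp = minp[folded Zp_def] and minm = minm[folded Zm_def] and sum = sum[folded Zp_def Zm_def]
      and Ext = Ext[folded Zp_def Zm_def] and sp = sp[folded Zp_def] and sm = sm[folded Zm_def]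
    have sJT: "inner (J1 (T11 x)) y = inner x (J1 (T11 y))" for x y
    proof -
      have "selfadjoint (J1 \<circ> T11)" using T11 krein_selfadjoint_iff[OF J1] by blast
      from selfadjoint_inner[OF this, of x y] show ?thesis by simp
    qed
    have bP: "bounded_clinear (id + T11)" and bM: "bounded_clinear (id - T11)"
      and bT21m: "bounded_clinear (- T21)" using bT T21 by blast+
    have Ap: "?Ap = block_op (id + T11) ?k T21 (J2 \<circ> Zp)"
      by (rule minimal_completion_unique[OF J1 J2 bP selfadjoint_one_plus[OF j1(1) bT sJT] T21 minp])
    have Am: "?Am = block_op (id - T11) (- ?k) (- T21) (J2 \<circ> Zm)"
      by (rule minimal_completion_unique[OF J1 J2 bM selfadjoint_one_minus[OF j1(1) bT sJT] bT21m minm])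
    have Tm: "?Ap - id = block_op T11 ?k T21 (- id + (J2 \<circ> Zp))"
      unfolding Ap by (auto simp: fun_eq_iff block_op_apply)
    have TM: "id - ?Am = block_op T11 ?k T21 (id - (J2 \<circ> Zm))"
      unfolding Am by (auto simp: fun_eq_iff block_op_apply)
    have Zm_eq: "J2 \<circ> (- id + (J2 \<circ> Zp)) = Zp - J2" and ZM_eq: "J2 \<circ> (id - (J2 \<circ> Zm)) = J2 - Zm"
      by (simp_all add: fun_eq_iff j2s j2(2))
    \<comment> \<open>For T_m the condition from I + T holds with equality, and the one from I - T
      is the compatibility \<open>sum\<close>; for T_M the roles are exchanged.\<close>
    have Tm_Ext: "?Ap - id \<in> Ext J1 J2 T11 T21"
      unfolding Ext Tm
    proof (intro exI conjI allI)
      show "selfadjoint (J2 \<circ> (- id + (J2 \<circ> Zp)))" unfolding Zm_eq by (intro selfadjoint_diff sp j2(1))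
      show "inner (Zp f) f \<le> inner (J2 (f + (- id + (J2 \<circ> Zp)) f)) f" for f by (simp add: j2(2))
      show "inner (Zm f) f \<le> inner (J2 (f - (- id + (J2 \<circ> Zp)) f)) f" for f
        using sum[of f] by (simp add: j2s j2(2) inner_diff_left inner_add_left)
    qed (rule refl)
    have TM_Ext: "id - ?Am \<in> Ext J1 J2 T11 T21"
      unfolding Ext TM
    proof (intro exI conjI allI)
      show "selfadjoint (J2 \<circ> (id - (J2 \<circ> Zm)))" unfolding ZM_eq by (intro selfadjoint_diff sm j2(1))
      show "inner (Zp f) f \<le> inner (J2 (f + (id - (J2 \<circ> Zm)) f)) f" for f
        using sum[of f] by (simp add: j2s j2(2) inner_diff_left inner_add_left)
      show "inner (Zm f) f \<le> inner (J2 (f - (id - (J2 \<circ> Zm)) f)) f" for f by (simp add: j2(2))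
    qed (rule refl)
    have Tm_le: "krein_le J (?Ap - id) (block_op T11 ?k T21 Z) \<longleftrightarrow>
        (\<forall>f. inner (Zp f) f \<le> inner (J2 (f + Z f)) f)" for Z
      unfolding Tm J_def krein_le_block[OF J1 J2]
      by (simp add: j2s j2(2) inner_diff_left inner_add_left diff_le_eq add.commute)
    have le_TM: "krein_le J (block_op T11 ?k T21 Z) (id - ?Am) \<longleftrightarrow>
        (\<forall>f. inner (Zm f) f \<le> inner (J2 (f - Z f)) f)" for Z
      unfolding TM J_def krein_le_block[OF J1 J2]
      by (simp add: j2s j2(2) inner_diff_left inner_add_left) (metis add.commute le_diff_eq)
    have iv: "T \<in> Ext J1 J2 T11 T21 \<longleftrightarrow>
        krein_selfadjoint J T \<and> krein_le J (?Ap - id) T \<and> krein_le J T (id - ?Am)" for T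
    proof
      assume T: "T \<in> Ext J1 J2 T11 T21"
      then have "krein_selfadjoint J T" by (simp add: Ext_def J_def)
      moreover obtain Z where "T = block_op T11 ?k T21 Z"
        "\<forall>f. inner (Zp f) f \<le> inner (J2 (f + Z f)) f" "\<forall>f. inner (Zm f) f \<le> inner (J2 (f - Z f)) f"
        using T unfolding Ext by blast
      ultimately show "krein_selfadjoint J T \<and> krein_le J (?Ap - id) T \<and> krein_le J T (id - ?Am)"
        using Tm_le le_TM by blast
    next
      assume a: "krein_selfadjoint J T \<and> krein_le J (?Ap - id) T \<and> krein_le J T (id - ?Am)"
      have fJ: "fundamental_symmetry J" unfolding J_def by (rule fundamental_symmetry_diag[OF J1 J2])
      note js = clinear_simps[OF selfadjoint_bounded[OF fundamental_symmetryD(1)[OF fJ]]]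
      have sT: "selfadjoint (J \<circ> T)" using a krein_selfadjoint_iff[OF fJ] by blast
      have "krein_selfadjoint J (?Ap - id)" using Tm_Ext by (simp add: Ext_def J_def)
      then have sTm: "selfadjoint (J \<circ> (?Ap - id))" using krein_selfadjoint_iff[OF fJ] by blast
      \<comment> \<open>\<open>T\<close> is only assumed to lie between the two bounds, so that it
        extends T1 has to be shown. T_m and T_M agree on the first summand, hence the nonnegative
        form of T - T_m vanishes there, and a nonnegative operator annihilates the vectors on which
        its form is zero.\<close>
      define G where "G = (J \<circ> T) - (J \<circ> (?Ap - id))"
      have G: "G z = J (T z - (?Ap - id) z)" for z by (simp add: G_def js)
      have nonneg: "0 \<le> inner (J ((T - (?Ap - id)) z)) z" "0 \<le> inner (J (((id - ?Am) - T) z)) z" for z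
        using a unfolding krein_le_def krein_inner_def inner_eq_Re_cinner by blast+
      have nG: "nonneg_op G"
        unfolding nonneg_op_inner
      proof (intro conjI allI)
        show "selfadjoint G" unfolding G_def by (intro selfadjoint_diff sT sTm)
        show "0 \<le> inner (G z) z" for z using nonneg(1)[of z] unfolding G by (simp only: minus_apply)
      qed
      have same: "(?Ap - id) (x, 0) = (id - ?Am) (x, 0)" for x
        unfolding Tm TM
        using bounded_clinear_0[OF selfadjoint_bounded[OF sp]] bounded_clinear_0[OF selfadjoint_bounded[OF sm]]
        by (simp add: block_op_apply j2s)
      have "T (x, 0) = (?Ap - id) (x, 0)" for x
      proof -
        have "inner (J (((id - ?Am) - T) (x, 0))) (x, 0) = - inner (G (x, 0)) (x, 0)"
          unfolding G minus_apply[of "id - ?Am"] same[symmetric] by (simp add: js inner_diff_left)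
        then have "inner (G (x, 0)) (x, 0) = 0"
          using nonneg(2)[of "(x, 0)"] nG unfolding nonneg_op_inner by (metis antisym neg_0_le_iff_le)
        then have "G (x, 0) = 0" by (rule nonneg_op_eq_0[OF nG])
        then have "J (J (T (x, 0) - (?Ap - id) (x, 0))) = J 0" unfolding G by simp
        then show ?thesis by (simp only: fundamental_symmetryD(2)[OF fJ] js) simp
      qed
      then have "T (x, 0) = col_op T11 T21 x" for x
        using Tm_Ext by (simp add: Ext_def)
      then obtain Z where Z: "T = block_op T11 ?k T21 Z" "selfadjoint (J2 \<circ> Z)"
        using krein_selfadjoint_block_form[OF J1 J2 _ _ T21] a unfolding J_def by blast
      then show "T \<in> Ext J1 J2 T11 T21"
        unfolding Ext using a Tm_le le_TM by (intro exI[of _ Z]) blast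
    qed
    \<comment> \<open>The link operator is J1 \<open>cadj W\<close>; its adjoint times J1 is
      therefore \<open>W\<close>, which brings the corners into the stated form.\<close>
    have cL: "cadj ?L \<circ> J1 = W"
    proof -
      have "cadj ?L = W \<circ> J1"
        unfolding L cadj_comp[OF selfadjoint_bounded[OF j1(1)] bounded_clinear_cadj[OF W]] cadj_cadj[OF W]
        using j1(1) by (simp add: selfadjoint_def)
      then show ?thesis by (simp add: fun_eq_iff j1(2))
    qed
    have sD: "selfadjoint ?D"
      unfolding Deq by (rule selfadjoint_sqrt_abs[OF selfadjoint_one_minus_square[OF j1(1) bT sJT]])
    have off: "J1 \<circ> ?D \<circ> cadj V = ?k"
    proof -
      have "J1 \<circ> ?k = ?D \<circ> cadj V"
        unfolding cadj_symmetry_comp[OF J1 J2 T21, symmetric] CV cadj_comp[OF V selfadjoint_bounded[OF sD]]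
        using sD by (simp add: selfadjoint_def)
      then have "J1 \<circ> (J1 \<circ> ?k) = J1 \<circ> ?D \<circ> cadj V" by (simp add: comp_assoc)
      then show ?thesis by (simp add: fun_eq_iff j1(2))
    qed
    have col: "J2 \<circ> V \<circ> ?D = T21"
    proof -
      have "J2 \<circ> (J2 \<circ> T21) = J2 \<circ> V \<circ> ?D" unfolding CV by (simp add: comp_assoc)
      then show ?thesis by (simp add: fun_eq_iff j2(2))
    qed
    have Zp_eq: "J2 \<circ> V \<circ> (id - (cadj ?L \<circ> J1)) \<circ> ?S \<circ> cadj V = J2 \<circ> Zp"
      and Zm_eq': "J2 \<circ> V \<circ> (id + (cadj ?L \<circ> J1)) \<circ> ?S \<circ> cadj V = J2 \<circ> Zm"
      unfolding cL Zp_def Zm_def by (simp_all only: comp_assoc)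
    have iii: "\<exists>V :: 'a \<Rightarrow> 'b.
             bounded_clinear V \<and> op_graph V = clos_comp_mp_inverse (J2 \<circ> T21) ?D \<and>
             ?Ap - id = block_op T11 (J1 \<circ> ?D \<circ> cadj V) (J2 \<circ> V \<circ> ?D)
                     (- id + (J2 \<circ> V \<circ> (id - (cadj ?L \<circ> J1)) \<circ> ?S \<circ> cadj V)) \<and>
             id - ?Am = block_op T11 (J1 \<circ> ?D \<circ> cadj V) (J2 \<circ> V \<circ> ?D)
                     (id - (J2 \<circ> V \<circ> (id + (cadj ?L \<circ> J1)) \<circ> ?S \<circ> cadj V))"
      by (rule exI[of _ V]) (unfold off col Zp_eq Zm_eq', intro conjI V graph Tm TM)
    have i: "is_minimal_completion J1 J2 (id + T11) T21 ?Ap"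
      "is_minimal_completion J1 J2 (id - T11) (- T21) ?Am"
      unfolding Ap Am by (rule minp, rule minm)
    show ?thesis by (intro conjI i Tm_Ext TM_Ext iii allI iv)
  qed
  \<comment> \<open>Changing the sign of T1 literally exchanges the two completion problems.\<close>
  have v: "T_min J1 J2 (- T11) (- T21) = - (id - ?Am)" "T_max J1 J2 (- T11) (- T21) = - (?Ap - id)"
    by (simp_all add: T_min_def T_max_def)
  have sufficient: "\<exists>T \<in> Ext J1 J2 T11 T21. krein_nu J (id - (T \<circ> T)) + nu_minus J2 = enat \<kappa>"
    if "nu_minus ?H = nu_minus ?H' + nu_minus J2"
    using main[OF that] Ext_index unfolding krein_nu_def by blast
  show ?thesis
    unfolding Let_def
  proof (intro conjI iffI impI, goal_cases)
    case 1
    then show ?case using necessary unfolding krein_nu_def by blast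
  next
    case 2
    then show ?case using sufficient unfolding krein_nu_def by blast
  qed (insert main v, unfold krein_nu_def, blast+)
qed

end
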